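(* Let $(\mathcal A,\mathcal A_* )$ be a faithful dual Banach algebra. Then there is a predual for $M(\mathcal A)$ which turns $M(\mathcal A)$ into a dual Banach algebra, and which can be chosen so that, for every bounded net $(a_\alpha)$ in $\mathcal A$ and every $a\in\mathcal A$, $a_\alpha\to a$ weak$^*$ in $\mathcal A$ if and only if $a_\alpha\to a$ weak$^*$ in $M(\mathcal A)$. The resulting weak$^*$-topology on $M(\mathcal A)$ is the unique weak$^*$-topology (turning $M(\mathcal A)$ into a dual Banach algebra) with this property.
   Context: A Banach algebra $\mathcal A$ is faithful (as a bimodule over itself) if $x\in\mathcal A$ and $axb=0$ for all $a,b\in\mathcal A$ imply $x=0$. A multiplier of $\mathcal A$ is a pair $(L,R)$ of maps $\mathcal A\to\mathcal A$ with $aL(b)=R(a)b$ for all $a,b\in\mathcal A$; when $\mathcal A$ is faithful, $L,R$ are automatically linear and bounded. $M(\mathcal A)$ is the set of multipliers, a Banach algebra with norm $\|(L,R)\|=\max(\|L\|,\|R\|)$ and product $(L,R)(L',R')=(LL',R'R)$. $\mathcal A$ is regarded as a subalgebra of $M(\mathcal A)$ via $a\mapsto(L_a,R_a)$, $L_a(b)=ab$, $R_a(b)=ba$ (injective by faithfulness). A dual Banach algebra is a Banach algebra $\mathcal A$ that is (isometrically) the dual $(\mathcal A_* )^*$ of a Banach space $\mathcal A_*$ such that multiplication is separately weak$^*$-continuous. A predual of $M(\mathcal A)$ is a Banach space whose dual is isometrically identified with $M(\mathcal A)$. *)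

theory Defs
  imports
    "HOL-Analysis.Analysis"
    "HOL-Algebra.Module"
begin

section \<open>Complex Banach spaces and Banach algebras with explicit carriers\<close>

text \<open>
  The record type of modules inherits \<^const>\<open>mult\<close> and \<^const>\<open>one\<close> from rings. For Banach
  spaces both fields are irrelevant. Banach algebras need not be unital, so they ignore
  \<^const>\<open>one\<close>.
\<close>

record 'a normed_module = "(complex, 'a) module" +
  nrm :: "'a \<Rightarrow> real"

definition complex_ring :: "complex ring" where
  "complex_ring = \<lparr>carrier = UNIV, mult = (*), one = 1, zero = 0, add = (+)\<rparr>"

locale banach_space = module complex_ring V for V :: "('a, 'm) normed_module_scheme" (structure) +
  assumes nrm_eq_zero: "x \<in> carrier V \<Longrightarrow> nrm V x = 0 \<Longrightarrow> x = \<zero>"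
    and nrm_smult: "x \<in> carrier V \<Longrightarrow> nrm V (c \<odot> x) = cmod c * nrm V x"
    and nrm_triangle: "x \<in> carrier V \<Longrightarrow> y \<in> carrier V \<Longrightarrow> nrm V (x \<oplus> y) \<le> nrm V x + nrm V y"
    and complete: "(\<forall>n::nat. s n \<in> carrier V) \<Longrightarrow>
        (\<forall>e>0. \<exists>N. \<forall>m\<ge>N. \<forall>n\<ge>N. nrm V (s m \<ominus> s n) < e) \<Longrightarrow>
        \<exists>l\<in>carrier V. (\<lambda>n. nrm V (s n \<ominus> l)) \<longlonglongrightarrow> 0"

locale banach_algebra = banach_space A for A :: "('a, 'm) normed_module_scheme" (structure) +
  assumes mult_closed: "x \<in> carrier A \<Longrightarrow> y \<in> carrier A \<Longrightarrow> x \<otimes> y \<in> carrier A"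
    and mult_assoc: "x \<in> carrier A \<Longrightarrow> y \<in> carrier A \<Longrightarrow> z \<in> carrier A \<Longrightarrow>
        (x \<otimes> y) \<otimes> z = x \<otimes> (y \<otimes> z)"
    and distrib_right: "x \<in> carrier A \<Longrightarrow> y \<in> carrier A \<Longrightarrow> z \<in> carrier A \<Longrightarrow>
        (x \<oplus> y) \<otimes> z = x \<otimes> z \<oplus> y \<otimes> z"
    and distrib_left: "x \<in> carrier A \<Longrightarrow> y \<in> carrier A \<Longrightarrow> z \<in> carrier A \<Longrightarrow>
        z \<otimes> (x \<oplus> y) = z \<otimes> x \<oplus> z \<otimes> y"
    and smult_mult_left: "x \<in> carrier A \<Longrightarrow> y \<in> carrier A \<Longrightarrow> (c \<odot> x) \<otimes> y = c \<odot> (x \<otimes> y)"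
    and smult_mult_right: "x \<in> carrier A \<Longrightarrow> y \<in> carrier A \<Longrightarrow> x \<otimes> (c \<odot> y) = c \<odot> (x \<otimes> y)"
    and nrm_mult: "x \<in> carrier A \<Longrightarrow> y \<in> carrier A \<Longrightarrow> nrm A (x \<otimes> y) \<le> nrm A x * nrm A y"

definition faithful :: "('a, 'm) normed_module_scheme \<Rightarrow> bool" where
  "faithful A \<longleftrightarrow> (\<forall>x\<in>carrier A.
     (\<forall>a\<in>carrier A. \<forall>b\<in>carrier A. a \<otimes>\<^bsub>A\<^esub> x \<otimes>\<^bsub>A\<^esub> b = \<zero>\<^bsub>A\<^esub>) \<longrightarrow> x = \<zero>\<^bsub>A\<^esub>)"

section \<open>Dual spaces, preduals and weak* topologies\<close>

text \<open>Maps on a carrier are represented by their extensional versions, so that equality of maps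
  is equality on the carrier.\<close>

definition op_norm :: "('a, 'm) normed_module_scheme \<Rightarrow> ('b \<Rightarrow> real) \<Rightarrow> ('a \<Rightarrow> 'b) \<Rightarrow> real" where
  "op_norm V n f = Sup {n (f x) |x. x \<in> carrier V \<and> nrm V x \<le> 1}"

definition bounded_functionals :: "('e, 'm) normed_module_scheme \<Rightarrow> ('e \<Rightarrow> complex) set" where
  "bounded_functionals E = {f \<in> extensional (carrier E).
     (\<forall>x\<in>carrier E. \<forall>y\<in>carrier E. f (x \<oplus>\<^bsub>E\<^esub> y) = f x + f y) \<and>
     (\<forall>c. \<forall>x\<in>carrier E. f (c \<odot>\<^bsub>E\<^esub> x) = c * f x) \<and>
     (\<exists>K. \<forall>x\<in>carrier E. cmod (f x) \<le> K * nrm E x)}"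

definition dual_space :: "('e, 'm) normed_module_scheme \<Rightarrow> ('e \<Rightarrow> complex) normed_module" where
  "dual_space E = \<lparr>carrier = bounded_functionals E, mult = undefined, one = undefined,
     zero = (\<lambda>x\<in>carrier E. 0), add = (\<lambda>f g. \<lambda>x\<in>carrier E. f x + g x),
     smult = (\<lambda>c f. \<lambda>x\<in>carrier E. c * f x), nrm = op_norm E cmod\<rparr>"

definition isometric_isomorphism ::
    "('a, 'm) normed_module_scheme \<Rightarrow> ('b, 'n) normed_module_scheme \<Rightarrow> ('a \<Rightarrow> 'b) \<Rightarrow> bool" where
  "isometric_isomorphism V W \<phi> \<longleftrightarrow> bij_betw \<phi> (carrier V) (carrier W) \<and>
     (\<forall>x\<in>carrier V. \<forall>y\<in>carrier V. \<phi> (x \<oplus>\<^bsub>V\<^esub> y) = \<phi> x \<oplus>\<^bsub>W\<^esub> \<phi> y) \<and>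
     (\<forall>c. \<forall>x\<in>carrier V. \<phi> (c \<odot>\<^bsub>V\<^esub> x) = c \<odot>\<^bsub>W\<^esub> \<phi> x) \<and>
     (\<forall>x\<in>carrier V. nrm W (\<phi> x) = nrm V x)"

text \<open>A predual of \<open>V\<close> is a Banach space \<open>E\<close> together with the identification \<open>\<phi>\<close> of \<open>V\<close>
  with the dual of \<open>E\<close>; the pairing of \<open>v\<close> and \<open>x\<close> is \<open>\<phi> v x\<close>.\<close>

definition predual ::
    "('a, 'm) normed_module_scheme \<Rightarrow> ('e, 'n) normed_module_scheme \<Rightarrow> ('a \<Rightarrow> 'e \<Rightarrow> complex) \<Rightarrow> bool"
  where "predual V E \<phi> \<longleftrightarrow> banach_space E \<and> isometric_isomorphism V (dual_space E) \<phi>"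

text \<open>The topology of pointwise convergence on \<open>E\<close>, transported to \<open>V\<close> along \<open>\<phi>\<close>.\<close>

definition weak_star ::
    "('a, 'm) normed_module_scheme \<Rightarrow> ('e, 'n) normed_module_scheme \<Rightarrow> ('a \<Rightarrow> 'e \<Rightarrow> complex)
      \<Rightarrow> 'a topology"
  where "weak_star V E \<phi> =
    pullback_topology (carrier V) \<phi> (product_topology (\<lambda>_. euclidean) (carrier E))"

definition dual_banach_algebra ::
    "('a, 'm) normed_module_scheme \<Rightarrow> ('e, 'n) normed_module_scheme \<Rightarrow> ('a \<Rightarrow> 'e \<Rightarrow> complex) \<Rightarrow> bool"
  where "dual_banach_algebra A E \<phi> \<longleftrightarrow> banach_algebra A \<and> predual A E \<phi> \<and>
    (\<forall>b\<in>carrier A.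
      continuous_map (weak_star A E \<phi>) (weak_star A E \<phi>) (\<lambda>a. a \<otimes>\<^bsub>A\<^esub> b) \<and>
      continuous_map (weak_star A E \<phi>) (weak_star A E \<phi>) (\<lambda>a. b \<otimes>\<^bsub>A\<^esub> a))"

section \<open>The multiplier algebra\<close>

type_synonym 'a multiplier = "('a \<Rightarrow> 'a) \<times> ('a \<Rightarrow> 'a)"

definition multipliers :: "('a, 'm) normed_module_scheme \<Rightarrow> 'a multiplier set" where
  "multipliers A = {(L, R). L \<in> carrier A \<rightarrow>\<^sub>E carrier A \<and> R \<in> carrier A \<rightarrow>\<^sub>E carrier A \<and>
     (\<forall>a\<in>carrier A. \<forall>b\<in>carrier A. a \<otimes>\<^bsub>A\<^esub> L b = R a \<otimes>\<^bsub>A\<^esub> b)}"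

definition multiplier_algebra :: "('a, 'm) normed_module_scheme \<Rightarrow> 'a multiplier normed_module" where
  "multiplier_algebra A = \<lparr>carrier = multipliers A,
     mult = (\<lambda>(L, R) (L', R'). (compose (carrier A) L L', compose (carrier A) R' R)),
     one = (\<lambda>a\<in>carrier A. a, \<lambda>a\<in>carrier A. a),
     zero = (\<lambda>a\<in>carrier A. \<zero>\<^bsub>A\<^esub>, \<lambda>a\<in>carrier A. \<zero>\<^bsub>A\<^esub>),
     add = (\<lambda>(L, R) (L', R'). (\<lambda>a\<in>carrier A. L a \<oplus>\<^bsub>A\<^esub> L' a, \<lambda>a\<in>carrier A. R a \<oplus>\<^bsub>A\<^esub> R' a)),
     smult = (\<lambda>c (L, R). (\<lambda>a\<in>carrier A. c \<odot>\<^bsub>A\<^esub> L a, \<lambda>a\<in>carrier A. c \<odot>\<^bsub>A\<^esub> R a)),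
     nrm = (\<lambda>(L, R). max (op_norm A (nrm A) L) (op_norm A (nrm A) R))\<rparr>"

definition multiplier_embedding :: "('a, 'm) normed_module_scheme \<Rightarrow> 'a \<Rightarrow> 'a multiplier" where
  "multiplier_embedding A a = (\<lambda>b\<in>carrier A. a \<otimes>\<^bsub>A\<^esub> b, \<lambda>b\<in>carrier A. b \<otimes>\<^bsub>A\<^esub> a)"

section \<open>Agreement of two topologies on bounded nets\<close>

text \<open>
  Whether a net converges depends only on the image in \<open>A\<close> of its filter of tails, and every
  proper filter arises in this way. Quantifying over filters on \<open>A\<close> therefore amounts to
  quantifying over nets in \<open>A\<close> with index sets of arbitrary type; the lemmas below make this
  precise.
\<close>

definition agree_on_bounded_nets ::
    "('a, 'm) normed_module_scheme \<Rightarrow> 'a topology \<Rightarrow> 'a multiplier topology \<Rightarrow> bool" where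
  "agree_on_bounded_nets A S T \<longleftrightarrow>
     (\<forall>(F :: 'a filter) K. \<forall>a\<in>carrier A. (\<forall>\<^sub>F x in F. x \<in> carrier A \<and> nrm A x \<le> K) \<longrightarrow>
        (limitin S (\<lambda>x. x) a F \<longleftrightarrow>
         limitin T (multiplier_embedding A) (multiplier_embedding A a) F))"

definition directed :: "'i set \<Rightarrow> ('i \<Rightarrow> 'i \<Rightarrow> bool) \<Rightarrow> bool" where
  "directed I r \<longleftrightarrow> I \<noteq> {} \<and> (\<forall>i\<in>I. r i i) \<and>
     (\<forall>i\<in>I. \<forall>j\<in>I. \<forall>k\<in>I. r i j \<longrightarrow> r j k \<longrightarrow> r i k) \<and>
     (\<forall>i\<in>I. \<forall>j\<in>I. \<exists>k\<in>I. r i k \<and> r j k)"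

definition tails :: "'i set \<Rightarrow> ('i \<Rightarrow> 'i \<Rightarrow> bool) \<Rightarrow> 'i filter" where
  "tails I r = (INF i\<in>I. principal {j\<in>I. r i j})"

lemma eventually_tails:
  assumes "directed I r"
  shows "eventually P (tails I r) \<longleftrightarrow> (\<exists>i\<in>I. \<forall>j\<in>I. r i j \<longrightarrow> P j)"
proof -
  have "eventually P (tails I r) \<longleftrightarrow> (\<exists>i\<in>I. eventually P (principal {j\<in>I. r i j}))"
    unfolding tails_def
  proof (rule eventually_INF_base)
    show "I \<noteq> {}" using assms unfolding directed_def by blast
    fix i j assume ij: "i \<in> I" "j \<in> I"
    then obtain k where k: "k \<in> I" "r i k" "r j k"
      using assms unfolding directed_def by blast
    moreover have "{l \<in> I. r k l} \<subseteq> {l \<in> I. r i l} \<inter> {l \<in> I. r j l}"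
      using ij k assms unfolding directed_def by blast
    ultimately show "\<exists>x\<in>I. principal {j \<in> I. r x j}
        \<le> inf (principal {l \<in> I. r i l}) (principal {l \<in> I. r j l})"
      unfolding inf_principal principal_le_iff by blast
  qed
  then show ?thesis by (auto simp: eventually_principal)
qed

lemma agree_on_bounded_nets_net:
  assumes "agree_on_bounded_nets A S T" and "directed I r"
    and "\<And>i. i \<in> I \<Longrightarrow> f i \<in> carrier A" and "\<And>i. i \<in> I \<Longrightarrow> nrm A (f i) \<le> K"
    and "a \<in> carrier A"
  shows "limitin S f a (tails I r) \<longleftrightarrow>
    limitin T (\<lambda>i. multiplier_embedding A (f i)) (multiplier_embedding A a) (tails I r)"
proof -
  obtain i where "i \<in> I" using assms(2) unfolding directed_def by blast
  then have "\<forall>\<^sub>F x in filtermap f (tails I r). x \<in> carrier A \<and> nrm A x \<le> K"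
    unfolding eventually_filtermap eventually_tails[OF assms(2)]
    using assms(3,4) by blast
  then have "limitin S (\<lambda>x. x) a (filtermap f (tails I r)) \<longleftrightarrow>
      limitin T (multiplier_embedding A) (multiplier_embedding A a) (filtermap f (tails I r))"
    using assms(1,5) unfolding agree_on_bounded_nets_def by blast
  then show ?thesis by (simp add: limitin_def eventually_filtermap)
qed

lemma agree_on_bounded_netsI:
  fixes A :: "('a, 'm) normed_module_scheme"
  assumes nets: "\<And>(I :: ('a set \<times> 'a) set) r f K a. directed I r \<Longrightarrow>
      (\<And>i. i \<in> I \<Longrightarrow> f i \<in> carrier A) \<Longrightarrow> (\<And>i. i \<in> I \<Longrightarrow> nrm A (f i) \<le> K) \<Longrightarrow> a \<in> carrier A \<Longrightarrow>
      limitin S f a (tails I r) \<longleftrightarrow>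
      limitin T (\<lambda>i. multiplier_embedding A (f i)) (multiplier_embedding A a) (tails I r)"
    and S: "topspace S = carrier A" and T: "multiplier_embedding A ` carrier A \<subseteq> topspace T"
  shows "agree_on_bounded_nets A S T"
  unfolding agree_on_bounded_nets_def
proof (intro allI ballI impI)
  fix F :: "'a filter" and K a
  assume a: "a \<in> carrier A" and F: "\<forall>\<^sub>F x in F. x \<in> carrier A \<and> nrm A x \<le> K"
  show "limitin S (\<lambda>x. x) a F \<longleftrightarrow>
      limitin T (multiplier_embedding A) (multiplier_embedding A a) F"
  proof (cases "F = bot")
    case True
    then show ?thesis using a S T by (auto simp: limitin_def)
  next
    case False
    define I where "I = {(U, x). eventually (\<lambda>y. y \<in> U) F \<and> x \<in> U \<and> x \<in> carrier A \<and> nrm A x \<le> K}"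
    define r :: "'a set \<times> 'a \<Rightarrow> 'a set \<times> 'a \<Rightarrow> bool" where "r = (\<lambda>i j. fst j \<subseteq> fst i)"
    have ne: "\<exists>x. (U, x) \<in> I" if "eventually (\<lambda>y. y \<in> U) F" for U
      using eventually_happens'[OF False eventually_conj[OF that F]] that
      by (auto simp: I_def)
    have dir: "directed I r"
      unfolding directed_def
    proof (intro conjI ballI impI)
      show "I \<noteq> {}" using ne[of UNIV] by auto
    next
      fix i j assume "i \<in> I" "j \<in> I"
      then have "eventually (\<lambda>y. y \<in> fst i \<inter> fst j) F"
        by (auto simp: I_def intro: eventually_conj)
      from ne[OF this] obtain x where "(fst i \<inter> fst j, x) \<in> I" by blast
      then show "\<exists>k\<in>I. r i k \<and> r j k" by (rule bexI[rotated]) (simp add: r_def)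
    qed (auto simp: r_def)
    have "filtermap snd (tails I r) = F"
    proof (rule filter_eqI)
      fix P
      have "(\<exists>i\<in>I. \<forall>j\<in>I. r i j \<longrightarrow> P (snd j)) \<longleftrightarrow> eventually P F"
      proof
        assume "\<exists>i\<in>I. \<forall>j\<in>I. r i j \<longrightarrow> P (snd j)"
        then obtain i where i: "i \<in> I" "\<And>j. j \<in> I \<Longrightarrow> r i j \<Longrightarrow> P (snd j)" by blast
        have U: "eventually (\<lambda>y. y \<in> fst i) F" using i(1) by (auto simp: I_def)
        show "eventually P F"
          using U F
        proof eventually_elim
          case (elim x)
          with U have "(fst i, x) \<in> I" by (auto simp: I_def)
          from i(2)[OF this] show ?case by (simp add: r_def)
        qed
      next
        assume "eventually P F"
        then obtain x where "(Collect P, x) \<in> I" using ne[of "Collect P"] by auto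
        then show "\<exists>i\<in>I. \<forall>j\<in>I. r i j \<longrightarrow> P (snd j)"
          by (intro bexI[of _ "(Collect P, x)"]) (auto simp: r_def I_def)
      qed
      then show "eventually P (filtermap snd (tails I r)) \<longleftrightarrow> eventually P F"
        by (simp add: eventually_filtermap eventually_tails[OF dir])
    qed
    moreover have "limitin S snd a (tails I r) \<longleftrightarrow>
        limitin T (\<lambda>i. multiplier_embedding A (snd i)) (multiplier_embedding A a) (tails I r)"
      by (rule nets[OF dir _ _ a, where K = K]) (auto simp: I_def)
    then have "limitin S (\<lambda>x. x) a (filtermap snd (tails I r)) \<longleftrightarrow>
        limitin T (multiplier_embedding A) (multiplier_embedding A a) (filtermap snd (tails I r))"
      by (simp add: limitin_def eventually_filtermap)
    ultimately show ?thesis by simp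
  qed
qed

end

theory Submission
  imports Defs
begin

text \<open>
  Equip pairs of maps on \<open>A\<close> with the topology \<open>\<T>\<close> of pointwise weak* convergence. By Tychonoff and
  Banach-Alaoglu the balls of \<open>M(A)\<close> are \<open>\<T>\<close>-compact, since the identity \<open>a L(b) = R(a) b\<close> is
  weak*-closed. By the Dixmier-Ng theorem the bounded functionals that are \<open>\<T>\<close>-continuous on balls
  therefore form a predual of \<open>M(A)\<close>. The product is separately continuous because multipliers are
  weak*-continuous on balls: their graphs are weak*-closed by faithfulness, and balls are compact.
  For agreement on bounded nets, \<open>x \<mapsto> (x b)\<^sub>b\<close> is injective and continuous on a compact ball of \<open>A\<close>,
  hence an embedding.

  For uniqueness, let \<open>T\<close> be a weak* topology with the stated property. If \<open>m\<^sub>\<alpha> \<rightarrow> m\<close> is a bounded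
  \<open>T\<close>-convergent net, then \<open>m\<^sub>\<alpha> a\<close> and \<open>a m\<^sub>\<alpha>\<close> are bounded nets in \<open>A\<close>, so \<open>m\<^sub>\<alpha> \<rightarrow> m\<close> for \<open>\<T>\<close>. By
  compactness \<open>T\<close> and \<open>\<T>\<close> coincide on the unit ball, and a weak* topology is determined by its
  restriction to the unit ball, because a functional that is weak*-continuous there is an element
  of the predual.
\<close>

section \<open>Normed spaces and finite-dimensional separation\<close>

text \<open>Hence the basic locale asks only for a norm, and M(A) becomes a Banach algebra once its
  predual has been found. Surjectivity in the Dixmier-Ng theorem and the representation of
  functionals that are continuous on the unit ball lead to one question: does a family of
  functionals attain prescribed values on a compact ball? Compactness reduces it to finitely many
  functionals, for which the image of the ball is compact and convex in a finite-dimensional space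
  and has a point nearest to the prescribed values. Multipliers are arbitrary pairs of maps.
  Faithfulness makes them linear by cancellation, and Baire's theorem makes them bounded. Their
  weak*-continuity is obtained on balls. The passage from balls to all of M(A) takes place in the
  predual: composition with a bounded linear map that is continuous on balls preserves the
  functionals that are continuous on balls.\<close>

locale normed_cspace = module complex_ring V for V :: "('a, 'm) normed_module_scheme" (structure) +
  assumes nrm_eq_zero: "x \<in> carrier V \<Longrightarrow> nrm V x = 0 \<Longrightarrow> x = \<zero>"
    and nrm_smult: "x \<in> carrier V \<Longrightarrow> nrm V (c \<odot> x) = cmod c * nrm V x"
    and nrm_triangle: "x \<in> carrier V \<Longrightarrow> y \<in> carrier V \<Longrightarrow> nrm V (x \<oplus> y) \<le> nrm V x + nrm V y"

sublocale banach_space \<subseteq> normed_cspace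
  by unfold_locales (fact nrm_eq_zero nrm_smult nrm_triangle)+

lemma complex_ring_simps [simp]:
  "carrier complex_ring = UNIV" "mult complex_ring = (*)" "one complex_ring = 1"
  "zero complex_ring = 0" "add complex_ring = (+)"
  by (simp_all add: complex_ring_def)

lemma cring_complex_ring: "cring complex_ring"
proof (rule cringI)
  show "abelian_group complex_ring"
    by (rule abelian_groupI) (auto intro: exI[of _ "- x" for x] simp: add.commute[of _ "- x" for x])
  show "comm_monoid complex_ring"
    by (rule comm_monoidI) (auto simp: mult_ac)
qed (auto simp: distrib_right)

definition nball :: "('a, 'm) normed_module_scheme \<Rightarrow> real \<Rightarrow> 'a set" where
  "nball V r = {x \<in> carrier V. nrm V x \<le> r}"

definition linear_functional :: "('a, 'm) normed_module_scheme \<Rightarrow> ('a \<Rightarrow> complex) \<Rightarrow> bool" where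
  "linear_functional V f \<longleftrightarrow>
     (\<forall>x\<in>carrier V. \<forall>y\<in>carrier V. f (x \<oplus>\<^bsub>V\<^esub> y) = f x + f y) \<and>
     (\<forall>c. \<forall>x\<in>carrier V. f (c \<odot>\<^bsub>V\<^esub> x) = c * f x)"

lemma linear_functional_add:
  "linear_functional V f \<Longrightarrow> x \<in> carrier V \<Longrightarrow> y \<in> carrier V \<Longrightarrow> f (x \<oplus>\<^bsub>V\<^esub> y) = f x + f y"
  by (simp add: linear_functional_def)

lemma linear_functional_smult:
  "linear_functional V f \<Longrightarrow> x \<in> carrier V \<Longrightarrow> f (c \<odot>\<^bsub>V\<^esub> x) = c * f x"
  by (simp add: linear_functional_def)

lemma linear_functional_sum:
  assumes "\<And>i. i \<in> I \<Longrightarrow> linear_functional V (f i)"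
  shows "linear_functional V (\<lambda>x. \<Sum>i\<in>I. d i * f i x)"
  using assms unfolding linear_functional_def
  by (auto simp: sum_distrib_left distrib_left sum.distrib mult_ac intro!: sum.cong)

lemma bounded_functionals_iff:
  "f \<in> bounded_functionals V \<longleftrightarrow> f \<in> extensional (carrier V) \<and> linear_functional V f \<and>
     (\<exists>K. \<forall>x\<in>carrier V. cmod (f x) \<le> K * nrm V x)"
  by (auto simp: bounded_functionals_def linear_functional_def)

section \<open>Arithmetic, norms and balls with explicit carriers\<close>

context normed_cspace
begin

lemma smult_in [simp, intro]: "x \<in> carrier V \<Longrightarrow> c \<odot> x \<in> carrier V"
  using smult_closed[of c x] by simp

lemma smult_0 [simp]: "x \<in> carrier V \<Longrightarrow> 0 \<odot> x = \<zero>"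
  using smult_l_null by simp

lemma smult_1 [simp]: "x \<in> carrier V \<Longrightarrow> 1 \<odot> x = x"
  using smult_one by simp

lemma smult_zero [simp]: "c \<odot> \<zero> = \<zero>"
  using smult_r_null[of c] by simp

lemma smult_smult: "x \<in> carrier V \<Longrightarrow> c \<odot> (d \<odot> x) = (c * d) \<odot> x"
  using smult_assoc1[of c d x] by simp

lemma smult_add_left: "x \<in> carrier V \<Longrightarrow> (c + d) \<odot> x = c \<odot> x \<oplus> d \<odot> x"
  using smult_l_distr[of c d x] by simp

lemma smult_add_right: "x \<in> carrier V \<Longrightarrow> y \<in> carrier V \<Longrightarrow> c \<odot> (x \<oplus> y) = c \<odot> x \<oplus> c \<odot> y"
  using smult_r_distr[of c x y] by simp

lemma uminus_eq_smult: "x \<in> carrier V \<Longrightarrow> \<ominus> x = (- 1) \<odot> x"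
  by (rule minus_equality) (use smult_add_left[of x "-1" 1] in simp_all)

lemma minus_eq_smult: "x \<in> carrier V \<Longrightarrow> y \<in> carrier V \<Longrightarrow> x \<ominus> y = x \<oplus> (- 1) \<odot> y"
  by (simp add: minus_eq uminus_eq_smult)

lemma nrm_zero [simp]: "nrm V \<zero> = 0"
  using nrm_smult[of \<zero> 0] by simp

lemma nrm_uminus: "x \<in> carrier V \<Longrightarrow> nrm V (\<ominus> x) = nrm V x"
  by (simp add: uminus_eq_smult nrm_smult)

lemma nrm_nonneg [simp]: "x \<in> carrier V \<Longrightarrow> 0 \<le> nrm V x"
  using nrm_triangle[of x "\<ominus> x"] by (simp add: nrm_uminus r_neg)

lemma nrm_minus_commute: "x \<in> carrier V \<Longrightarrow> y \<in> carrier V \<Longrightarrow> nrm V (x \<ominus> y) = nrm V (y \<ominus> x)"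
  by (metis a_inv_closed minus_add minus_closed minus_eq minus_minus nrm_uminus a_comm)

lemma minus_triangle:
  assumes "x \<in> carrier V" "y \<in> carrier V" "z \<in> carrier V"
  shows "nrm V (x \<ominus> z) \<le> nrm V (x \<ominus> y) + nrm V (y \<ominus> z)"
proof -
  have "x \<ominus> z = (x \<ominus> y) \<oplus> (y \<ominus> z)"
    using assms by (simp add: minus_eq a_assoc r_neg1)
  then show ?thesis using nrm_triangle[of "x \<ominus> y" "y \<ominus> z"] assms by simp
qed

lemma minus_self [simp]: "x \<in> carrier V \<Longrightarrow> x \<ominus> x = \<zero>"
  by (simp add: minus_eq r_neg)

lemma minus_eq_zero_iff: "x \<in> carrier V \<Longrightarrow> y \<in> carrier V \<Longrightarrow> x \<ominus> y = \<zero> \<longleftrightarrow> x = y"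
  by (metis minus_eq minus_equality minus_minus a_inv_closed r_neg)

lemma nrm_minus_eq_0_iff: "x \<in> carrier V \<Longrightarrow> y \<in> carrier V \<Longrightarrow> nrm V (x \<ominus> y) = 0 \<longleftrightarrow> x = y"
  using minus_eq_zero_iff nrm_eq_zero by fastforce

lemma nball_subset: "nball V r \<subseteq> carrier V"
  by (auto simp: nball_def)

lemma zero_in_nball: "0 \<le> r \<Longrightarrow> \<zero> \<in> nball V r"
  by (simp add: nball_def)

lemma smult_in_nball: "x \<in> nball V r \<Longrightarrow> cmod c * r \<le> s \<Longrightarrow> c \<odot> x \<in> nball V s"
  unfolding nball_def
  by (auto simp: nrm_smult) (meson mult_left_mono norm_ge_zero order_trans)

lemma convex_in_nball:
  assumes "x \<in> nball V r" "y \<in> nball V r" "0 \<le> t" "t \<le> 1"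
  shows "of_real (1 - t) \<odot> x \<oplus> of_real t \<odot> y \<in> nball V r"
proof -
  have xy: "x \<in> carrier V" "y \<in> carrier V" "nrm V x \<le> r" "nrm V y \<le> r"
    using assms by (auto simp: nball_def)
  have "nrm V (of_real (1 - t) \<odot> x \<oplus> of_real t \<odot> y) \<le> (1 - t) * nrm V x + t * nrm V y"
    using nrm_triangle[of "of_real (1 - t) \<odot> x" "of_real t \<odot> y"] xy assms(3,4)
    by (simp add: nrm_smult del: of_real_diff)
  also have "\<dots> \<le> (1 - t) * r + t * r"
    using xy assms(3,4) by (intro add_mono mult_left_mono) auto
  finally show ?thesis using xy by (simp add: nball_def algebra_simps)
qed

section \<open>Separation by finitely many functionals\<close>

lemma linear_functional_zero: "linear_functional V f \<Longrightarrow> f \<zero> = 0"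
  using linear_functional_smult[of V f \<zero> 0] by simp

lemma linear_functional_minus:
  "linear_functional V f \<Longrightarrow> x \<in> carrier V \<Longrightarrow> y \<in> carrier V \<Longrightarrow> f (x \<ominus> y) = f x - f y"
  by (simp add: minus_eq_smult linear_functional_add linear_functional_smult)

text \<open>Expansion in powers of t along the segment from a to b. For a point a nearest to z,
  comparing the linear with the quadratic term for small t yields the variational inequality in
  \<open>finite_separation\<close>.\<close>

lemma cmod_affine:
  "(cmod (of_real (1 - t) * a + of_real t * b - z))\<^sup>2 =
    (cmod (a - z))\<^sup>2 - 2 * t * Re (cnj (z - a) * b - cnj (z - a) * a) + t\<^sup>2 * (cmod (b - a))\<^sup>2"
  unfolding cmod_power2 by (simp add: power2_eq_square algebra_simps)

text \<open>The separating functional is read off the point of the compact convex image of the ball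
  that is closest to \<open>z\<close>.\<close>

lemma finite_separation:
  assumes cpt: "compactin T (nball V r)" and r: "0 \<le> r" and I: "finite I"
    and lin: "\<And>i. i \<in> I \<Longrightarrow> linear_functional V (f i)"
    and cont: "\<And>i. i \<in> I \<Longrightarrow> continuous_map (subtopology T (nball V r)) euclidean (f i)"
    and sep: "\<not> (\<exists>v\<in>nball V r. \<forall>i\<in>I. f i v = z i)"
  shows "\<exists>d s. (\<forall>v\<in>nball V r. cmod (\<Sum>i\<in>I. d i * f i v) \<le> s) \<and> s < Re (\<Sum>i\<in>I. d i * z i)"
proof -
  define h where "h v = (\<Sum>i\<in>I. (cmod (f i v - z i))\<^sup>2)" for v
  have "continuous_map (subtopology T (nball V r)) euclideanreal h"
    unfolding h_def
    by (intro continuous_map_sum I continuous_map_real_pow)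
      (use cont in \<open>auto intro!: continuous_map_norm continuous_map_diff\<close>)
  then have "compactin euclideanreal (h ` nball V r)"
    using cpt by (intro image_compactin[of "subtopology T (nball V r)"]) (auto simp: compactin_subtopology)
  then have "compact (h ` nball V r)" by simp
  moreover have "h ` nball V r \<noteq> {}" using zero_in_nball[OF r] by blast
  ultimately obtain x where x: "x \<in> nball V r" and min: "\<And>v. v \<in> nball V r \<Longrightarrow> h x \<le> h v"
    using compact_attains_inf[of "h ` nball V r"] by blast
  have xV: "x \<in> carrier V" using x by (auto simp: nball_def)
  \<comment> \<open>These coefficients make \<open>Re (g v - g x)\<close>, up to the factor -2, the
    derivative of h at x in the direction of v.\<close>
  define d where "d i = cnj (z i - f i x)" for i
  define g where "g v = (\<Sum>i\<in>I. d i * f i v)" for v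
  have gl: "linear_functional V g" unfolding g_def by (rule linear_functional_sum) (fact lin)
  have le: "Re (g v) \<le> Re (g x)" if v: "v \<in> nball V r" for v
  proof (rule ccontr)
    assume contr: "\<not> ?thesis"
    define \<alpha> where "\<alpha> = Re (g v - g x)"
    have \<alpha>: "\<alpha> > 0" using contr by (simp add: \<alpha>_def)
    define \<beta> where "\<beta> = (\<Sum>i\<in>I. (cmod (f i v - f i x))\<^sup>2)"
    have \<beta>: "\<beta> \<ge> 0" unfolding \<beta>_def by (simp add: sum_nonneg)
    have vV: "v \<in> carrier V" using v by (auto simp: nball_def)
    \<comment> \<open>Moving from x towards v by t changes h by -2 t \<alpha> + t^2 \<beta>, which
      is nonnegative because h is minimal at x.\<close>
    have *: "2 * \<alpha> \<le> t * \<beta>" if t: "0 < t" "t \<le> 1" for t :: real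
    proof -
      let ?y = "of_real (1 - t) \<odot> x \<oplus> of_real t \<odot> v"
      have "?y \<in> nball V r" using convex_in_nball[OF x v] t by simp
      then have "h x \<le> h ?y" by (rule min)
      moreover have "h ?y = h x - 2 * t * \<alpha> + t\<^sup>2 * \<beta>"
      proof -
        have "(cmod (f i ?y - z i))\<^sup>2 = (cmod (f i x - z i))\<^sup>2 - 2 * t * Re (d i * f i v - d i * f i x)
            + t\<^sup>2 * (cmod (f i v - f i x))\<^sup>2" if i: "i \<in> I" for i
        proof -
          have "f i ?y = of_real (1 - t) * f i x + of_real t * f i v"
            using lin[OF i] xV vV by (simp add: linear_functional_add linear_functional_smult)
          then show ?thesis
            unfolding d_def by (simp only: cmod_affine)
        qed
        then have "h ?y = (\<Sum>i\<in>I. (cmod (f i x - z i))\<^sup>2 - 2 * t * Re (d i * f i v - d i * f i x)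
            + t\<^sup>2 * (cmod (f i v - f i x))\<^sup>2)"
          unfolding h_def by (intro sum.cong) auto
        also have "\<dots> = h x - 2 * t * \<alpha> + t\<^sup>2 * \<beta>"
          unfolding h_def \<alpha>_def \<beta>_def g_def sum_subtractf[symmetric] Re_sum
          by (simp only: sum.distrib sum_subtractf sum_distrib_left)
        finally show ?thesis .
      qed
      ultimately have "t * (2 * \<alpha>) \<le> t * (t * \<beta>)" by (simp add: power2_eq_square algebra_simps)
      then show ?thesis using t by simp
    qed
    \<comment> \<open>Small enough that t \<beta> \<le> \<alpha> < 2 \<alpha>; the summand 1 covers
      \<beta> = 0.\<close>
    define t where "t = min 1 (\<alpha> / (\<beta> + 1))"
    have t: "0 < t" "t \<le> 1" using \<alpha> \<beta> by (auto simp: t_def)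
    have "t * \<beta> \<le> \<alpha> / (\<beta> + 1) * \<beta>" using \<beta> by (intro mult_right_mono) (auto simp: t_def)
    also have "\<dots> \<le> \<alpha>" using \<alpha> \<beta> by (simp add: field_simps)
    finally show False using *[OF t] \<alpha> by simp
  qed
  have "cmod (g v) \<le> Re (g x)" if v: "v \<in> nball V r" for v
  proof (cases "g v = 0")
    case True
    then show ?thesis using le[OF zero_in_nball[OF r]] linear_functional_zero[OF gl] by simp
  next
    case False
    \<comment> \<open>The ball is invariant under scalars of modulus 1, so this phase turns the
      bound on real parts into a bound on moduli.\<close>
    define c where "c = cnj (g v) / of_real (cmod (g v))"
    have "cmod c = 1" using False by (simp add: c_def norm_divide)
    then have "c \<odot> v \<in> nball V r" using smult_in_nball[OF v, of c r] by simp
    then have "Re (g (c \<odot> v)) \<le> Re (g x)" by (rule le)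
    moreover have "g (c \<odot> v) = of_real (cmod (g v))"
    proof -
      have "g (c \<odot> v) = c * g v"
        using linear_functional_smult[OF gl] v by (auto simp: nball_def)
      also have "\<dots> = of_real (cmod (g v))"
        using False by (simp add: c_def complex_norm_square[symmetric] mult.commute[of "cnj _"]
            power2_eq_square)
      finally show ?thesis .
    qed
    ultimately show ?thesis by simp
  qed
  moreover have "Re (g x) < Re (\<Sum>i\<in>I. d i * z i)"
  proof -
    obtain i where i: "i \<in> I" "f i x \<noteq> z i" using sep x by blast
    \<comment> \<open>The gap is the squared distance from z to its nearest point, which is positive
      because x does not solve the system.\<close>
    have "Re (\<Sum>i\<in>I. d i * z i) - Re (g x) = (\<Sum>i\<in>I. (cmod (z i - f i x))\<^sup>2)"
      unfolding g_def d_def Re_sum sum_subtractf[symmetric] cmod_power2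
      by (intro sum.cong) (auto simp: power2_eq_square algebra_simps)
    also have "\<dots> > 0" using i I by (intro sum_pos2[of _ i]) auto
    finally show ?thesis by simp
  qed
  ultimately show ?thesis unfolding g_def by blast
qed

end

section \<open>The Hahn-Banach theorem\<close>

definition sublinear :: "('a, 'm) normed_module_scheme \<Rightarrow> ('a \<Rightarrow> real) \<Rightarrow> bool" where
  "sublinear V p \<longleftrightarrow>
     (\<forall>x\<in>carrier V. \<forall>y\<in>carrier V. p (x \<oplus>\<^bsub>V\<^esub> y) \<le> p x + p y) \<and>
     (\<forall>t\<ge>0. \<forall>x\<in>carrier V. p (of_real t \<odot>\<^bsub>V\<^esub> x) = t * p x)"

lemma sublinear_add:
  "sublinear V p \<Longrightarrow> x \<in> carrier V \<Longrightarrow> y \<in> carrier V \<Longrightarrow> p (x \<oplus>\<^bsub>V\<^esub> y) \<le> p x + p y"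
  by (simp add: sublinear_def)

lemma sublinear_scale:
  "sublinear V p \<Longrightarrow> 0 \<le> t \<Longrightarrow> x \<in> carrier V \<Longrightarrow> p (of_real t \<odot>\<^bsub>V\<^esub> x) = t * p x"
  by (simp add: sublinear_def)

context normed_cspace
begin

text \<open>The inequality for positive t suffices: applied with 1/t to the vector t x, it gives the
  reverse inequality.\<close>

lemma sublinearI:
  assumes add: "\<And>x y. x \<in> carrier V \<Longrightarrow> y \<in> carrier V \<Longrightarrow> p (x \<oplus> y) \<le> p x + p y"
    and zero: "p \<zero> = 0"
    and scale: "\<And>t x. 0 < t \<Longrightarrow> x \<in> carrier V \<Longrightarrow> p (of_real t \<odot> x) \<le> t * p x"
  shows "sublinear V p"
  unfolding sublinear_def
proof (intro conjI ballI allI impI)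
  fix t :: real and x assume t: "0 \<le> t" and x: "x \<in> carrier V"
  show "p (of_real t \<odot> x) = t * p x"
  proof (cases "t = 0")
    case True
    then show ?thesis using x zero by simp
  next
    case False
    then have t: "t > 0" using t by simp
    have "p (of_real (1 / t) \<odot> (of_real t \<odot> x)) \<le> (1 / t) * p (of_real t \<odot> x)"
      using t x by (intro scale) auto
    then have "t * p x \<le> p (of_real t \<odot> x)"
      using t x by (simp add: smult_smult field_simps)
    then show ?thesis using scale[OF t x] by simp
  qed
qed (fact add)

lemma sublinear_zero: "sublinear V p \<Longrightarrow> p \<zero> = 0"
  using sublinear_scale[of V p 0 \<zero>] by simp

lemma sublinear_uminus: "sublinear V p \<Longrightarrow> x \<in> carrier V \<Longrightarrow> - p (\<ominus> x) \<le> p x"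
  using sublinear_add[of V p x "\<ominus> x"] by (simp add: r_neg sublinear_zero)

lemma sublinear_nrm: "sublinear V (nrm V)"
  by (rule sublinearI) (auto simp: nrm_triangle nrm_smult)

text \<open>The infimum over t of the right-hand sides is itself sublinear. The case t = 0 puts q
  below p, and t = 1 makes q small in the direction of -y. For a minimal p this forces additivity;
  for the norm it builds in the value that a norming functional must take.\<close>

lemma sublinear_shift:
  assumes p: "sublinear V p" and y: "y \<in> carrier V"
  shows "\<exists>q. sublinear V q \<and> (\<forall>x\<in>carrier V. \<forall>t\<ge>0. q x \<le> p (x \<oplus> of_real t \<odot> y) - t * p y)"
proof -
  define a where "a x t = p (x \<oplus> of_real t \<odot> y) - t * p y" for x t
  define q where "q x = (INF t\<in>{0..}. a x t)" for x
  \<comment> \<open>Subadditivity applied to t y = (x + t y) - x keeps the infimum finite.\<close>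
  have bdd: "bdd_below (a x ` {0..})" if x: "x \<in> carrier V" for x
  proof (rule bdd_belowI2)
    fix t :: real assume t: "t \<in> {0..}"
    have "t * p y = p (of_real t \<odot> y)" using sublinear_scale[OF p _ y] t by simp
    also have "of_real t \<odot> y = (x \<oplus> of_real t \<odot> y) \<oplus> \<ominus> x"
      using x y by (simp add: a_comm[of x] a_assoc r_neg)
    also have "p \<dots> \<le> p (x \<oplus> of_real t \<odot> y) + p (\<ominus> x)"
      using x y by (intro sublinear_add[OF p]) auto
    finally show "- p (\<ominus> x) \<le> a x t" by (simp add: a_def)
  qed
  have le: "q x \<le> a x t" if "x \<in> carrier V" "0 \<le> t" for x t
    unfolding q_def using bdd[OF that(1)] that(2) by (intro cINF_lower) auto
  have "sublinear V q"
  proof (rule sublinearI)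
    fix x z assume xz: "x \<in> carrier V" "z \<in> carrier V"
    have *: "q (x \<oplus> z) \<le> a x s + a z t" if st: "0 \<le> s" "0 \<le> t" for s t
    proof -
      have "q (x \<oplus> z) \<le> a (x \<oplus> z) (s + t)" using xz st by (intro le) auto
      also have "(x \<oplus> z) \<oplus> of_real (s + t) \<odot> y = (x \<oplus> of_real s \<odot> y) \<oplus> (z \<oplus> of_real t \<odot> y)"
        using xz y by (simp add: smult_add_left a_ac)
      then have "a (x \<oplus> z) (s + t) \<le> a x s + a z t"
        using sublinear_add[OF p, of "x \<oplus> of_real s \<odot> y" "z \<oplus> of_real t \<odot> y"] xz y
        by (simp add: a_def algebra_simps del: of_real_add)
      finally show ?thesis .
    qed
    have "q (x \<oplus> z) - a x s \<le> q z" if "0 \<le> s" for s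
      unfolding q_def[of z] using *[OF that] by (intro cINF_greatest) (auto simp: algebra_simps)
    then have "q (x \<oplus> z) - q z \<le> q x"
      unfolding q_def[of x] by (intro cINF_greatest) (auto simp: algebra_simps)
    then show "q (x \<oplus> z) \<le> q x + q z" by simp
  next
    have "a \<zero> t = 0" if "t \<in> {0..}" for t
      using that y by (simp add: a_def sublinear_scale[OF p])
    then show "q \<zero> = 0" unfolding q_def by (simp cong: INF_cong_simp)
  next
    fix s :: real and x assume s: "0 < s" and x: "x \<in> carrier V"
    have "q (of_real s \<odot> x) / s \<le> a x t" if t: "0 \<le> t" for t
    proof -
      have "q (of_real s \<odot> x) \<le> a (of_real s \<odot> x) (s * t)" using s t x by (intro le) auto
      also have "of_real s \<odot> x \<oplus> of_real (s * t) \<odot> y = of_real s \<odot> (x \<oplus> of_real t \<odot> y)"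
        using x y by (simp add: smult_add_right smult_smult)
      then have "a (of_real s \<odot> x) (s * t) = s * a x t"
        using s x y sublinear_scale[OF p, of s "x \<oplus> of_real t \<odot> y"]
        by (simp add: a_def algebra_simps del: of_real_mult)
      finally show ?thesis using s by (simp add: field_simps)
    qed
    then have "q (of_real s \<odot> x) / s \<le> q x"
      unfolding q_def[of x] by (intro cINF_greatest) auto
    then show "q (of_real s \<odot> x) \<le> s * q x" using s by (simp add: field_simps)
  qed
  then show ?thesis using le unfolding a_def by blast
qed

text \<open>Zorn's lemma with pointwise infima of chains as lower bounds. They are finite because
  every sublinear q below p satisfies q x \<ge> -q(-x) \<ge> -p(-x).\<close>

lemma minimal_sublinear:
  assumes p: "sublinear V p"
  shows "\<exists>q. sublinear V q \<and> (\<forall>x\<in>carrier V. q x \<le> p x) \<and>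
    (\<forall>q'. sublinear V q' \<longrightarrow> (\<forall>x\<in>carrier V. q' x \<le> q x) \<longrightarrow> (\<forall>x\<in>carrier V. q' x = q x))"
proof -
  \<comment> \<open>Fixing the values off the carrier lets the order of HOL functions express
    comparison on the carrier.\<close>
  define S where "S = {q. sublinear V q \<and> (\<forall>x\<in>carrier V. q x \<le> p x) \<and> (\<forall>x. x \<notin> carrier V \<longrightarrow> q x = 0)}"
  \<comment> \<open>The order is reversed, so that a maximal element in the sense of Zorn is a
    minimal functional.\<close>
  let ?R = "\<lambda>q q' :: 'a \<Rightarrow> real. q' \<le> q"
  have "\<exists>m\<in>S. \<forall>q\<in>S. ?R m q \<longrightarrow> q = m"
  proof (rule predicate_Zorn)
    show "partial_order_on S (relation_of ?R S)"
      by (rule partial_order_on_relation_ofI) auto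
  next
    fix C assume "C \<in> Chains (relation_of ?R S)"
    then have CS: "C \<subseteq> S" and chain: "\<And>q q'. q \<in> C \<Longrightarrow> q' \<in> C \<Longrightarrow> q \<le> q' \<or> q' \<le> q"
      by (auto simp: Chains_def relation_of_def)
    show "\<exists>u\<in>S. \<forall>q\<in>C. u \<le> q"
    proof (cases "C = {}")
      case True
      have "(\<lambda>x. if x \<in> carrier V then p x else 0) \<in> S"
        using p by (auto simp: S_def sublinear_def)
      then show ?thesis using True by blast
    next
      case False
      define u where "u x = (if x \<in> carrier V then INF q\<in>C. q x else 0)" for x
      have bdd: "bdd_below ((\<lambda>q. q x) ` C)" if x: "x \<in> carrier V" for x
      proof (rule bdd_belowI2)
        fix q assume "q \<in> C"
        then have q: "sublinear V q" "q (\<ominus> x) \<le> p (\<ominus> x)" using CS x by (auto simp: S_def)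
        show "- p (\<ominus> x) \<le> q x" using sublinear_uminus[OF q(1) x] q(2) by simp
      qed
      have le: "u x \<le> q x" if "x \<in> carrier V" "q \<in> C" for q x
        using bdd that by (auto simp: u_def intro: cINF_lower)
      have ge: "c \<le> u x" if "x \<in> carrier V" "\<And>q. q \<in> C \<Longrightarrow> c \<le> q x" for c x
        using that False by (auto simp: u_def intro: cINF_greatest)
      have sub: "sublinear V q" if "q \<in> C" for q using that CS by (auto simp: S_def)
      have "sublinear V u"
      proof (rule sublinearI)
        fix x y assume xy: "x \<in> carrier V" "y \<in> carrier V"
        have *: "u (x \<oplus> y) \<le> q x + q' y" if qq: "q \<in> C" "q' \<in> C" for q q'
        proof -
          \<comment> \<open>In a chain the smaller of q and q' serves for both summands; this is why
            the infimum stays subadditive.\<close>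
          obtain r where r: "r \<in> C" "r \<le> q" "r \<le> q'" using chain[OF qq] qq by auto
          have "u (x \<oplus> y) \<le> r (x \<oplus> y)" using xy r by (intro le) auto
          also have "\<dots> \<le> r x + r y" using sublinear_add[OF sub[OF r(1)]] xy by simp
          also have "\<dots> \<le> q x + q' y" using r by (auto simp: le_fun_def intro: add_mono)
          finally show ?thesis .
        qed
        have "u (x \<oplus> y) - q x \<le> u y" if "q \<in> C" for q
          using *[OF that] xy by (intro ge) (auto simp: algebra_simps)
        then have "u (x \<oplus> y) - u y \<le> u x"
          using xy by (intro ge) (auto simp: algebra_simps)
        then show "u (x \<oplus> y) \<le> u x + u y" by simp
      next
        show "u \<zero> = 0" using False sub by (simp add: u_def sublinear_zero cong: INF_cong_simp)
      next
        fix t :: real and x assume t: "0 < t" and x: "x \<in> carrier V"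
        have "u (of_real t \<odot> x) / t \<le> u x"
        proof (rule ge[OF x])
          fix q assume q: "q \<in> C"
          have "u (of_real t \<odot> x) \<le> q (of_real t \<odot> x)" using x q by (intro le) auto
          then show "u (of_real t \<odot> x) / t \<le> q x"
            using sublinear_scale[OF sub[OF q], of t x] t x by (simp add: field_simps)
        qed
        then show "u (of_real t \<odot> x) \<le> t * u x" using t by (simp add: field_simps)
      qed
      moreover have "u x \<le> p x" if "x \<in> carrier V" for x
      proof -
        obtain q where "q \<in> C" using False by blast
        then show ?thesis using le[OF that] CS that by (force simp: S_def)
      qed
      ultimately have "u \<in> S" by (auto simp: S_def u_def)
      moreover have "u \<le> q" if "q \<in> C" for q
        using le[OF _ that] that CS by (auto simp: le_fun_def S_def u_def)
      ultimately show ?thesis by blast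
    qed
  qed
  then obtain q where q: "q \<in> S" and min: "\<And>q'. q' \<in> S \<Longrightarrow> q' \<le> q \<Longrightarrow> q' = q" by blast
  have "\<forall>x\<in>carrier V. q' x = q x"
    if q': "sublinear V q'" "\<forall>x\<in>carrier V. q' x \<le> q x" for q'
  proof -
    let ?q = "\<lambda>x. if x \<in> carrier V then q' x else 0"
    have "sublinear V ?q" using q'(1) by (auto simp: sublinear_def)
    moreover have "q' x \<le> p x" if "x \<in> carrier V" for x
      using q'(2) q that by (force simp: S_def)
    ultimately have "?q \<in> S" by (auto simp: S_def)
    moreover have "?q \<le> q" using q'(2) q by (auto simp: S_def le_fun_def)
    ultimately have "?q = q" by (rule min)
    then show ?thesis by (auto dest: fun_cong)
  qed
  then show ?thesis using q by (intro exI[of _ q]) (simp add: S_def)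
qed

text \<open>A minimal sublinear functional coincides with all its shifts and is therefore additive.\<close>

lemma dominated_additive:
  assumes p: "sublinear V p"
  shows "\<exists>u. sublinear V u \<and> (\<forall>x\<in>carrier V. u x \<le> p x) \<and>
    (\<forall>x\<in>carrier V. \<forall>y\<in>carrier V. u (x \<oplus> y) = u x + u y)"
proof -
  obtain u where u: "sublinear V u" "\<And>x. x \<in> carrier V \<Longrightarrow> u x \<le> p x"
    and min: "\<And>q x. sublinear V q \<Longrightarrow> \<forall>x\<in>carrier V. q x \<le> u x \<Longrightarrow> x \<in> carrier V \<Longrightarrow> q x = u x"
    using minimal_sublinear[OF p] by metis
  have "u (x \<oplus> y) = u x + u y" if xy: "x \<in> carrier V" "y \<in> carrier V" for x y
  proof -
    obtain q where q: "sublinear V q"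
      "\<And>x t. x \<in> carrier V \<Longrightarrow> t \<ge> 0 \<Longrightarrow> q x \<le> u (x \<oplus> of_real t \<odot> y) - t * u y"
      using sublinear_shift[OF u(1) xy(2)] by blast
    have "q z \<le> u z" if "z \<in> carrier V" for z using q(2)[OF that, of 0] that xy by simp
    then have "q x = u x" using min[OF q(1)] xy by blast
    then have "u x + u y \<le> u (x \<oplus> y)" using q(2)[OF xy(1), of 1] xy by simp
    then show ?thesis using sublinear_add[OF u(1) xy] by simp
  qed
  then show ?thesis using u by (intro exI[of _ u]) simp
qed

text \<open>For the shift q of the norm at e one has q(-e) \<le> -||e||. Every additive u below q
  therefore satisfies u e \<ge> ||e||, while u stays below the norm. The value at e is thus forced
  by q instead of being prescribed on a line and extended.\<close>

theorem norming_functional: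
  assumes e: "e \<in> carrier V"
  shows "\<exists>f\<in>bounded_functionals V. (\<forall>x\<in>carrier V. cmod (f x) \<le> nrm V x) \<and> nrm V e \<le> cmod (f e)"
proof -
  obtain q where q: "sublinear V q"
    "\<And>x t. x \<in> carrier V \<Longrightarrow> t \<ge> 0 \<Longrightarrow> q x \<le> nrm V (x \<oplus> of_real t \<odot> e) - t * nrm V e"
    using sublinear_shift[OF sublinear_nrm e] by auto
  obtain u where u: "sublinear V u" "\<And>x. x \<in> carrier V \<Longrightarrow> u x \<le> q x"
    and add: "\<And>x y. x \<in> carrier V \<Longrightarrow> y \<in> carrier V \<Longrightarrow> u (x \<oplus> y) = u x + u y"
    using dominated_additive[OF q(1)] by auto
  have un: "u x \<le> nrm V x" if "x \<in> carrier V" for x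
    using u(2)[OF that] q(2)[OF that, of 0] that e by simp
  have neg: "u (\<ominus> x) = - u x" if "x \<in> carrier V" for x
    using add[of x "\<ominus> x"] that by (simp add: r_neg sublinear_zero[OF u(1)])
  have scale: "u (of_real t \<odot> x) = t * u x" if x: "x \<in> carrier V" for t x
  proof (cases "t \<ge> 0")
    case True
    then show ?thesis using sublinear_scale[OF u(1)] x by simp
  next
    case False
    have "u (of_real (- t) \<odot> x) = - t * u x"
      using False x by (intro sublinear_scale[OF u(1)]) auto
    moreover have "of_real t \<odot> x = \<ominus> (of_real (- t) \<odot> x)"
      using x by (simp add: uminus_eq_smult smult_smult)
    ultimately show ?thesis using neg[of "of_real (- t) \<odot> x"] x by simp
  qed
  \<comment> \<open>The complex-linear functional with real part u is u(x) - i u(i x).\<close>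
  define f where "f = (\<lambda>x\<in>carrier V. Complex (u x) (- u (\<i> \<odot> x)))"
  have fl: "linear_functional V f"
    unfolding linear_functional_def
  proof (intro conjI ballI allI)
    fix x y assume "x \<in> carrier V" "y \<in> carrier V"
    then show "f (x \<oplus> y) = f x + f y"
      by (simp add: f_def add smult_add_right complex_eq_iff)
  next
    fix c x assume x: "x \<in> carrier V"
    have *: "u (d \<odot> x) = Re d * u x + Im d * u (\<i> \<odot> x)" for d
    proof -
      have "d = of_real (Re d) + of_real (Im d) * \<i>" by (simp add: complex_eq_iff)
      then have "d \<odot> x = of_real (Re d) \<odot> x \<oplus> of_real (Im d) \<odot> (\<i> \<odot> x)"
        using smult_add_left[OF x, of "of_real (Re d)" "of_real (Im d) * \<i>"] x
        by (simp add: smult_smult)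
      then show ?thesis using x by (simp add: add scale)
    qed
    show "f (c \<odot> x) = c * f x"
      using x by (simp add: f_def smult_smult *[of c] *[of "\<i> * c"] complex_eq_iff)
  qed
  have bound: "cmod (f x) \<le> nrm V x" if x: "x \<in> carrier V" for x
  proof (cases "f x = 0")
    case False
    \<comment> \<open>After rotation by this phase the value is real, where f agrees with u and the
      bound on u applies.\<close>
    define c where "c = cnj (f x) / of_real (cmod (f x))"
    have c: "cmod c = 1" using False by (simp add: c_def norm_divide)
    have "c * f x = of_real (cmod (f x))"
      using False by (simp add: c_def complex_norm_square[symmetric] mult.commute[of "cnj _"]
          power2_eq_square)
    then have "f (c \<odot> x) = of_real (cmod (f x))"
      using linear_functional_smult[OF fl x, of c] by simp
    moreover have "Re (f (c \<odot> x)) = u (c \<odot> x)" using x by (simp add: f_def)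
    ultimately have "cmod (f x) = u (c \<odot> x)" by simp
    also have "\<dots> \<le> nrm V x" using un[of "c \<odot> x"] x c by (simp add: nrm_smult)
    finally show ?thesis .
  qed (use x in simp)
  have "q (\<ominus> e) \<le> - nrm V e" using q(2)[of "\<ominus> e" 1] e by (simp add: l_neg)
  then have "nrm V e \<le> u e" using u(2)[of "\<ominus> e"] neg e by simp
  also have "\<dots> = Re (f e)" using e by (simp add: f_def)
  also have "\<dots> \<le> cmod (f e)" by (rule complex_Re_le_cmod)
  finally have "nrm V e \<le> cmod (f e)" .
  moreover have "f \<in> bounded_functionals V"
    using fl bound by (auto simp: bounded_functionals_iff f_def intro!: exI[of _ 1])
  ultimately show ?thesis using bound by blast
qed

end

section \<open>Operator norms and dual spaces\<close>

text \<open>The choice of delta in two continuity estimates; the summand 1 covers K = 0.\<close>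

lemma divide_succ_mult_less: "0 \<le> K \<Longrightarrow> 0 < e \<Longrightarrow> e / (K + 1) * K < (e :: real)"
  by (simp add: field_simps)

context normed_cspace
begin

text \<open>Each single equation defines a closed subset of the compact ball. If the whole system
  has no solution, some finite subsystem has none, and \<open>finite_separation\<close> applies to
  it.\<close>

lemma separation:
  assumes cpt: "compactin T (nball V r)" and r: "0 \<le> r"
    and lin: "\<And>i. i \<in> I \<Longrightarrow> linear_functional V (f i)"
    and cont: "\<And>i. i \<in> I \<Longrightarrow> continuous_map (subtopology T (nball V r)) euclidean (f i)"
    and sep: "\<not> (\<exists>v\<in>nball V r. \<forall>i\<in>I. f i v = z i)"
  shows "\<exists>J d s. finite J \<and> J \<subseteq> I \<and> (\<forall>v\<in>nball V r. cmod (\<Sum>i\<in>J. d i * f i v) \<le> s) \<and>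
    s < Re (\<Sum>i\<in>J. d i * z i)"
proof -
  let ?X = "subtopology T (nball V r)"
  have top: "topspace ?X = nball V r"
    using compactin_subset_topspace[OF cpt] by auto
  define C where "C i = {v \<in> topspace ?X. f i v = z i}" for i
  have clo: "closedin ?X (C i)" if "i \<in> I" for i
    unfolding C_def using cont[OF that] by (intro closedin_continuous_maps_eq[of euclidean]) auto
  have "\<exists>J. finite J \<and> J \<subseteq> I \<and> \<not> (\<exists>v\<in>nball V r. \<forall>i\<in>J. f i v = z i)"
  proof (rule ccontr)
    assume contr: "\<nexists>J. finite J \<and> J \<subseteq> I \<and> \<not> (\<exists>v\<in>nball V r. \<forall>i\<in>J. f i v = z i)"
    have *: "\<exists>v\<in>nball V r. \<forall>i\<in>J. f i v = z i" if "finite J" "J \<subseteq> I" for J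
      using contr[simplified, rule_format, of J] that by auto
    \<comment> \<open>The whole ball is a member of the family, so that the intersection stays
      inside it even if I is empty.\<close>
    have "\<Inter>(insert (topspace ?X) (C ` I)) \<noteq> {}"
    proof (rule compact_space_fip[THEN iffD1, rule_format])
      show "compact_space ?X" using cpt by (simp add: compactin_subspace)
      show "(\<forall>S\<in>insert (topspace ?X) (C ` I). closedin ?X S) \<and>
        (\<forall>\<F>. finite \<F> \<and> \<F> \<subseteq> insert (topspace ?X) (C ` I) \<longrightarrow> \<Inter>\<F> \<noteq> {})"
      proof (intro conjI allI impI)
        show "\<forall>S\<in>insert (topspace ?X) (C ` I). closedin ?X S" using clo by (auto simp del: topspace_subtopology)
        fix \<F> assume \<F>: "finite \<F> \<and> \<F> \<subseteq> insert (topspace ?X) (C ` I)"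
        then have "finite (\<F> - {topspace ?X})" "\<F> - {topspace ?X} \<subseteq> C ` I" by auto
        from finite_subset_image[OF this] obtain J where
          J: "J \<subseteq> I" "finite J" "\<F> - {topspace ?X} = C ` J" by blast
        then obtain v where "v \<in> nball V r" "\<forall>i\<in>J. f i v = z i" using *[OF J(2,1)] by blast
        then have "v \<in> S" if "S \<in> \<F>" for S
          using J(3) that top unfolding C_def by blast
        then show "\<Inter>\<F> \<noteq> {}" by blast
      qed
    qed
    then obtain v where "v \<in> topspace ?X" "\<forall>i\<in>I. v \<in> C i" by auto
    then show False using sep top by (auto simp: C_def)
  qed
  then obtain J where J: "finite J" "J \<subseteq> I" "\<not> (\<exists>v\<in>nball V r. \<forall>i\<in>J. f i v = z i)" by blast
  obtain d s where "\<forall>v\<in>nball V r. cmod (\<Sum>i\<in>J. d i * f i v) \<le> s" "s < Re (\<Sum>i\<in>J. d i * z i)"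
    using finite_separation[OF cpt r J(1) _ _ J(3)] lin cont J(2) by blast
  then show ?thesis using J by blast
qed

section \<open>Operator norms\<close>

lemma op_norm_le: "(\<And>x. x \<in> nball V 1 \<Longrightarrow> n (f x) \<le> K) \<Longrightarrow> op_norm V n f \<le> K"
  unfolding op_norm_def using zero_in_nball[of 1] by (intro cSup_least) (auto simp: nball_def)

text \<open>A supremum of reals is informative only for a bounded set, so some K must be known
  beforehand; it may be negative, hence |K| in the estimate. The norm n on the codomain is arbitrary
  because the same facts serve functionals and multipliers.\<close>

lemma op_norm_upper:
  assumes bound: "\<And>x. x \<in> carrier V \<Longrightarrow> n (f x) \<le> K * nrm V x" and x: "x \<in> nball V 1"
  shows "n (f x) \<le> op_norm V n f"
  unfolding op_norm_def
proof (rule cSup_upper)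
  show "bdd_above {n (f x) |x. x \<in> carrier V \<and> nrm V x \<le> 1}"
  proof (rule bdd_aboveI)
    fix t assume "t \<in> {n (f x) |x. x \<in> carrier V \<and> nrm V x \<le> 1}"
    then obtain y where y: "t = n (f y)" "y \<in> carrier V" "nrm V y \<le> 1" by blast
    have "t \<le> K * nrm V y" using y bound by simp
    also have "\<dots> \<le> \<bar>K\<bar> * nrm V y" using y by (intro mult_right_mono) auto
    also have "\<dots> \<le> \<bar>K\<bar> * 1" using y by (intro mult_left_mono) auto
    finally show "t \<le> \<bar>K\<bar>" by simp
  qed
qed (use x in \<open>auto simp: nball_def\<close>)

lemma op_norm_bound:
  assumes hom: "\<And>c x. x \<in> carrier V \<Longrightarrow> n (f (c \<odot> x)) = cmod c * n (f x)"
    and bound: "\<And>x. x \<in> carrier V \<Longrightarrow> n (f x) \<le> K * nrm V x" and x: "x \<in> carrier V"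
  shows "n (f x) \<le> op_norm V n f * nrm V x"
proof (cases "nrm V x = 0")
  case True
  then show ?thesis using bound[OF x] by simp
next
  case False
  then have pos: "nrm V x > 0" using x by (simp add: order_less_le)
  let ?y = "of_real (1 / nrm V x) \<odot> x"
  have "?y \<in> nball V 1" using x pos by (simp add: nball_def nrm_smult norm_divide)
  from op_norm_upper[of n f K, OF bound this] have "n (f ?y) \<le> op_norm V n f" by simp
  moreover have "n (f ?y) = n (f x) / nrm V x"
    using hom[OF x] pos by (simp add: norm_divide)
  ultimately have "n (f x) / nrm V x \<le> op_norm V n f" by simp
  then show ?thesis using pos by (simp only: pos_divide_le_eq)
qed

lemma op_norm_nonneg:
  assumes hom: "\<And>c x. x \<in> carrier V \<Longrightarrow> n (f (c \<odot> x)) = cmod c * n (f x)"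
    and bound: "\<And>x. x \<in> carrier V \<Longrightarrow> n (f x) \<le> K * nrm V x"
  shows "0 \<le> op_norm V n f"
  using op_norm_upper[of n f K \<zero>] bound zero_in_nball[of 1] hom[of \<zero> 0] by simp

section \<open>Bounded functionals and closed subspaces of the dual\<close>

lemma functional_hom:
  "linear_functional V f \<Longrightarrow> x \<in> carrier V \<Longrightarrow> cmod (f (c \<odot> x)) = cmod c * cmod (f x)"
  by (simp add: linear_functional_smult norm_mult)

lemma functional_bound:
  assumes "f \<in> bounded_functionals V" "x \<in> carrier V"
  shows "cmod (f x) \<le> op_norm V cmod f * nrm V x"
proof -
  obtain K where "\<forall>x\<in>carrier V. cmod (f x) \<le> K * nrm V x" and "linear_functional V f"
    using assms(1) by (auto simp: bounded_functionals_iff)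
  then show ?thesis
    using assms(2) by (intro op_norm_bound[of cmod f K]) (auto simp: functional_hom)
qed

lemma functional_op_norm_nonneg:
  assumes "f \<in> bounded_functionals V" shows "0 \<le> op_norm V cmod f"
proof -
  obtain K where "\<forall>x\<in>carrier V. cmod (f x) \<le> K * nrm V x" and "linear_functional V f"
    using assms(1) by (auto simp: bounded_functionals_iff)
  then show ?thesis by (intro op_norm_nonneg[of cmod f K]) (auto simp: functional_hom)
qed

text \<open>Operations and norm are inherited from the dual, so one treatment covers both the full
  dual and the predual of the Dixmier-Ng theorem.\<close>

definition functional_subspace :: "('a \<Rightarrow> complex) set \<Rightarrow> bool" where
  "functional_subspace S \<longleftrightarrow> S \<subseteq> bounded_functionals V \<and> (\<lambda>x\<in>carrier V. 0) \<in> S \<and>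
     (\<forall>f\<in>S. \<forall>g\<in>S. (\<lambda>x\<in>carrier V. f x + g x) \<in> S) \<and>
     (\<forall>c. \<forall>f\<in>S. (\<lambda>x\<in>carrier V. c * f x) \<in> S)"

lemma functional_subspace_bounded_functionals: "functional_subspace (bounded_functionals V)"
proof -
  have "(\<lambda>x\<in>carrier V. f x + g x) \<in> bounded_functionals V"
    if "f \<in> bounded_functionals V" "g \<in> bounded_functionals V" for f g
  proof -
    have "cmod (f x + g x) \<le> (op_norm V cmod f + op_norm V cmod g) * nrm V x" if "x \<in> carrier V" for x
      using functional_bound[of f x] functional_bound[of g x] norm_triangle_ineq[of "f x" "g x"]
        that \<open>f \<in> _\<close> \<open>g \<in> _\<close> by (simp add: distrib_right)
    then show ?thesis
      using that by (auto simp: bounded_functionals_iff linear_functional_def distrib_left)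
  qed
  moreover have "(\<lambda>x\<in>carrier V. c * f x) \<in> bounded_functionals V"
    if "f \<in> bounded_functionals V" for c f
  proof -
    have "cmod (c * f x) \<le> (cmod c * op_norm V cmod f) * nrm V x" if "x \<in> carrier V" for x
      using functional_bound[of f x] that \<open>f \<in> _\<close> by (simp add: norm_mult mult_left_mono mult.assoc)
    then show ?thesis
      using that by (auto simp: bounded_functionals_iff linear_functional_def distrib_left)
  qed
  ultimately show ?thesis
    by (auto simp: functional_subspace_def bounded_functionals_iff linear_functional_def
        intro!: exI[of _ 0])
qed

lemma dual_subspace_normed:
  assumes "functional_subspace S"
  shows "normed_cspace (dual_space V\<lparr>carrier := S\<rparr>)"
proof -
  let ?D = "dual_space V\<lparr>carrier := S\<rparr>"
  have S: "f \<in> bounded_functionals V" if "f \<in> S" for f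
    using assms that by (auto simp: functional_subspace_def)
  have ext: "restrict f (carrier V) = f" if "f \<in> S" for f
    using S[OF that] by (simp add: bounded_functionals_iff extensional_restrict)
  have D: "carrier ?D = S" "zero ?D = (\<lambda>x\<in>carrier V. 0)"
    "add ?D = (\<lambda>f g. \<lambda>x\<in>carrier V. f x + g x)" "smult ?D = (\<lambda>c f. \<lambda>x\<in>carrier V. c * f x)"
    "nrm ?D = op_norm V cmod"
    by (simp_all add: dual_space_def)
  have cl: "(\<lambda>x\<in>carrier V. 0) \<in> S" "\<And>f g. f \<in> S \<Longrightarrow> g \<in> S \<Longrightarrow> (\<lambda>x\<in>carrier V. f x + g x) \<in> S"
    "\<And>c f. f \<in> S \<Longrightarrow> (\<lambda>x\<in>carrier V. c * f x) \<in> S"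
    using assms by (auto simp: functional_subspace_def)
  have "abelian_group ?D"
  proof (rule abelian_groupI)
    fix f assume f: "f \<in> carrier ?D"
    have "(\<lambda>x\<in>carrier V. (- 1) * f x) \<in> S" using cl(3)[of f "- 1"] f D(1) by simp
    moreover have "(\<lambda>x\<in>carrier V. (\<lambda>x\<in>carrier V. (- 1) * f x) x + f x) = (\<lambda>x\<in>carrier V. 0)"
      by (rule restrict_ext) simp
    ultimately show "\<exists>g\<in>carrier ?D. g \<oplus>\<^bsub>?D\<^esub> f = \<zero>\<^bsub>?D\<^esub>" unfolding D by blast
    have "(\<lambda>x\<in>carrier V. (\<lambda>x\<in>carrier V. 0) x + f x) = restrict f (carrier V)"
      by (rule restrict_ext) simp
    then show "\<zero>\<^bsub>?D\<^esub> \<oplus>\<^bsub>?D\<^esub> f = f" using ext f unfolding D by simp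
  qed (auto simp: D cl intro!: restrict_ext)
  then have "module complex_ring ?D"
  proof (intro moduleI cring_complex_ring)
    fix f assume f: "f \<in> carrier ?D"
    have "(\<lambda>x\<in>carrier V. 1 * f x) = restrict f (carrier V)" by (rule restrict_ext) simp
    then show "\<one>\<^bsub>complex_ring\<^esub> \<odot>\<^bsub>?D\<^esub> f = f" using ext f unfolding D complex_ring_simps by simp
  qed (auto simp: D cl distrib_left distrib_right intro!: restrict_ext)
  then interpret D: module complex_ring ?D .
  show ?thesis
  proof unfold_locales
    fix f assume f: "f \<in> carrier ?D" "nrm ?D f = 0"
    have "f x = 0" if "x \<in> carrier V" for x
      using functional_bound[of f x] f S that by (simp add: D)
    then have "restrict f (carrier V) = (\<lambda>x\<in>carrier V. 0)" by (intro restrict_ext) auto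
    then show "f = \<zero>\<^bsub>?D\<^esub>" using ext f by (simp add: D)
  next
    have le: "op_norm V cmod (\<lambda>x\<in>carrier V. c * f x) \<le> cmod c * op_norm V cmod f" if f: "f \<in> S" for c f
    proof (rule op_norm_le)
      fix x assume x: "x \<in> nball V 1"
      have "cmod (f x) \<le> op_norm V cmod f"
        using op_norm_upper[of cmod f "op_norm V cmod f" x] functional_bound[OF S[OF f]] x by simp
      then show "cmod ((\<lambda>x\<in>carrier V. c * f x) x) \<le> cmod c * op_norm V cmod f"
        using x by (simp add: nball_def norm_mult mult_left_mono)
    qed
    fix c f assume f: "f \<in> carrier ?D"
    then have fS: "f \<in> S" by (simp add: D)
    show "nrm ?D (c \<odot>\<^bsub>?D\<^esub> f) = cmod c * nrm ?D f"
    proof (cases "c = 0")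
      case True
      then show ?thesis
        using le[OF fS, of c] functional_op_norm_nonneg[OF S[OF cl(3)[OF fS]], of c] by (simp add: D)
    next
      case False
      let ?g = "\<lambda>x\<in>carrier V. c * f x"
      \<comment> \<open>Scaling back by 1/c turns the inequality \<open>le\<close> into the reverse
        one.\<close>
      have "(\<lambda>x\<in>carrier V. (1 / c) * ?g x) = restrict f (carrier V)"
        using False by (intro restrict_ext) simp
      then have "op_norm V cmod f \<le> cmod (1 / c) * op_norm V cmod ?g"
        using le[OF cl(3)[OF fS], of "1 / c" c] ext[OF fS] by simp
      then show ?thesis
        using le[OF fS, of c] False by (simp add: D norm_divide field_simps)
    qed
  next
    fix f g assume fg: "f \<in> carrier ?D" "g \<in> carrier ?D"
    have "cmod (f x + g x) \<le> op_norm V cmod f + op_norm V cmod g" if x: "x \<in> nball V 1" for x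
      using op_norm_upper[of cmod f "op_norm V cmod f" x] op_norm_upper[of cmod g "op_norm V cmod g" x]
        functional_bound[OF S] fg x norm_triangle_ineq[of "f x" "g x"] by (simp add: D)
    then show "nrm ?D (f \<oplus>\<^bsub>?D\<^esub> g) \<le> nrm ?D f + nrm ?D g"
      unfolding D by (intro op_norm_le) (simp add: nball_def)
  qed
qed

text \<open>A Cauchy sequence converges pointwise, and its uniform estimate relative to the norm of
  the argument survives in the limit. Closedness of S is phrased by this same estimate, so it is
  immediate for the full dual and a matter of uniform limits for functionals that are continuous on
  balls.\<close>

lemma dual_subspace_banach:
  assumes S: "functional_subspace S"
    and lim: "\<And>f. f \<in> bounded_functionals V \<Longrightarrow>
      \<forall>\<epsilon>>0. \<exists>g\<in>S. \<forall>x\<in>carrier V. cmod (f x - g x) \<le> \<epsilon> * nrm V x \<Longrightarrow> f \<in> S"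
  shows "banach_space (dual_space V\<lparr>carrier := S\<rparr>)"
proof -
  let ?D = "dual_space V\<lparr>carrier := S\<rparr>"
  interpret D: normed_cspace ?D by (rule dual_subspace_normed[OF S])
  have SB: "f \<in> bounded_functionals V" if "f \<in> S" for f
    using S that by (auto simp: functional_subspace_def)
  have carD: "carrier ?D = S" and nrmD: "nrm ?D = op_norm V cmod" by (simp_all add: dual_space_def)
  have minus: "(f \<ominus>\<^bsub>?D\<^esub> g) x = f x - g x" if "f \<in> S" "g \<in> S" "x \<in> carrier V" for f g x
    using that D.minus_eq_smult[of f g] by (simp add: dual_space_def)
  show ?thesis
  proof (unfold_locales)
    fix s :: "nat \<Rightarrow> 'a \<Rightarrow> complex"
    assume s: "\<forall>n. s n \<in> carrier ?D"
      and cau: "\<forall>e>0. \<exists>N. \<forall>m\<ge>N. \<forall>n\<ge>N. nrm ?D (s m \<ominus>\<^bsub>?D\<^esub> s n) < e"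
    have sS: "s n \<in> S" for n using s carD by simp
    have diff: "cmod (s m x - s n x) \<le> nrm ?D (s m \<ominus>\<^bsub>?D\<^esub> s n) * nrm V x" if "x \<in> carrier V" for m n x
    proof -
      have "s m \<ominus>\<^bsub>?D\<^esub> s n \<in> S" using D.minus_closed[of "s m" "s n"] sS carD by simp
      from functional_bound[OF SB[OF this] that] show ?thesis
        by (simp add: minus[OF sS sS that] nrmD)
    qed
    have unif: "\<exists>N. \<forall>m\<ge>N. \<forall>n\<ge>N. \<forall>x\<in>carrier V. cmod (s m x - s n x) \<le> e * nrm V x" if e: "e > 0" for e
    proof -
      obtain N where N: "\<forall>m\<ge>N. \<forall>n\<ge>N. nrm ?D (s m \<ominus>\<^bsub>?D\<^esub> s n) < e" using cau e by blast
      have "cmod (s m x - s n x) \<le> e * nrm V x" if "m \<ge> N" "n \<ge> N" "x \<in> carrier V" for m n x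
        by (rule order_trans[OF diff mult_right_mono]) (use N that in \<open>auto intro: less_imp_le\<close>)
      then show ?thesis by blast
    qed
    have conv: "convergent (\<lambda>n. s n x)" if x: "x \<in> carrier V" for x
    proof -
      have "Cauchy (\<lambda>n. s n x)"
        unfolding Cauchy_def dist_norm
      proof (intro allI impI)
        fix e :: real assume e: "e > 0"
        have pos: "nrm V x + 1 > 0" using x nrm_nonneg[of x] by linarith
        define \<delta> where "\<delta> = e / (nrm V x + 1)"
        have "\<delta> > 0" using pos e by (simp add: \<delta>_def)
        from unif[OF this] obtain N where
          N: "\<forall>m\<ge>N. \<forall>n\<ge>N. \<forall>x\<in>carrier V. cmod (s m x - s n x) \<le> \<delta> * nrm V x" ..
        have "\<delta> * nrm V x < e"
          unfolding \<delta>_def using x e by (intro divide_succ_mult_less) auto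
        then show "\<exists>M. \<forall>m\<ge>M. \<forall>n\<ge>M. cmod (s m x - s n x) < e"
          using N x by (meson le_less_trans)
      qed
      then show ?thesis by (simp add: Cauchy_convergent_iff)
    qed
    define f where "f = (\<lambda>x\<in>carrier V. lim (\<lambda>n. s n x))"
    have f: "(\<lambda>n. s n x) \<longlonglongrightarrow> f x" if "x \<in> carrier V" for x
      using conv[OF that] that by (simp add: f_def convergent_LIMSEQ_iff)
    have near: "\<exists>N. \<forall>n\<ge>N. \<forall>x\<in>carrier V. cmod (f x - s n x) \<le> e * nrm V x" if e: "e > 0" for e
    proof -
      obtain N where N: "\<forall>m\<ge>N. \<forall>n\<ge>N. \<forall>x\<in>carrier V. cmod (s m x - s n x) \<le> e * nrm V x"
        using unif[OF e] by blast
      have "cmod (f x - s n x) \<le> e * nrm V x" if "n \<ge> N" "x \<in> carrier V" for n x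
      proof (rule LIMSEQ_le_const2)
        show "(\<lambda>m. cmod (s m x - s n x)) \<longlonglongrightarrow> cmod (f x - s n x)"
          by (intro tendsto_intros f that)
        show "\<exists>M. \<forall>m\<ge>M. cmod (s m x - s n x) \<le> e * nrm V x" using N that by blast
      qed
      then show ?thesis by blast
    qed
    have lin: "linear_functional V (s n)" for n using SB[OF sS] by (simp add: bounded_functionals_iff)
    have fl: "linear_functional V f"
      unfolding linear_functional_def
    proof (intro conjI ballI allI)
      fix x y assume xy: "x \<in> carrier V" "y \<in> carrier V"
      have "(\<lambda>n. s n (x \<oplus> y)) \<longlonglongrightarrow> f x + f y"
        using tendsto_add[OF f[OF xy(1)] f[OF xy(2)]] by (simp add: linear_functional_add[OF lin] xy)
      then show "f (x \<oplus> y) = f x + f y" using f[of "x \<oplus> y"] xy LIMSEQ_unique by blast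
    next
      fix c x assume x: "x \<in> carrier V"
      have "(\<lambda>n. s n (c \<odot> x)) \<longlonglongrightarrow> c * f x"
        using tendsto_mult_left[OF f[OF x], of c] by (simp add: linear_functional_smult[OF lin] x)
      then show "f (c \<odot> x) = c * f x" using f[of "c \<odot> x"] x LIMSEQ_unique by blast
    qed
    obtain N where N: "\<forall>x\<in>carrier V. cmod (f x - s N x) \<le> 1 * nrm V x"
      using near[of 1] by auto
    have "cmod (f x) \<le> (1 + op_norm V cmod (s N)) * nrm V x" if "x \<in> carrier V" for x
    proof -
      have "cmod (f x) \<le> cmod (f x - s N x) + cmod (s N x)"
        using norm_triangle_ineq[of "f x - s N x" "s N x"] by simp
      then show ?thesis
        using bspec[OF N that] functional_bound[OF SB[OF sS] that, of N] by (simp add: distrib_right)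
    qed
    then have "f \<in> bounded_functionals V"
      using fl by (auto simp: bounded_functionals_iff f_def)
    moreover have "\<forall>\<epsilon>>0. \<exists>g\<in>S. \<forall>x\<in>carrier V. cmod (f x - g x) \<le> \<epsilon> * nrm V x"
      using near sS by (meson order_refl)
    ultimately have fS: "f \<in> S" by (rule lim)
    have "(\<lambda>n. nrm ?D (s n \<ominus>\<^bsub>?D\<^esub> f)) \<longlonglongrightarrow> 0"
    proof (rule LIMSEQ_I)
      fix e :: real assume e: "e > 0"
      obtain N where N: "\<forall>n\<ge>N. \<forall>x\<in>carrier V. cmod (f x - s n x) \<le> (e/2) * nrm V x"
        using near[of "e/2"] e by auto
      have "norm (nrm ?D (s n \<ominus>\<^bsub>?D\<^esub> f) - 0) < e" if n: "n \<ge> N" for n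
      proof -
        \<comment> \<open>Half of e, because the supremum preserves only the weak
          inequality.\<close>
        have "nrm ?D (s n \<ominus>\<^bsub>?D\<^esub> f) \<le> e/2"
          unfolding nrmD
        proof (rule op_norm_le)
          fix x assume "x \<in> nball V 1"
          then have x: "x \<in> carrier V" "nrm V x \<le> 1" by (auto simp: nball_def)
          have "cmod ((s n \<ominus>\<^bsub>?D\<^esub> f) x) = cmod (f x - s n x)"
            using minus[OF sS fS x(1)] by (simp add: norm_minus_commute)
          also have "\<dots> \<le> (e/2) * nrm V x" using N n x by blast
          also have "\<dots> \<le> (e/2) * 1" using e x by (intro mult_left_mono) auto
          finally show "cmod ((s n \<ominus>\<^bsub>?D\<^esub> f) x) \<le> e/2" by simp
        qed
        moreover have "0 \<le> nrm ?D (s n \<ominus>\<^bsub>?D\<^esub> f)"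
          using D.nrm_nonneg[of "s n \<ominus>\<^bsub>?D\<^esub> f"] D.minus_closed[of "s n" f] sS fS carD by simp
        ultimately show ?thesis using e by simp
      qed
      then show "\<exists>N. \<forall>n\<ge>N. norm (nrm ?D (s n \<ominus>\<^bsub>?D\<^esub> f) - 0) < e" by blast
    qed
    then show "\<exists>l\<in>carrier ?D. (\<lambda>n. nrm ?D (s n \<ominus>\<^bsub>?D\<^esub> l)) \<longlonglongrightarrow> 0"
      using fS carD by blast
  qed (fact D.nrm_eq_zero D.nrm_smult D.nrm_triangle)+
qed

end

section \<open>Weak* topologies\<close>

lemma continuous_map_cmult:
  fixes f :: "'a \<Rightarrow> complex"
  shows "continuous_map X euclidean f \<Longrightarrow> continuous_map X euclidean (\<lambda>x. c * f x)"
  by (simp add: continuous_map_atin tendsto_mult)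

locale predual_pair = V: normed_cspace V + E: banach_space E
  for V :: "('v, 'm) normed_module_scheme" and E :: "('e, 'n) normed_module_scheme" +
  fixes \<phi> :: "'v \<Rightarrow> 'e \<Rightarrow> complex"
  assumes iso: "isometric_isomorphism V (dual_space E) \<phi>"
begin

lemma bij: "bij_betw \<phi> (carrier V) (bounded_functionals E)"
  using iso by (simp add: isometric_isomorphism_def dual_space_def)

lemma functional: "v \<in> carrier V \<Longrightarrow> \<phi> v \<in> bounded_functionals E"
  using bij by (auto simp: bij_betw_def)

lemma ext: "v \<in> carrier V \<Longrightarrow> \<phi> v \<in> extensional (carrier E)"
  using functional by (simp add: bounded_functionals_def)

lemma linear_right: "v \<in> carrier V \<Longrightarrow> linear_functional E (\<phi> v)"
  using functional by (simp add: bounded_functionals_iff)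

lemma linear_left: "e \<in> carrier E \<Longrightarrow> linear_functional V (\<lambda>v. \<phi> v e)"
  using iso by (simp add: isometric_isomorphism_def dual_space_def linear_functional_def)

lemma nrm_eq: "v \<in> carrier V \<Longrightarrow> op_norm E cmod (\<phi> v) = nrm V v"
  using iso by (simp add: isometric_isomorphism_def dual_space_def)

lemma bound: "v \<in> carrier V \<Longrightarrow> e \<in> carrier E \<Longrightarrow> cmod (\<phi> v e) \<le> nrm V v * nrm E e"
  using E.functional_bound[OF functional] by (simp add: nrm_eq)

lemma nrm_le: "v \<in> carrier V \<Longrightarrow> (\<And>e. e \<in> nball E 1 \<Longrightarrow> cmod (\<phi> v e) \<le> K) \<Longrightarrow> nrm V v \<le> K"
  using E.op_norm_le[of cmod "\<phi> v"] by (simp add: nrm_eq)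

lemma surj: "f \<in> bounded_functionals E \<Longrightarrow> \<exists>v\<in>carrier V. \<phi> v = f"
  using bij unfolding bij_betw_def by (metis imageE)

lemma eqI:
  assumes "v \<in> carrier V" "w \<in> carrier V" "\<And>e. e \<in> carrier E \<Longrightarrow> \<phi> v e = \<phi> w e"
  shows "v = w"
proof -
  have "\<phi> v = \<phi> w" using assms ext by (intro extensionalityI[of _ "carrier E"]) auto
  then show ?thesis using bij assms(1,2) by (auto simp: bij_betw_def inj_on_def)
qed

abbreviation "\<W> \<equiv> weak_star V E \<phi>"

lemma topspace_weak_star [simp]: "topspace \<W> = carrier V"
  using ext by (auto simp: weak_star_def topspace_pullback_topology PiE_def)

text \<open>The universal property of the initial topology; it reduces continuity into a
  weak*-topology to scalar functions.\<close>

lemma continuous_map_weak_star: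
  "continuous_map X \<W> g \<longleftrightarrow> g \<in> topspace X \<rightarrow> carrier V \<and>
     (\<forall>e\<in>carrier E. continuous_map X euclidean (\<lambda>x. \<phi> (g x) e))"
proof (intro iffI conjI ballI)
  assume g: "continuous_map X \<W> g"
  then show "g \<in> topspace X \<rightarrow> carrier V" by (auto simp: continuous_map_def)
  fix e assume "e \<in> carrier E"
  then have "continuous_map \<W> euclidean ((\<lambda>u. u e) \<circ> \<phi>)"
    unfolding weak_star_def
    by (intro continuous_map_pullback continuous_map_product_projection)
  from continuous_map_compose[OF g this]
  show "continuous_map X euclidean (\<lambda>x. \<phi> (g x) e)" by (simp add: o_def)
next
  assume g: "g \<in> topspace X \<rightarrow> carrier V \<and>
    (\<forall>e\<in>carrier E. continuous_map X euclidean (\<lambda>x. \<phi> (g x) e))"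
  then show "continuous_map X \<W> g"
    unfolding weak_star_def
    by (intro continuous_map_pullback') (use ext in \<open>auto simp: continuous_map_componentwise\<close>)
qed

lemma continuous_map_pairing: "e \<in> carrier E \<Longrightarrow> continuous_map \<W> euclidean (\<lambda>v. \<phi> v e)"
  using continuous_map_weak_star[of \<W> id] by simp

lemma Hausdorff: "Hausdorff_space \<W>"
proof (rule Hausdorff_space_injective_preimage)
  have "continuous_map \<W> (product_topology (\<lambda>_. euclidean) (carrier E)) (id \<circ> \<phi>)"
    unfolding weak_star_def by (intro continuous_map_pullback continuous_map_id)
  then show "continuous_map \<W> (product_topology (\<lambda>_. euclidean) (carrier E)) \<phi>" by simp
  show "inj_on \<phi> (topspace \<W>)" using bij by (simp add: bij_betw_def)
  show "Hausdorff_space (product_topology (\<lambda>_. euclidean :: complex topology) (carrier E))"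
    by (simp add: Hausdorff_space_product_topology)
qed

text \<open>By Tychonoff the product of the discs of radius r ||e|| is compact. The linear functions
  in it form a closed subset, which is exactly the image of the ball, and the inverse of
  \<open>\<phi>\<close> is continuous on the image of V.\<close>

theorem banach_alaoglu: "compactin \<W> (nball V r)"
proof (cases "0 \<le> r")
  case False
  then have "nball V r = {}" using order_trans[OF V.nrm_nonneg, of _ r] by (auto simp: nball_def)
  then show ?thesis by simp
next
  case r: True
  let ?X = "product_topology (\<lambda>_. euclidean :: complex topology) (carrier E)"
  let ?K = "PiE (carrier E) (\<lambda>e. cball 0 (r * nrm E e))"
  have proj: "continuous_map ?X euclidean (\<lambda>u. u e)" if "e \<in> carrier E" for e
    using that by (rule continuous_map_product_projection)
  define C where "C = {u \<in> topspace ?X. linear_functional E u}"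
  have "C = (\<Inter>(x, y)\<in>carrier E \<times> carrier E. {u \<in> topspace ?X. u (x \<oplus>\<^bsub>E\<^esub> y) = u x + u y}) \<inter>
      (\<Inter>(c, x)\<in>UNIV \<times> carrier E. {u \<in> topspace ?X. u (c \<odot>\<^bsub>E\<^esub> x) = c * u x})"
    using E.zero_closed unfolding C_def linear_functional_def by blast
  also have "closedin ?X \<dots>"
  proof (intro closedin_Int closedin_INT)
    fix p assume "p \<in> carrier E \<times> carrier E"
    then obtain x y where "p = (x, y)" "x \<in> carrier E" "y \<in> carrier E" by blast
    moreover from this have "closedin ?X {u \<in> topspace ?X. u (x \<oplus>\<^bsub>E\<^esub> y) = u x + u y}"
      by (intro closedin_continuous_maps_eq[of euclidean] continuous_map_add proj) auto
    ultimately show "closedin ?X (case p of (x, y) \<Rightarrow> {u \<in> topspace ?X. u (x \<oplus>\<^bsub>E\<^esub> y) = u x + u y})"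
      by simp
  next
    fix p :: "complex \<times> 'e" assume "p \<in> UNIV \<times> carrier E"
    then obtain c x where "p = (c, x)" "x \<in> carrier E" by blast
    moreover from this have "closedin ?X {u \<in> topspace ?X. u (c \<odot>\<^bsub>E\<^esub> x) = c * u x}"
      by (intro closedin_continuous_maps_eq[of euclidean] continuous_map_cmult proj) auto
    ultimately show "closedin ?X (case p of (c, x) \<Rightarrow> {u \<in> topspace ?X. u (c \<odot>\<^bsub>E\<^esub> x) = c * u x})"
      by simp
  qed auto
  finally have "closedin ?X C" .
  moreover have "compactin ?X ?K" by (simp add: compactin_PiE)
  ultimately have KC: "compactin ?X (?K \<inter> C)" by (rule compact_Int_closedin[rotated])
  have KCV: "?K \<inter> C \<subseteq> \<phi> ` nball V r"
  proof
    fix u assume u: "u \<in> ?K \<inter> C"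
    then have bd: "cmod (u e) \<le> r * nrm E e" if "e \<in> carrier E" for e
      using that by (auto simp: PiE_iff)
    then have "u \<in> bounded_functionals E"
      using u by (auto simp: bounded_functionals_iff C_def PiE_def)
    then obtain v where v: "v \<in> carrier V" "\<phi> v = u" using surj by blast
    have "nrm V v \<le> r"
    proof (rule nrm_le[OF v(1)])
      fix e assume e: "e \<in> nball E 1"
      then have "cmod (\<phi> v e) \<le> r * nrm E e" using bd v by (auto simp: nball_def)
      also have "\<dots> \<le> r * 1" using e r by (intro mult_left_mono) (auto simp: nball_def)
      finally show "cmod (\<phi> v e) \<le> r" by simp
    qed
    then show "u \<in> \<phi> ` nball V r" using v by (auto simp: nball_def)
  qed
  have "\<phi> v \<in> ?K \<inter> C" if v: "v \<in> nball V r" for v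
  proof -
    have "cmod (\<phi> v e) \<le> r * nrm E e" if "e \<in> carrier E" for e
      using v that by (intro order_trans[OF bound mult_right_mono]) (auto simp: nball_def)
    then show ?thesis
      using v ext linear_right by (auto simp: nball_def C_def PiE_iff)
  qed
  with KCV have KC_eq: "?K \<inter> C = \<phi> ` nball V r" by blast
  let ?g = "inv_into (carrier V) \<phi>"
  have g: "?g (\<phi> v) = v" if "v \<in> carrier V" for v
    using bij that by (simp add: bij_betw_inv_into_left)
  have "continuous_map (subtopology ?X (\<phi> ` carrier V)) \<W> ?g"
    unfolding continuous_map_weak_star
  proof (intro conjI ballI)
    fix e assume "e \<in> carrier E"
    then have "continuous_map (subtopology ?X (\<phi> ` carrier V)) euclidean (\<lambda>u. u e)"
      by (intro continuous_map_from_subtopology proj)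
    then show "continuous_map (subtopology ?X (\<phi> ` carrier V)) euclidean (\<lambda>u. \<phi> (?g u) e)"
      by (rule continuous_map_eq) (auto simp: g)
  qed (auto simp: g)
  moreover have "compactin (subtopology ?X (\<phi> ` carrier V)) (\<phi> ` nball V r)"
    using KC V.nball_subset unfolding KC_eq by (auto simp: compactin_subtopology)
  ultimately have "compactin \<W> (?g ` \<phi> ` nball V r)" by (rule image_compactin[rotated])
  moreover have "(\<lambda>v. ?g (\<phi> v)) ` nball V r = (\<lambda>v. v) ` nball V r"
    by (rule image_cong) (use g in \<open>auto simp: nball_def\<close>)
  ultimately show ?thesis by (simp add: image_image)
qed

text \<open>The bound on the differences of the approximants is where the norm of the predual has to
  be recovered from its dual, which is the Hahn-Banach theorem.\<close>

theorem weak_star_continuous_functional: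
  assumes lin: "linear_functional V f"
    and cont: "continuous_map (subtopology \<W> (nball V 1)) euclidean f"
  shows "\<exists>e\<in>carrier E. \<forall>v\<in>carrier V. f v = \<phi> v e"
proof -
  have approx: "\<exists>e\<in>carrier E. \<forall>v\<in>nball V 1. cmod (f v - \<phi> v e) \<le> \<epsilon>" if \<epsilon>: "0 < \<epsilon>" for \<epsilon>
  proof -
    \<comment> \<open>The system f v = \<epsilon>, \<open>\<phi> v e = 0\<close> for all e has no
      solution, because the second part forces v = 0. \<open>None\<close> stands for f and
      \<open>Some e\<close> for the pairing with e.\<close>
    define I where "I = insert None (Some ` carrier E)"
    define F where "F i = (case i of None \<Rightarrow> f | Some e \<Rightarrow> \<lambda>v. \<phi> v e)" for i
    define z where "z i = (case i of None \<Rightarrow> complex_of_real \<epsilon> | Some (e :: 'e) \<Rightarrow> 0)" for i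
    have Flin: "linear_functional V (F i)" if "i \<in> I" for i
      using that lin linear_left by (auto simp: I_def F_def)
    have Fcont: "continuous_map (subtopology \<W> (nball V 1)) euclidean (F i)" if "i \<in> I" for i
      using that cont continuous_map_from_subtopology[OF continuous_map_pairing]
      by (auto simp: I_def F_def)
    have sep: "\<not> (\<exists>v\<in>nball V 1. \<forall>i\<in>I. F i v = z i)"
    proof
      assume "\<exists>v\<in>nball V 1. \<forall>i\<in>I. F i v = z i"
      then obtain v where v: "v \<in> nball V 1" "\<forall>i\<in>I. F i v = z i" by blast
      then have vV: "v \<in> carrier V" by (simp add: nball_def)
      have "\<phi> v e = \<phi> \<zero>\<^bsub>V\<^esub> e" if "e \<in> carrier E" for e
        using v(2) that V.linear_functional_zero[OF linear_left[OF that]]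
        by (auto simp: I_def F_def z_def)
      then have "v = \<zero>\<^bsub>V\<^esub>" using vV by (intro eqI) auto
      then have "f v = 0" using V.linear_functional_zero[OF lin] by simp
      moreover have "f v = of_real \<epsilon>" using v(2) by (auto simp: I_def F_def z_def)
      ultimately show False using \<epsilon> by simp
    qed
    obtain J d s where J: "finite J" "J \<subseteq> I"
      and le: "\<And>v. v \<in> nball V 1 \<Longrightarrow> cmod (\<Sum>i\<in>J. d i * F i v) \<le> s"
      and gt: "s < Re (\<Sum>i\<in>J. d i * z i)"
      using V.separation[OF banach_alaoglu zero_le_one Flin Fcont sep] by blast
    \<comment> \<open>The pairing is linear in e, so a finite combination of the functionals
      collapses to a multiple of f plus one single pairing.\<close>
    have "\<exists>c. \<exists>e\<in>carrier E. (\<forall>v\<in>carrier V. (\<Sum>i\<in>J. d i * F i v) = c * f v + \<phi> v e) \<and>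
        (\<Sum>i\<in>J. d i * z i) = c * of_real \<epsilon>"
      using J
    proof (induction J rule: finite_induct)
      case empty
      have "\<phi> v \<zero>\<^bsub>E\<^esub> = 0" if "v \<in> carrier V" for v
        using E.linear_functional_zero[OF linear_right[OF that]] .
      then show ?case by (intro exI[of _ 0] bexI[of _ "\<zero>\<^bsub>E\<^esub>"]) auto
    next
      case (insert i J)
      then obtain c e where e: "e \<in> carrier E"
        "\<And>v. v \<in> carrier V \<Longrightarrow> (\<Sum>i\<in>J. d i * F i v) = c * f v + \<phi> v e"
        "(\<Sum>i\<in>J. d i * z i) = c * of_real \<epsilon>" by blast
      show ?case
      proof (cases i)
        case None
        then show ?thesis
          using insert.hyps e
          by (intro exI[of _ "d i + c"] bexI[of _ e]) (auto simp: F_def z_def distrib_right)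
      next
        case (Some x)
        then have x: "x \<in> carrier E" using insert.prems by (auto simp: I_def)
        have "\<phi> v (d i \<odot>\<^bsub>E\<^esub> x \<oplus>\<^bsub>E\<^esub> e) = d i * \<phi> v x + \<phi> v e" if "v \<in> carrier V" for v
          using linear_right[OF that] x e(1)
          by (simp add: linear_functional_add linear_functional_smult)
        then show ?thesis
          using insert.hyps e x Some
          by (intro exI[of _ c] bexI[of _ "d i \<odot>\<^bsub>E\<^esub> x \<oplus>\<^bsub>E\<^esub> e"]) (auto simp: F_def z_def)
      qed
    qed
    then obtain c e where e: "e \<in> carrier E"
      "\<And>v. v \<in> carrier V \<Longrightarrow> (\<Sum>i\<in>J. d i * F i v) = c * f v + \<phi> v e"
      and c: "(\<Sum>i\<in>J. d i * z i) = c * of_real \<epsilon>" by blast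
    have s0: "0 \<le> s" using order_trans[OF norm_ge_zero le[OF V.zero_in_nball]] by simp
    \<comment> \<open>Together with s \<ge> 0 this gives c \<noteq> 0. Division by c then turns the
      bound s into an error s / |c| < \<epsilon>, with -e / c as the approximating element.\<close>
    have "s < cmod c * \<epsilon>"
      using less_le_trans[OF gt complex_Re_le_cmod] \<epsilon> unfolding c norm_mult by simp
    then have c0: "c \<noteq> 0" "s / cmod c < \<epsilon>" using s0 by (auto simp: divide_less_eq mult.commute)
    let ?e = "(- 1 / c) \<odot>\<^bsub>E\<^esub> e"
    have "cmod (f v - \<phi> v ?e) \<le> \<epsilon>" if v: "v \<in> nball V 1" for v
    proof -
      have vV: "v \<in> carrier V" using v by (simp add: nball_def)
      have "f v - \<phi> v ?e = (c * f v + \<phi> v e) / c"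
        using linear_functional_smult[OF linear_right[OF vV] e(1)] c0 by (simp add: field_simps)
      then have "cmod (f v - \<phi> v ?e) \<le> s / cmod c"
        using le[OF v] e(2)[OF vV] by (simp add: norm_divide divide_right_mono)
      then show ?thesis using c0(2) by simp
    qed
    then show ?thesis using e(1) by (intro bexI[of _ ?e]) auto
  qed
  have nrmE: "nrm E e \<le> K" if e: "e \<in> carrier E" and K: "\<And>v. v \<in> nball V 1 \<Longrightarrow> cmod (\<phi> v e) \<le> K" for e K
  proof -
    obtain g where g: "g \<in> bounded_functionals E" "\<And>x. x \<in> carrier E \<Longrightarrow> cmod (g x) \<le> nrm E x"
      "nrm E e \<le> cmod (g e)"
      using E.norming_functional[OF e] by blast
    obtain v where v: "v \<in> carrier V" "\<phi> v = g" using surj[OF g(1)] by blast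
    have "nrm V v \<le> 1" using g(2) v by (intro nrm_le) (auto simp: nball_def intro: order_trans)
    then show ?thesis using K[of v] v g(3) by (simp add: nball_def)
  qed
  have "\<exists>e. \<forall>n::nat. e n \<in> carrier E \<and> (\<forall>v\<in>nball V 1. cmod (f v - \<phi> v (e n)) \<le> inverse (Suc n))"
    using approx[of "inverse (Suc n)" for n] by (intro choice) auto
  then obtain e where e: "\<And>n::nat. e n \<in> carrier E"
    "\<And>n v. v \<in> nball V 1 \<Longrightarrow> cmod (f v - \<phi> v (e n)) \<le> inverse (Suc n)" by blast
  have dist: "nrm E (e m \<ominus>\<^bsub>E\<^esub> e n) \<le> inverse (Suc m) + inverse (Suc n)" for m n
  proof (rule nrmE)
    fix v assume v: "v \<in> nball V 1"
    then have "\<phi> v (e m \<ominus>\<^bsub>E\<^esub> e n) = (f v - \<phi> v (e n)) - (f v - \<phi> v (e m))"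
      using E.linear_functional_minus[OF linear_right] e(1) by (simp add: nball_def)
    also have "cmod \<dots> \<le> cmod (f v - \<phi> v (e n)) + cmod (f v - \<phi> v (e m))"
      by (rule norm_triangle_ineq4)
    finally show "cmod (\<phi> v (e m \<ominus>\<^bsub>E\<^esub> e n)) \<le> inverse (Suc m) + inverse (Suc n)"
      using e(2)[OF v, of m] e(2)[OF v, of n] by linarith
  qed (use e(1) in auto)
  have "\<forall>\<epsilon>>0. \<exists>N. \<forall>m\<ge>N. \<forall>n\<ge>N. nrm E (e m \<ominus>\<^bsub>E\<^esub> e n) < \<epsilon>"
  proof (intro allI impI)
    fix \<epsilon> :: real assume "\<epsilon> > 0"
    then obtain N where N: "inverse (real (Suc N)) < \<epsilon> / 2" using reals_Archimedean[of "\<epsilon> / 2"] by auto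
    have small: "inverse (real (Suc m)) < \<epsilon> / 2" if "m \<ge> N" for m
      by (rule le_less_trans[OF _ N]) (use that in \<open>simp add: field_simps\<close>)
    have "nrm E (e m \<ominus>\<^bsub>E\<^esub> e n) < \<epsilon>" if "m \<ge> N" "n \<ge> N" for m n
      using dist[of m n] small[OF that(1)] small[OF that(2)] by linarith
    then show "\<exists>N. \<forall>m\<ge>N. \<forall>n\<ge>N. nrm E (e m \<ominus>\<^bsub>E\<^esub> e n) < \<epsilon>" by blast
  qed
  from E.complete[OF _ this] e(1) obtain l where
    l: "l \<in> carrier E" "(\<lambda>n. nrm E (e n \<ominus>\<^bsub>E\<^esub> l)) \<longlonglongrightarrow> 0" by blast
  have ball: "f v = \<phi> v l" if v: "v \<in> nball V 1" for v
  proof -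
    have vV: "v \<in> carrier V" using v by (simp add: nball_def)
    have "(\<lambda>n. \<phi> v (e n) - \<phi> v l) \<longlonglongrightarrow> 0"
    proof (rule Lim_null_comparison)
      show "(\<lambda>n. nrm V v * nrm E (e n \<ominus>\<^bsub>E\<^esub> l)) \<longlonglongrightarrow> 0"
        using tendsto_mult_left[OF l(2), of "nrm V v"] by simp
      show "\<forall>\<^sub>F n in sequentially. norm (\<phi> v (e n) - \<phi> v l) \<le> nrm V v * nrm E (e n \<ominus>\<^bsub>E\<^esub> l)"
        using bound[OF vV, of "e n \<ominus>\<^bsub>E\<^esub> l" for n] e(1) l(1)
          E.linear_functional_minus[OF linear_right[OF vV]] by simp
    qed
    moreover have "(\<lambda>n. f v - \<phi> v (e n)) \<longlonglongrightarrow> 0"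
      by (rule Lim_null_comparison[OF _ LIMSEQ_inverse_real_of_nat]) (use e(2)[OF v] in simp)
    ultimately have "(\<lambda>n. f v - \<phi> v l) \<longlonglongrightarrow> 0"
      using tendsto_add[of "\<lambda>n. \<phi> v (e n) - \<phi> v l" 0 sequentially "\<lambda>n. f v - \<phi> v (e n)" 0] by simp
    then show ?thesis by (simp add: LIMSEQ_const_iff)
  qed
  have "f v = \<phi> v l" if v: "v \<in> carrier V" for v
  proof -
    \<comment> \<open>Scaling into the unit ball extends the identity to all v by homogeneity; the
      summand 1 avoids a separate case v = 0.\<close>
    define c :: complex where "c = of_real (nrm V v + 1)"
    have pos: "nrm V v + 1 > 0" using V.nrm_nonneg[OF v] by linarith
    then have c: "c \<noteq> 0" "cmod c = nrm V v + 1" unfolding c_def norm_of_real of_real_eq_0_iff by auto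
    have "(1 / c) \<odot>\<^bsub>V\<^esub> v \<in> nball V 1"
      using v pos by (simp add: nball_def V.nrm_smult norm_divide c(2))
    from ball[OF this] show ?thesis
      using linear_functional_smult[OF lin v] linear_functional_smult[OF linear_left[OF l(1)] v] c(1)
      by simp
  qed
  then show ?thesis using l(1) by blast
qed

end

section \<open>The Dixmier-Ng theorem\<close>

text \<open>T is an arbitrary topology without compatibility with scalar multiplication, so the
  radii are not interchangeable and all of them are quantified. This lets composition with a bounded
  map move from one ball to another.\<close>

definition ball_continuous_functionals ::
    "('a, 'm) normed_module_scheme \<Rightarrow> 'a topology \<Rightarrow> ('a \<Rightarrow> complex) set" where
  "ball_continuous_functionals V T = {f \<in> bounded_functionals V.
     \<forall>r. continuous_map (subtopology T (nball V r)) euclidean f}"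

definition evaluation :: "('a \<Rightarrow> complex) set \<Rightarrow> 'a \<Rightarrow> ('a \<Rightarrow> complex) \<Rightarrow> complex" where
  "evaluation S x = (\<lambda>f\<in>S. f x)"

abbreviation ball_predual :: "('a, 'm) normed_module_scheme \<Rightarrow> 'a topology \<Rightarrow> ('a \<Rightarrow> complex) normed_module" where
  "ball_predual V T \<equiv> dual_space V\<lparr>carrier := ball_continuous_functionals V T\<rparr>"

context normed_cspace
begin

lemma functional_subspace_ball_continuous: "functional_subspace (ball_continuous_functionals V T)"
proof -
  let ?S = "ball_continuous_functionals V T"
  have B: "functional_subspace (bounded_functionals V)" by (rule functional_subspace_bounded_functionals)
  have *: "restrict g (carrier V) \<in> ?S"
    if "restrict g (carrier V) \<in> bounded_functionals V"
      "\<And>r. continuous_map (subtopology T (nball V r)) euclidean g" for g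
    unfolding ball_continuous_functionals_def
  proof (intro CollectI conjI allI)
    fix r show "continuous_map (subtopology T (nball V r)) euclidean (restrict g (carrier V))"
      by (rule continuous_map_eq[OF that(2)]) (auto simp: nball_def)
  qed (fact that(1))
  show ?thesis
    unfolding functional_subspace_def
  proof (intro conjI ballI allI)
    show "?S \<subseteq> bounded_functionals V" by (auto simp: ball_continuous_functionals_def)
    show "(\<lambda>x\<in>carrier V. 0) \<in> ?S"
      using B by (intro *) (auto simp: functional_subspace_def)
    fix f assume f: "f \<in> ?S"
    show "(\<lambda>x\<in>carrier V. f x + g x) \<in> ?S" if "g \<in> ?S" for g
      using B f that
      by (intro * continuous_map_add) (auto simp: functional_subspace_def ball_continuous_functionals_def)
    show "(\<lambda>x\<in>carrier V. c * f x) \<in> ?S" for c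
      using B f
      by (intro * continuous_map_cmult) (auto simp: functional_subspace_def ball_continuous_functionals_def)
  qed
qed

text \<open>On a ball, approximation relative to the norm is uniform approximation, and uniform
  limits of continuous functions are continuous.\<close>

lemma banach_ball_predual: "banach_space (ball_predual V T)"
proof (rule dual_subspace_banach[OF functional_subspace_ball_continuous])
  fix f assume f: "f \<in> bounded_functionals V"
    and lim: "\<forall>\<epsilon>>0. \<exists>g\<in>ball_continuous_functionals V T. \<forall>x\<in>carrier V. cmod (f x - g x) \<le> \<epsilon> * nrm V x"
  have "\<exists>g. \<forall>n::nat. g n \<in> ball_continuous_functionals V T \<and>
      (\<forall>x\<in>carrier V. cmod (f x - g n x) \<le> inverse (Suc n) * nrm V x)"
    by (intro choice) (use lim[rule_format, of "inverse (real (Suc n))" for n] in \<open>auto simp: Bex_def\<close>)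
  then obtain g where g: "\<And>n::nat. g n \<in> ball_continuous_functionals V T"
    "\<And>n x. x \<in> carrier V \<Longrightarrow> cmod (f x - g n x) \<le> inverse (Suc n) * nrm V x" by blast
  have "continuous_map (subtopology T (nball V r)) euclidean f" for r
  proof -
    have "continuous_map (subtopology T (nball V r)) Met_TC.mtopology f"
    proof (rule Met_TC.continuous_map_uniform_limit[where F = sequentially and f = g])
      show "\<forall>\<^sub>F n in sequentially. continuous_map (subtopology T (nball V r)) Met_TC.mtopology (g n)"
        using g(1) by (simp add: ball_continuous_functionals_def mtopology_is_euclidean)
      fix \<epsilon> :: real assume \<epsilon>: "0 < \<epsilon>"
      have "(\<lambda>n. inverse (real (Suc n)) * \<bar>r\<bar>) \<longlonglongrightarrow> 0 * \<bar>r\<bar>"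
        by (intro tendsto_mult LIMSEQ_inverse_real_of_nat tendsto_const)
      then have "\<forall>\<^sub>F n in sequentially. inverse (real (Suc n)) * \<bar>r\<bar> < \<epsilon>"
        using \<epsilon> by (auto dest: order_tendstoD(2))
      then show "\<forall>\<^sub>F n in sequentially. \<forall>x\<in>topspace (subtopology T (nball V r)).
          f x \<in> UNIV \<and> dist (g n x) (f x) < \<epsilon>"
      proof (eventually_elim, intro ballI conjI UNIV_I)
        fix n x assume n: "inverse (real (Suc n)) * \<bar>r\<bar> < \<epsilon>"
          and "x \<in> topspace (subtopology T (nball V r))"
        then have x: "x \<in> carrier V" "nrm V x \<le> r" by (auto simp: nball_def)
        have "dist (g n x) (f x) \<le> inverse (Suc n) * nrm V x"
          using g(2)[OF x(1)] by (simp add: dist_norm norm_minus_commute)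
        also have "\<dots> \<le> inverse (Suc n) * \<bar>r\<bar>" using x by (intro mult_left_mono) auto
        finally show "dist (g n x) (f x) < \<epsilon>" using n by simp
      qed
    qed simp
    then show ?thesis by (simp add: mtopology_is_euclidean)
  qed
  then show "f \<in> ball_continuous_functionals V T"
    using f by (simp add: ball_continuous_functionals_def)
qed

text \<open>\<open>norming\<close> makes evaluation isometric, hence injective. For surjectivity, a
  functional F of norm K on the predual must be evaluation at a point of the K-ball. Otherwise
  \<open>separation\<close> yields one g in the predual with |g| \<le> s on that ball and |F g| > s,
  contradicting |F g| \<le> K ||g||.\<close>

theorem dixmier_ng:
  fixes T :: "'a topology"
  assumes compact: "\<And>r. 0 \<le> r \<Longrightarrow> compactin T (nball V r)"
    and norming: "\<And>x K. x \<in> carrier V \<Longrightarrow>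
      (\<And>f. f \<in> ball_continuous_functionals V T \<Longrightarrow> (\<And>y. y \<in> carrier V \<Longrightarrow> cmod (f y) \<le> nrm V y) \<Longrightarrow>
        cmod (f x) \<le> K) \<Longrightarrow> nrm V x \<le> K"
  shows "predual V (ball_predual V T) (evaluation (ball_continuous_functionals V T))"
proof -
  let ?S = "ball_continuous_functionals V T" and ?P = "ball_predual V T"
  let ?ev = "evaluation ?S"
  interpret P: banach_space ?P by (rule banach_ball_predual)
  have car: "carrier ?P = ?S" "add ?P = (\<lambda>f g. \<lambda>x\<in>carrier V. f x + g x)"
    "smult ?P = (\<lambda>c f. \<lambda>x\<in>carrier V. c * f x)" "nrm ?P = op_norm V cmod"
    by (simp_all add: dual_space_def)
  have SB: "f \<in> bounded_functionals V" "linear_functional V f" if "f \<in> ?S" for f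
    using that by (auto simp: ball_continuous_functionals_def bounded_functionals_iff)
  have closed: "(\<lambda>x\<in>carrier V. f x + g x) \<in> ?S" "(\<lambda>x\<in>carrier V. c * f x) \<in> ?S"
    if "f \<in> ?S" "g \<in> ?S" for f g c
    using functional_subspace_ball_continuous[of T] that by (auto simp: functional_subspace_def)
  have ev_bound: "cmod (?ev x f) \<le> nrm V x * nrm ?P f" if "x \<in> carrier V" "f \<in> ?S" for x f
    using functional_bound[OF SB(1)[OF that(2)] that(1)] that(2)
    by (simp add: car evaluation_def mult.commute)
  have ev: "?ev x \<in> bounded_functionals ?P" if x: "x \<in> carrier V" for x
    unfolding bounded_functionals_iff
  proof (intro conjI exI ballI)
    show "?ev x \<in> extensional (carrier ?P)" by (simp add: car evaluation_def)
    show "linear_functional ?P (?ev x)"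
      using closed x by (auto simp: linear_functional_def car evaluation_def)
    show "cmod (?ev x f) \<le> nrm V x * nrm ?P f" if "f \<in> carrier ?P" for f
      using ev_bound[OF x] that by (simp add: car)
  qed
  have nrm_eq: "op_norm ?P cmod (?ev x) = nrm V x" if x: "x \<in> carrier V" for x
  proof (rule antisym)
    show "op_norm ?P cmod (?ev x) \<le> nrm V x"
    proof (rule P.op_norm_le)
      fix f assume "f \<in> nball ?P 1"
      then have f: "f \<in> ?S" "nrm ?P f \<le> 1" by (auto simp: nball_def car(1))
      have "cmod (?ev x f) \<le> nrm V x * nrm ?P f" by (rule ev_bound[OF x f(1)])
      also have "\<dots> \<le> nrm V x * 1" using f x by (intro mult_left_mono) auto
      finally show "cmod (?ev x f) \<le> nrm V x" by simp
    qed
    show "nrm V x \<le> op_norm ?P cmod (?ev x)"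
    proof (rule norming[OF x])
      fix f assume f: "f \<in> ?S" and le: "\<And>y. y \<in> carrier V \<Longrightarrow> cmod (f y) \<le> nrm V y"
      have "op_norm V cmod f \<le> 1"
        using le by (intro op_norm_le) (auto simp: nball_def intro: order_trans)
      then have "f \<in> nball ?P 1" using f by (simp add: nball_def car)
      from P.op_norm_upper[OF _ this, of cmod "?ev x" "nrm V x"]
      have "cmod (?ev x f) \<le> op_norm ?P cmod (?ev x)" using ev_bound[OF x] by (simp add: car)
      then show "cmod (f x) \<le> op_norm ?P cmod (?ev x)" using f by (simp add: evaluation_def)
    qed
  qed
  have surj: "\<exists>x\<in>carrier V. ?ev x = F" if F: "F \<in> bounded_functionals ?P" for F
  proof -
    define K where "K = op_norm ?P cmod F"
    have K: "0 \<le> K" unfolding K_def by (rule P.functional_op_norm_nonneg[OF F])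
    have Flin: "linear_functional ?P F" using F by (simp add: bounded_functionals_iff)
    have "\<exists>x\<in>nball V K. \<forall>f\<in>?S. f x = F f"
    proof (rule ccontr)
      assume contr: "\<not> (\<exists>x\<in>nball V K. \<forall>f\<in>?S. f x = F f)"
      have cont: "continuous_map (subtopology T (nball V K)) euclidean f" if "f \<in> ?S" for f
        using that by (simp add: ball_continuous_functionals_def)
      obtain J d s where J: "finite J" "J \<subseteq> ?S"
        and le: "\<And>v. v \<in> nball V K \<Longrightarrow> cmod (\<Sum>f\<in>J. d f * f v) \<le> s"
        and gt: "s < Re (\<Sum>f\<in>J. d f * F f)"
        using separation[OF compact[OF K] K SB(2) cont contr] by blast
      \<comment> \<open>The predual is a vector space, so the separating combination is itself one
        of its elements and F can be applied to it.\<close>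
      have "\<exists>g\<in>?S. (\<forall>v\<in>carrier V. g v = (\<Sum>f\<in>J. d f * f v)) \<and> F g = (\<Sum>f\<in>J. d f * F f)"
        using J
      proof (induction J rule: finite_induct)
        case empty
        have "zero ?P \<in> ?S" using P.zero_closed by (simp only: car(1))
        moreover have "F (zero ?P) = 0" by (rule P.linear_functional_zero[OF Flin])
        moreover have "zero ?P v = 0" if "v \<in> carrier V" for v using that by (simp add: dual_space_def)
        ultimately show ?case by (intro bexI[of _ "zero ?P"]) simp_all
      next
        case (insert f J)
        then obtain g where g: "g \<in> ?S" "\<And>v. v \<in> carrier V \<Longrightarrow> g v = (\<Sum>f\<in>J. d f * f v)"
          "F g = (\<Sum>f\<in>J. d f * F f)" by blast
        have f: "f \<in> ?S" using insert.prems by simp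
        let ?h = "(d f \<odot>\<^bsub>?P\<^esub> f) \<oplus>\<^bsub>?P\<^esub> g"
        have fg: "f \<in> carrier ?P" "g \<in> carrier ?P" using f g by (simp_all add: car(1))
        have "F ?h = d f * F f + F g"
          using linear_functional_add[OF Flin P.smult_in[OF fg(1), of "d f"] fg(2)]
            linear_functional_smult[OF Flin fg(1)] by simp
        moreover have "?h \<in> ?S" using P.a_closed[OF P.smult_in[OF fg(1)] fg(2)] by (simp add: car(1))
        moreover have "?h v = d f * f v + g v" if "v \<in> carrier V" for v
          using that by (simp add: car)
        ultimately show ?case
          using insert.hyps g by (intro bexI[of _ ?h]) auto
      qed
      then obtain g where g: "g \<in> ?S" "\<And>v. v \<in> carrier V \<Longrightarrow> g v = (\<Sum>f\<in>J. d f * f v)"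
        "F g = (\<Sum>f\<in>J. d f * F f)" by blast
      have le': "cmod (g v) \<le> s" if "v \<in> nball V K" for v
        using le[OF that] g(2) that by (simp add: nball_def)
      have "K * op_norm V cmod g \<le> s"
      \<comment> \<open>For K = 0 the ball cannot be rescaled to the unit ball, but s bounds the
        modulus of g at 0 and is therefore nonnegative.\<close>
      proof (cases "K = 0")
        case True
        then show ?thesis using order_trans[OF norm_ge_zero le'[OF zero_in_nball[OF K]]] by simp
      next
        case False
        then have Kpos: "K > 0" using K by simp
        have "op_norm V cmod g \<le> s / K"
        proof (rule op_norm_le)
          fix v assume v: "v \<in> nball V 1"
          have "of_real K \<odot> v \<in> nball V K" using smult_in_nball[OF v] K by simp
          from le'[OF this] show "cmod (g v) \<le> s / K"
            using linear_functional_smult[OF SB(2)[OF g(1)], of v "of_real K"] v Kpos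
            by (simp add: nball_def norm_mult pos_le_divide_eq mult.commute)
        qed
        then show ?thesis using Kpos by (simp add: pos_le_divide_eq mult.commute)
      qed
      moreover have "cmod (F g) \<le> K * op_norm V cmod g"
        using P.functional_bound[OF F, of g] g(1) by (simp add: car K_def)
      moreover have "s < cmod (F g)"
        using less_le_trans[OF gt complex_Re_le_cmod] g(3) by simp
      ultimately show False by simp
    qed
    then obtain x where x: "x \<in> carrier V" "\<And>f. f \<in> ?S \<Longrightarrow> f x = F f" by (auto simp: nball_def)
    have "F \<in> extensional ?S" using F by (simp add: bounded_functionals_iff car(1))
    then have "?ev x = F"
      using x(2) by (intro extensionalityI[of _ ?S]) (auto simp: evaluation_def)
    then show ?thesis using x(1) by blast
  qed
  have "inj_on ?ev (carrier V)"
  proof (rule inj_onI)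
    fix x y assume xy: "x \<in> carrier V" "y \<in> carrier V" "?ev x = ?ev y"
    have "nrm V (x \<ominus> y) \<le> 0"
    proof (rule norming)
      fix f assume f: "f \<in> ?S"
      then have "f x = f y" using fun_cong[OF xy(3), of f] by (simp add: evaluation_def)
      then show "cmod (f (x \<ominus> y)) \<le> 0"
        using linear_functional_minus[OF SB(2)[OF f] xy(1,2)] by simp
    qed (use xy in auto)
    then have "nrm V (x \<ominus> y) = 0" using xy by (intro antisym nrm_nonneg) auto
    then show "x = y" using nrm_minus_eq_0_iff xy by blast
  qed
  then have "bij_betw ?ev (carrier V) (carrier (dual_space ?P))"
    using ev surj by (auto simp: bij_betw_def dual_space_def)
  moreover have "?ev (x \<oplus> y) = ?ev x \<oplus>\<^bsub>dual_space ?P\<^esub> ?ev y" if "x \<in> carrier V" "y \<in> carrier V" for x y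
    using that linear_functional_add[OF SB(2)]
    by (auto simp: dual_space_def evaluation_def intro!: restrict_ext)
  moreover have "?ev (c \<odot> x) = c \<odot>\<^bsub>dual_space ?P\<^esub> ?ev x" if "x \<in> carrier V" for c x
    using that linear_functional_smult[OF SB(2)]
    by (auto simp: dual_space_def evaluation_def intro!: restrict_ext)
  moreover have "nrm (dual_space ?P) (?ev x) = nrm V x" if "x \<in> carrier V" for x
    using nrm_eq[OF that] by (simp add: dual_space_def)
  ultimately show ?thesis
    using P.banach_space_axioms by (simp add: predual_def isometric_isomorphism_def)
qed

end

section \<open>Multipliers of a faithful dual Banach algebra\<close>

locale faithful_dual_algebra = banach_algebra A + predual_pair A E \<phi>
  for A :: "('a, 'm) normed_module_scheme" (structure) and E :: "('e, 'n) normed_module_scheme"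
    and \<phi> :: "'a \<Rightarrow> 'e \<Rightarrow> complex" +
  assumes faithful: "faithful A"
    and mult_right_continuous: "b \<in> carrier A \<Longrightarrow> continuous_map \<W> \<W> (\<lambda>a. a \<otimes> b)"
    and mult_left_continuous: "b \<in> carrier A \<Longrightarrow> continuous_map \<W> \<W> (\<lambda>a. b \<otimes> a)"

text \<open>Reversing the product turns (L, R) into (R, L) and keeps the weak*-topology and
  faithfulness, so facts on R are facts on L for the opposite algebra.\<close>

abbreviation opposite :: "('a, 'm) normed_module_scheme \<Rightarrow> ('a, 'm) normed_module_scheme" where
  "opposite A \<equiv> A\<lparr>mult := \<lambda>x y. y \<otimes>\<^bsub>A\<^esub> x\<rparr>"

lemma opposite_minus [simp]: "x \<ominus>\<^bsub>opposite A\<^esub> y = x \<ominus>\<^bsub>A\<^esub> y"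
  by (simp add: a_minus_def a_inv_def m_inv_def)

lemma opposite_simps [simp]:
  "isometric_isomorphism (opposite A) D \<phi> = isometric_isomorphism A D \<phi>"
  "weak_star (opposite A) E \<phi> = weak_star A E \<phi>"
  "nball (opposite A) = nball A"
  "op_norm (opposite A) n = op_norm A n"
  by (simp_all add: isometric_isomorphism_def weak_star_def nball_def op_norm_def fun_eq_iff)

lemma opposite_multipliers: "(L, R) \<in> multipliers A \<Longrightarrow> (R, L) \<in> multipliers (opposite A)"
  by (auto simp: multipliers_def)

section \<open>The opposite algebra and the norm metric\<close>

context banach_algebra
begin

lemma banach_algebra_opposite: "banach_algebra (opposite A)"
proof -
  have "abelian_group (opposite A)"
  proof (rule abelian_groupI)
    fix x assume "x \<in> carrier (opposite A)"
    then show "\<exists>y\<in>carrier (opposite A). y \<oplus>\<^bsub>opposite A\<^esub> x = \<zero>\<^bsub>opposite A\<^esub>"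
      by (intro bexI[of _ "\<ominus> x"]) (auto simp: l_neg)
  qed (auto simp: a_ac)
  then have "module complex_ring (opposite A)"
    by (intro moduleI cring_complex_ring) (auto simp: smult_add_left smult_add_right smult_smult)
  then interpret op: module complex_ring "opposite A" .
  have nrm_comm: "nrm A (y \<otimes> x) \<le> nrm A x * nrm A y" if "x \<in> carrier A" "y \<in> carrier A" for x y
    using nrm_mult[OF that(2,1)] by (simp only: mult.commute)
  show ?thesis
  proof unfold_locales
    fix s :: "nat \<Rightarrow> 'a"
    assume "\<forall>n. s n \<in> carrier (opposite A)"
      "\<forall>e>0. \<exists>N. \<forall>m\<ge>N. \<forall>n\<ge>N. nrm (opposite A) (s m \<ominus>\<^bsub>opposite A\<^esub> s n) < e"
    then show "\<exists>l\<in>carrier (opposite A). (\<lambda>n. nrm (opposite A) (s n \<ominus>\<^bsub>opposite A\<^esub> l)) \<longlonglongrightarrow> 0"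
      using complete[of s] by simp
  qed (auto simp: nrm_eq_zero nrm_smult nrm_triangle mult_closed mult_assoc distrib_left distrib_right
      smult_mult_left smult_mult_right nrm_comm)
qed

lemma mult_zero_left: "x \<in> carrier A \<Longrightarrow> \<zero> \<otimes> x = \<zero>"
  using smult_mult_left[of \<zero> x 0] by (simp add: mult_closed)

lemma mult_zero_right: "x \<in> carrier A \<Longrightarrow> x \<otimes> \<zero> = \<zero>"
  using smult_mult_right[of x \<zero> 0] by (simp add: mult_closed)

lemma mult_minus_right: "x \<in> carrier A \<Longrightarrow> y \<in> carrier A \<Longrightarrow> z \<in> carrier A \<Longrightarrow>
    x \<otimes> (y \<ominus> z) = x \<otimes> y \<ominus> x \<otimes> z"
  by (simp add: minus_eq_smult distrib_left smult_mult_right mult_closed)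

text \<open>The value 0 off the carrier secures symmetry and nonnegativity, which
  \<open>Metric_space\<close> demands for all arguments.\<close>

definition metric :: "'a \<Rightarrow> 'a \<Rightarrow> real" where
  "metric x y = (if x \<in> carrier A \<and> y \<in> carrier A then nrm A (x \<ominus> y) else 0)"

sublocale metric: Metric_space "carrier A" metric
  by unfold_locales (auto simp: metric_def nrm_minus_commute minus_triangle nrm_minus_eq_0_iff)

lemma mcomplete: "metric.mcomplete"
  unfolding metric.mcomplete_def
proof (intro allI impI)
  fix s :: "nat \<Rightarrow> 'a" assume s: "metric.MCauchy s"
  then have sA: "s n \<in> carrier A" for n by (auto simp: metric.MCauchy_def)
  have "\<forall>e>0. \<exists>N. \<forall>m\<ge>N. \<forall>n\<ge>N. nrm A (s m \<ominus> s n) < e"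
    using s sA by (auto simp: metric.MCauchy_def metric_def)
  with complete[of s] sA obtain l where l: "l \<in> carrier A" "(\<lambda>n. nrm A (s n \<ominus> l)) \<longlonglongrightarrow> 0" by blast
  then have "(\<lambda>n. metric (s n) l) \<longlonglongrightarrow> 0" by (simp add: metric_def sA)
  then show "\<exists>x. limitin metric.mtopology s x sequentially"
    using l(1) sA by (auto simp: metric.limitin_metric_dist_null)
qed

end

section \<open>Algebraic consequences of faithfulness\<close>

context faithful_dual_algebra
begin

lemma faithful_dual_algebra_opposite: "faithful_dual_algebra (opposite A) E \<phi>"
proof -
  interpret op: banach_algebra "opposite A" by (rule banach_algebra_opposite)
  show ?thesis
  proof unfold_locales
    show "isometric_isomorphism (opposite A) (dual_space E) \<phi>" using iso by simp
    show "faithful (opposite A)"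
      using faithful by (auto simp: faithful_def mult_assoc)
    show "continuous_map (weak_star (opposite A) E \<phi>) (weak_star (opposite A) E \<phi>) (\<lambda>a. a \<otimes>\<^bsub>opposite A\<^esub> b)"
      if "b \<in> carrier (opposite A)" for b
      using mult_left_continuous that by simp
    show "continuous_map (weak_star (opposite A) E \<phi>) (weak_star (opposite A) E \<phi>) (\<lambda>a. b \<otimes>\<^bsub>opposite A\<^esub> a)"
      if "b \<in> carrier (opposite A)" for b
      using mult_right_continuous that by simp
  qed
qed

text \<open>If a (x - y) = 0 for all a, then a (x - y) b = 0 for all a and b. Identities for L
  follow by this cancellation: after multiplication by a from the left, a L(x) = R(a) x moves the
  claim into the algebra laws of A.\<close>

lemma left_cancel:
  assumes "x \<in> carrier A" "y \<in> carrier A" "\<And>a. a \<in> carrier A \<Longrightarrow> a \<otimes> x = a \<otimes> y"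
  shows "x = y"
proof -
  have "x \<ominus> y = \<zero>"
    using faithful assms
    by (auto simp: faithful_def mult_minus_right minus_self mult_closed mult_zero_left)
  then show ?thesis using assms(1,2) by (simp add: minus_eq_zero_iff)
qed

lemma right_cancel:
  assumes "x \<in> carrier A" "y \<in> carrier A" "\<And>a. a \<in> carrier A \<Longrightarrow> x \<otimes> a = y \<otimes> a"
  shows "x = y"
proof -
  interpret op: faithful_dual_algebra "opposite A" E \<phi> by (rule faithful_dual_algebra_opposite)
  show ?thesis using op.left_cancel[of x y] assms by simp
qed

lemma multiplierD:
  assumes "(L, R) \<in> multipliers A"
  shows "x \<in> carrier A \<Longrightarrow> L x \<in> carrier A" "x \<in> carrier A \<Longrightarrow> R x \<in> carrier A"
    "x \<in> carrier A \<Longrightarrow> y \<in> carrier A \<Longrightarrow> x \<otimes> L y = R x \<otimes> y"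
    "L \<in> extensional (carrier A)" "R \<in> extensional (carrier A)"
  using assms by (auto simp: multipliers_def PiE_def)

lemma left_multiplier_add:
  assumes m: "(L, R) \<in> multipliers A" and "x \<in> carrier A" "y \<in> carrier A"
  shows "L (x \<oplus> y) = L x \<oplus> L y"
  using assms(2,3) multiplierD[OF m] by - (rule left_cancel, auto simp: distrib_left)

lemma left_multiplier_smult:
  assumes m: "(L, R) \<in> multipliers A" and "x \<in> carrier A"
  shows "L (c \<odot> x) = c \<odot> L x"
  using assms(2) multiplierD[OF m] by - (rule left_cancel, auto simp: smult_mult_right)

lemma left_multiplier_mult:
  assumes m: "(L, R) \<in> multipliers A" and "x \<in> carrier A" "y \<in> carrier A"
  shows "L (x \<otimes> y) = L x \<otimes> y"
  using assms(2,3) multiplierD[OF m]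
  by - (rule left_cancel, auto simp: mult_closed mult_assoc[symmetric])

lemma left_multiplier_zero: "(L, R) \<in> multipliers A \<Longrightarrow> L \<zero> = \<zero>"
  using left_multiplier_smult[of L R \<zero> 0] multiplierD(1)[of L R \<zero>] by simp

text \<open>The graph of \<open>L\<close> is cut out by the equations \<open>R a \<otimes> x = a \<otimes> y\<close>, which are weak*-closed in
  both variables; projecting it along a compact ball keeps it closed. This replaces both the closed
  graph theorem and the weak*-continuity arguments on bounded nets.\<close>

lemma left_multiplier_closed_preimage:
  assumes m: "(L, R) \<in> multipliers A"
    and X: "topspace X \<subseteq> carrier A" "continuous_map X \<W> (\<lambda>x. x)" and C: "closedin \<W> C"
  shows "closedin X {x \<in> topspace X. L x \<in> nball A s \<inter> C}"
proof -
  \<comment> \<open>X will be the norm topology, which leads to boundedness, and a weak*-ball, which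
    leads to continuity.\<close>
  let ?Y = "subtopology \<W> (nball A s)"
  let ?Z = "prod_topology X ?Y"
  have topY: "topspace ?Y = nball A s" by (auto simp: nball_def)
  have cpt: "compact_space ?Y" using banach_alaoglu[of s] by (simp add: compactin_subspace)
  have f1: "continuous_map ?Z \<W> fst"
    using continuous_map_compose[OF continuous_map_fst X(2), of ?Y] by (simp add: o_def)
  have f2: "continuous_map ?Z \<W> snd"
    using continuous_map_into_fulltopology[OF continuous_map_snd] by blast
  define G where "G = {p \<in> topspace ?Z. snd p \<in> C} \<inter>
      (\<Inter>a\<in>carrier A. {p \<in> topspace ?Z. R a \<otimes> fst p = a \<otimes> snd p})"
  have "closedin ?Z G"
    unfolding G_def
  proof (intro closedin_Int closedin_INT)
    show "closedin ?Z {p \<in> topspace ?Z. snd p \<in> C}"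
      by (rule closedin_continuous_map_preimage[OF f2 C])
    fix a assume a: "a \<in> carrier A"
    show "closedin ?Z {p \<in> topspace ?Z. R a \<otimes> fst p = a \<otimes> snd p}"
      using continuous_map_compose[OF f1 mult_left_continuous[OF multiplierD(2)[OF m a]]]
        continuous_map_compose[OF f2 mult_left_continuous[OF a]]
      by (intro closedin_continuous_maps_eq[OF Hausdorff]) (simp_all add: o_def)
  qed (use zero_closed in blast)
  then have "closedin X (fst ` G)"
    using closed_map_fst[OF cpt, of X] by (simp add: closed_map_def)
  also have "fst ` G = {x \<in> topspace X. L x \<in> nball A s \<inter> C}"
  proof (intro equalityI subsetI)
    fix x assume "x \<in> fst ` G"
    then obtain y where y: "(x, y) \<in> G" by auto
    then have x: "x \<in> topspace X" "x \<in> carrier A" and yA: "y \<in> nball A s" "y \<in> carrier A" "y \<in> C"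
      using X(1) unfolding G_def by (auto simp: nball_def)
    \<comment> \<open>On G one has a y = R(a) x = a L(x) for every a, so y and L x agree by
      cancellation.\<close>
    have "y = L x"
      using y x yA multiplierD[OF m] by - (rule left_cancel, auto simp: G_def)
    then show "x \<in> {x \<in> topspace X. L x \<in> nball A s \<inter> C}" using x yA by simp
  next
    fix x assume "x \<in> {x \<in> topspace X. L x \<in> nball A s \<inter> C}"
    then have "(x, L x) \<in> G"
      using X(1) multiplierD(3)[OF m] topY unfolding G_def by (auto simp: nball_def)
    then show "x \<in> fst ` G" by force
  qed
  finally show ?thesis .
qed

section \<open>Boundedness and weak*-continuity on balls\<close>

lemma norm_to_weak_star_continuous: "continuous_map metric.mtopology \<W> (\<lambda>x. x)"
  unfolding continuous_map_weak_star
proof (intro conjI ballI)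
  fix e assume e: "e \<in> carrier E"
  have "continuous_map metric.mtopology Met_TC.mtopology (\<lambda>x. \<phi> x e)"
    unfolding metric.metric_continuous_map[OF Met_TC.Metric_space_axioms]
  proof (intro conjI ballI allI impI)
    fix a and \<epsilon> :: real assume a: "a \<in> carrier A" and \<epsilon>: "0 < \<epsilon>"
    define \<delta> where "\<delta> = \<epsilon> / (nrm E e + 1)"
    have pos: "nrm E e + 1 > 0" using E.nrm_nonneg[OF e] by linarith
    have "dist (\<phi> a e) (\<phi> x e) < \<epsilon>" if x: "x \<in> carrier A" "metric a x < \<delta>" for x
    proof -
      have "dist (\<phi> a e) (\<phi> x e) = cmod (\<phi> (a \<ominus> x) e)"
        using linear_functional_minus[OF linear_left[OF e] a x(1)] by (simp add: dist_norm)
      also have "\<dots> \<le> nrm A (a \<ominus> x) * nrm E e" using a x e by (intro bound) auto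
      also have "\<dots> \<le> \<delta> * nrm E e"
        using a x E.nrm_nonneg[OF e] by (intro mult_right_mono) (auto simp: metric_def)
      also have "\<dots> < \<epsilon>"
        unfolding \<delta>_def by (rule divide_succ_mult_less[OF E.nrm_nonneg[OF e] \<epsilon>])
      finally show ?thesis .
    qed
    moreover have "\<delta> > 0" unfolding \<delta>_def using \<epsilon> pos by simp
    ultimately show "\<exists>\<delta>>0. \<forall>x. x \<in> carrier A \<and> metric a x < \<delta> \<longrightarrow> dist (\<phi> a e) (\<phi> x e) < \<epsilon>" by blast
  qed auto
  then show "continuous_map metric.mtopology euclidean (\<lambda>x. \<phi> x e)"
    by (simp add: mtopology_is_euclidean)
qed auto

text \<open>The sets where L has norm at most n are norm-closed and cover A, so by Baire one of them
  contains a ball around some x0. Since L x = L(x0 + x) - L x0, the norm of L is at most 2n on a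
  ball around 0.\<close>

lemma left_multiplier_bounded:
  assumes m: "(L, R) \<in> multipliers A"
  shows "\<exists>K. \<forall>x\<in>carrier A. nrm A (L x) \<le> K * nrm A x"
proof -
  define F where "F n = {x \<in> carrier A. L x \<in> nball A (real n)}" for n :: nat
  have clo: "closedin metric.mtopology (F n)" for n
    using left_multiplier_closed_preimage[OF m _ norm_to_weak_star_continuous closedin_topspace, of "real n"]
    by (simp add: F_def Int_absorb2 nball_subset)
  have "\<exists>n. metric.mtopology interior_of (F n) \<noteq> {}"
  proof (rule ccontr)
    assume contr: "\<not> ?thesis"
    have "metric.mtopology interior_of (\<Union>(range F)) = {}"
    proof (rule metric.metric_Baire_category_alt[OF mcomplete])
      fix T assume "T \<in> range F"
      then show "closedin metric.mtopology T \<and> metric.mtopology interior_of T = {}"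
        using clo contr by blast
    qed simp
    moreover have "\<Union>(range F) = carrier A"
    proof (intro equalityI subsetI)
      fix x assume x: "x \<in> carrier A"
      obtain n where "nrm A (L x) \<le> real n" using real_arch_simple by blast
      then show "x \<in> \<Union>(range F)" using x multiplierD(1)[OF m] by (auto simp: F_def nball_def)
    qed (auto simp: F_def)
    ultimately show False
      using zero_closed interior_of_topspace[of metric.mtopology] by auto
  qed
  then obtain n x0 where "x0 \<in> metric.mtopology interior_of (F n)" by blast
  moreover have "openin metric.mtopology (metric.mtopology interior_of (F n))"
    by (rule openin_interior_of)
  ultimately obtain \<delta> where x0: "x0 \<in> carrier A" and \<delta>: "\<delta> > 0"
    and "metric.mball x0 \<delta> \<subseteq> metric.mtopology interior_of (F n)"
    unfolding metric.openin_mtopology by blast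
  then have \<delta>F: "metric.mball x0 \<delta> \<subseteq> F n"
    using interior_of_subset[of metric.mtopology "F n"] by blast
  have small: "nrm A (L x) \<le> 2 * n" if x: "x \<in> carrier A" "nrm A x < \<delta>" for x
  proof -
    have eq: "x0 \<ominus> (x0 \<oplus> x) = \<ominus> x" using x0 x by (simp add: minus_eq minus_add r_neg1 a_assoc[symmetric] r_neg)
    have "x0 \<oplus> x \<in> metric.mball x0 \<delta>" "x0 \<in> metric.mball x0 \<delta>"
      using x0 x \<delta> by (auto simp: metric.mball_def metric_def eq nrm_uminus)
    then have "x0 \<oplus> x \<in> F n" "x0 \<in> F n" using \<delta>F by auto
    then have le: "nrm A (L x0 \<oplus> L x) \<le> n" "nrm A (L x0) \<le> n"
      using left_multiplier_add[OF m x0 x(1)] by (auto simp: F_def nball_def)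
    have LA: "L x0 \<in> carrier A" "L x \<in> carrier A" using multiplierD(1)[OF m] x0 x by auto
    have "L x = (L x0 \<oplus> L x) \<oplus> (\<ominus> L x0)" using LA by (simp add: a_comm[of "L x0"] a_assoc r_neg)
    then have "nrm A (L x) \<le> nrm A (L x0 \<oplus> L x) + nrm A (L x0)"
      using nrm_triangle[of "L x0 \<oplus> L x" "\<ominus> L x0"] LA by (simp add: nrm_uminus)
    then show ?thesis using le by simp
  qed
  have "nrm A (L x) \<le> (4 * n / \<delta>) * nrm A x" if x: "x \<in> carrier A" for x
  proof (cases "nrm A x = 0")
    case True
    then have "x = \<zero>" using nrm_eq_zero x by blast
    then show ?thesis using left_multiplier_zero[OF m] by simp
  next
    case False
    then have pos: "nrm A x > 0" using nrm_nonneg[OF x] by linarith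
    \<comment> \<open>Scaling x to norm \<delta>/2, strictly inside the ball, turns the bound 2n
      into the constant 4n/\<delta>.\<close>
    let ?c = "\<delta> / (2 * nrm A x)"
    have c: "?c > 0" using pos \<delta> by simp
    have "nrm A (of_real ?c \<odot> x) = \<delta> / 2"
      using nrm_smult[OF x, of "of_real ?c"] pos \<delta> unfolding norm_of_real by simp
    then have "nrm A (of_real ?c \<odot> x) < \<delta>" using \<delta> by simp
    from small[OF smult_in[OF x] this] have "nrm A (of_real ?c \<odot> L x) \<le> 2 * n"
      using left_multiplier_smult[OF m x] by simp
    moreover have "nrm A (of_real ?c \<odot> L x) = ?c * nrm A (L x)"
      using nrm_smult[OF multiplierD(1)[OF m x], of "of_real ?c"] c by (simp only: norm_of_real abs_of_pos)
    ultimately have "?c * nrm A (L x) \<le> 2 * n" by simp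
    then have "nrm A (L x) \<le> 2 * n / ?c" using c by (simp only: pos_le_divide_eq mult.commute)
    also have "\<dots> = (4 * n / \<delta>) * nrm A x" by simp
    finally show ?thesis .
  qed
  then show ?thesis by blast
qed

text \<open>Boundedness sends the ball into some other ball, so the ball condition in
  \<open>left_multiplier_closed_preimage\<close> is automatic and preimages of closed sets are
  closed. The signs of K and r are open, hence the absolute values.\<close>

lemma left_multiplier_continuous:
  assumes m: "(L, R) \<in> multipliers A"
  shows "continuous_map (subtopology \<W> (nball A r)) \<W> L"
proof -
  obtain K where K: "\<And>x. x \<in> carrier A \<Longrightarrow> nrm A (L x) \<le> K * nrm A x"
    using left_multiplier_bounded[OF m] by blast
  have LB: "L x \<in> nball A (\<bar>K\<bar> * \<bar>r\<bar>)" if "x \<in> nball A r" for x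
  proof -
    have x: "x \<in> carrier A" "nrm A x \<le> r" using that by (auto simp: nball_def)
    have "nrm A (L x) \<le> \<bar>K\<bar> * \<bar>r\<bar>"
      by (rule order_trans[OF K[OF x(1)]], rule mult_mono) (use x in auto)
    then show ?thesis using multiplierD(1)[OF m x(1)] by (simp add: nball_def)
  qed
  have top: "topspace (subtopology \<W> (nball A r)) = nball A r" by (auto simp: nball_def)
  show ?thesis
    unfolding continuous_map_closedin
  proof (intro conjI allI impI)
    show "L \<in> topspace (subtopology \<W> (nball A r)) \<rightarrow> topspace \<W>"
      using multiplierD(1)[OF m] by (auto simp: nball_def)
    fix C assume "closedin \<W> C"
    from left_multiplier_closed_preimage[OF m _ _ this, of "subtopology \<W> (nball A r)" "\<bar>K\<bar> * \<bar>r\<bar>"]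
    have "closedin (subtopology \<W> (nball A r))
        {x \<in> topspace (subtopology \<W> (nball A r)). L x \<in> nball A (\<bar>K\<bar> * \<bar>r\<bar>) \<inter> C}"
      by (auto simp: continuous_map_from_subtopology)
    then show "closedin (subtopology \<W> (nball A r)) {x \<in> topspace (subtopology \<W> (nball A r)). L x \<in> C}"
      using LB by (simp only: top Int_iff) (metis (mono_tags, lifting) Collect_cong)
  qed
qed

section \<open>Right multipliers through the opposite algebra\<close>

lemma right_multiplier_add:
  assumes "(L, R) \<in> multipliers A" "x \<in> carrier A" "y \<in> carrier A"
  shows "R (x \<oplus> y) = R x \<oplus> R y"
proof -
  interpret op: faithful_dual_algebra "opposite A" E \<phi> by (rule faithful_dual_algebra_opposite)
  show ?thesis using op.left_multiplier_add[OF opposite_multipliers[OF assms(1)]] assms by simp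
qed

lemma right_multiplier_smult:
  assumes "(L, R) \<in> multipliers A" "x \<in> carrier A"
  shows "R (c \<odot> x) = c \<odot> R x"
proof -
  interpret op: faithful_dual_algebra "opposite A" E \<phi> by (rule faithful_dual_algebra_opposite)
  show ?thesis using op.left_multiplier_smult[OF opposite_multipliers[OF assms(1)]] assms by simp
qed

lemma right_multiplier_mult:
  assumes "(L, R) \<in> multipliers A" "x \<in> carrier A" "y \<in> carrier A"
  shows "R (x \<otimes> y) = x \<otimes> R y"
proof -
  interpret op: faithful_dual_algebra "opposite A" E \<phi> by (rule faithful_dual_algebra_opposite)
  show ?thesis using op.left_multiplier_mult[OF opposite_multipliers[OF assms(1)]] assms by simp
qed

lemma right_multiplier_bounded:
  assumes "(L, R) \<in> multipliers A"
  shows "\<exists>K. \<forall>x\<in>carrier A. nrm A (R x) \<le> K * nrm A x"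
proof -
  interpret op: faithful_dual_algebra "opposite A" E \<phi> by (rule faithful_dual_algebra_opposite)
  show ?thesis using op.left_multiplier_bounded[OF opposite_multipliers[OF assms]] by simp
qed

lemma right_multiplier_continuous:
  assumes "(L, R) \<in> multipliers A"
  shows "continuous_map (subtopology \<W> (nball A r)) \<W> R"
proof -
  interpret op: faithful_dual_algebra "opposite A" E \<phi> by (rule faithful_dual_algebra_opposite)
  show ?thesis using op.left_multiplier_continuous[OF opposite_multipliers[OF assms]]
    by (simp only: opposite_simps)
qed

end

section \<open>The multiplier algebra\<close>

text \<open>Duals are complete, and completeness is carried back along the isometry
  \<open>\<phi>\<close>; this is how M(A) obtains it.\<close>

lemma (in predual_pair) banach_space_of_dual: "banach_space V"
proof -
  let ?D = "dual_space E"
  have "?D = ?D\<lparr>carrier := bounded_functionals E\<rparr>" by (simp add: dual_space_def)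
  then interpret D: banach_space ?D
    using E.dual_subspace_banach[OF E.functional_subspace_bounded_functionals] by simp
  have carD: "carrier ?D = bounded_functionals E" by (simp add: dual_space_def)
  have minus: "\<phi> (x \<ominus>\<^bsub>V\<^esub> y) = \<phi> x \<ominus>\<^bsub>?D\<^esub> \<phi> y" if "x \<in> carrier V" "y \<in> carrier V" for x y
    using that iso functional
    by (simp add: V.minus_eq_smult D.minus_eq_smult isometric_isomorphism_def carD)
  have nrm: "nrm ?D (\<phi> x) = nrm V x" if "x \<in> carrier V" for x
    using that iso by (simp add: isometric_isomorphism_def)
  show ?thesis
  proof unfold_locales
    fix s :: "nat \<Rightarrow> 'v"
    assume s: "\<forall>n. s n \<in> carrier V"
      and cau: "\<forall>e>0. \<exists>N. \<forall>m\<ge>N. \<forall>n\<ge>N. nrm V (s m \<ominus>\<^bsub>V\<^esub> s n) < e"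
    have eq: "nrm ?D (\<phi> (s m) \<ominus>\<^bsub>?D\<^esub> \<phi> v) = nrm V (s m \<ominus>\<^bsub>V\<^esub> v)" if "v \<in> carrier V" for m v
      using s that nrm[of "s m \<ominus>\<^bsub>V\<^esub> v"] by (simp add: minus)
    have "\<forall>e>0. \<exists>N. \<forall>m\<ge>N. \<forall>n\<ge>N. nrm ?D (\<phi> (s m) \<ominus>\<^bsub>?D\<^esub> \<phi> (s n)) < e"
      using cau s by (simp add: eq)
    then obtain l where l: "l \<in> carrier ?D" "(\<lambda>n. nrm ?D (\<phi> (s n) \<ominus>\<^bsub>?D\<^esub> l)) \<longlonglongrightarrow> 0"
      using D.complete[of "\<lambda>n. \<phi> (s n)"] s functional by (auto simp: carD)
    obtain v where "v \<in> carrier V" "\<phi> v = l" using surj l(1) by (auto simp: carD)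
    then show "\<exists>l\<in>carrier V. (\<lambda>n. nrm V (s n \<ominus>\<^bsub>V\<^esub> l)) \<longlonglongrightarrow> 0"
      using l(2) eq by (intro bexI[of _ v]) auto
  qed (fact V.nrm_eq_zero V.nrm_smult V.nrm_triangle)+
qed

text \<open>A continuous map from a compact space to a Hausdorff space is closed. The image of the
  complement of a neighbourhood U of a is closed and, by injectivity, misses g a; the filter
  eventually avoids that image and so enters U.\<close>

lemma limitin_compact_injective:
  assumes X: "compact_space X" and Y: "Hausdorff_space Y" and g: "continuous_map X Y g"
    and inj: "inj_on g (topspace X)" and a: "a \<in> topspace X"
    and ev: "\<forall>\<^sub>F x in F. x \<in> topspace X" and lim: "limitin Y g (g a) F"
  shows "limitin X (\<lambda>x. x) a F"
  unfolding limitin_def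
proof (intro conjI allI impI a)
  fix U assume U: "openin X U \<and> a \<in> U"
  have "closed_map X Y g" by (rule continuous_imp_closed_map[OF g X Y])
  then have "closedin Y (g ` (topspace X - U))"
    using U by (simp add: closed_map_def closedin_diff)
  then have "openin Y (topspace Y - g ` (topspace X - U))" by blast
  moreover have "g a \<in> topspace Y - g ` (topspace X - U)"
    using U a inj continuous_map_image_subset_topspace[OF g] by (auto simp: inj_on_def)
  ultimately have "\<forall>\<^sub>F x in F. g x \<in> topspace Y - g ` (topspace X - U)"
    using lim unfolding limitin_def by blast
  with ev show "\<forall>\<^sub>F x in F. x \<in> U" by eventually_elim auto
qed

text \<open>The identity is a continuous bijection from a compact space onto a Hausdorff one, hence
  a homeomorphism.\<close>

lemma subtopology_eq_compact:
  assumes cpt: "compactin T B" and cont: "continuous_map (subtopology T B) Y (\<lambda>x. x)"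
    and Y: "Hausdorff_space Y"
  shows "subtopology T B = subtopology Y B"
proof -
  have BT: "topspace (subtopology T B) = B" using compactin_subset_topspace[OF cpt] by auto
  then have BY: "topspace (subtopology Y B) = B"
    using continuous_map_image_subset_topspace[OF cont] by auto
  have "continuous_map (subtopology T B) (subtopology Y B) (\<lambda>x. x)"
    using cont BT by (simp add: continuous_map_in_subtopology)
  then have "homeomorphic_map (subtopology T B) (subtopology Y B) (\<lambda>x. x)"
    using cpt Y BT BY
    by (intro continuous_imp_homeomorphic_map)
      (auto simp: compactin_subspace Hausdorff_space_subtopology)
  then have "homeomorphic_map (subtopology T B) (subtopology Y B) id"
    unfolding id_def .
  then show ?thesis by simp
qed

section \<open>Algebra and norm of M(A)\<close>

context faithful_dual_algebra
begin

abbreviation "\<M> \<equiv> multiplier_algebra A"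

abbreviation "\<T> \<equiv> prod_topology (product_topology (\<lambda>_. \<W>) (carrier A))
  (product_topology (\<lambda>_. \<W>) (carrier A))"

lemma mult_alg_simps [simp]:
  "carrier \<M> = multipliers A"
  "zero \<M> = (\<lambda>a\<in>carrier A. \<zero>, \<lambda>a\<in>carrier A. \<zero>)"
  "add \<M> m n = (\<lambda>a\<in>carrier A. fst m a \<oplus> fst n a, \<lambda>a\<in>carrier A. snd m a \<oplus> snd n a)"
  "smult \<M> c m = (\<lambda>a\<in>carrier A. c \<odot> fst m a, \<lambda>a\<in>carrier A. c \<odot> snd m a)"
  "mult \<M> m n = (compose (carrier A) (fst m) (fst n), compose (carrier A) (snd n) (snd m))"
  "nrm \<M> m = max (op_norm A (nrm A) (fst m)) (op_norm A (nrm A) (snd m))"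
  by (simp_all add: multiplier_algebra_def case_prod_unfold)

lemma multipliersI:
  assumes "\<And>a. a \<in> carrier A \<Longrightarrow> L a \<in> carrier A" "\<And>a. a \<in> carrier A \<Longrightarrow> R a \<in> carrier A"
    "\<And>a b. a \<in> carrier A \<Longrightarrow> b \<in> carrier A \<Longrightarrow> a \<otimes> L b = R a \<otimes> b"
  shows "(\<lambda>a\<in>carrier A. L a, \<lambda>a\<in>carrier A. R a) \<in> multipliers A"
  using assms by (auto simp: multipliers_def)

lemma multiplier_facts:
  assumes "m \<in> multipliers A"
  shows "a \<in> carrier A \<Longrightarrow> fst m a \<in> carrier A" "a \<in> carrier A \<Longrightarrow> snd m a \<in> carrier A"
    "a \<in> carrier A \<Longrightarrow> b \<in> carrier A \<Longrightarrow> a \<otimes> fst m b = snd m a \<otimes> b"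
    "restrict (fst m) (carrier A) = fst m" "restrict (snd m) (carrier A) = snd m"
  using multiplierD[of "fst m" "snd m"] assms by (auto simp: extensional_restrict)

lemma multiplier_eqI:
  assumes "m \<in> multipliers A" "n \<in> multipliers A"
    "\<And>a. a \<in> carrier A \<Longrightarrow> fst m a = fst n a" "\<And>a. a \<in> carrier A \<Longrightarrow> snd m a = snd n a"
  shows "m = n"
proof (rule prod_eqI)
  show "fst m = fst n"
    using multiplierD(4)[of "fst m" "snd m"] multiplierD(4)[of "fst n" "snd n"] assms
    by (intro extensionalityI[of _ "carrier A"]) auto
  show "snd m = snd n"
    using multiplierD(5)[of "fst m" "snd m"] multiplierD(5)[of "fst n" "snd n"] assms
    by (intro extensionalityI[of _ "carrier A"]) auto
qed

lemma mult_alg_closed: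
  shows "zero \<M> \<in> multipliers A"
    and "m \<in> multipliers A \<Longrightarrow> n \<in> multipliers A \<Longrightarrow> add \<M> m n \<in> multipliers A"
    and "m \<in> multipliers A \<Longrightarrow> smult \<M> c m \<in> multipliers A"
    and "m \<in> multipliers A \<Longrightarrow> n \<in> multipliers A \<Longrightarrow> mult \<M> m n \<in> multipliers A"
proof -
  show "zero \<M> \<in> multipliers A"
    unfolding mult_alg_simps by (rule multipliersI) (auto simp: mult_zero_left mult_zero_right)
  show "add \<M> m n \<in> multipliers A" if "m \<in> multipliers A" "n \<in> multipliers A"
    unfolding mult_alg_simps using multiplier_facts[OF that(1)] multiplier_facts[OF that(2)]
    by (intro multipliersI) (auto simp: distrib_left distrib_right)
  show "smult \<M> c m \<in> multipliers A" if "m \<in> multipliers A"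
    unfolding mult_alg_simps using multiplier_facts[OF that]
    by (intro multipliersI) (auto simp: smult_mult_left smult_mult_right)
  show "mult \<M> m n \<in> multipliers A" if "m \<in> multipliers A" "n \<in> multipliers A"
    unfolding mult_alg_simps compose_def using multiplier_facts[OF that(1)] multiplier_facts[OF that(2)]
    by (intro multipliersI) auto
qed

lemma multiplier_linear:
  assumes "m \<in> multipliers A" and "x \<in> carrier A" "y \<in> carrier A"
  shows "fst m (x \<oplus> y) = fst m x \<oplus> fst m y" "snd m (x \<oplus> y) = snd m x \<oplus> snd m y"
    "fst m (c \<odot> x) = c \<odot> fst m x" "snd m (c \<odot> x) = c \<odot> snd m x"
  using assms left_multiplier_add[of "fst m" "snd m"] right_multiplier_add[of "fst m" "snd m"]
    left_multiplier_smult[of "fst m" "snd m"] right_multiplier_smult[of "fst m" "snd m"] by simp_all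

lemma multiplier_nrm_bound:
  assumes m: "m \<in> multipliers A" and x: "x \<in> carrier A"
  shows "nrm A (fst m x) \<le> nrm \<M> m * nrm A x" "nrm A (snd m x) \<le> nrm \<M> m * nrm A x"
proof -
  have mm: "(fst m, snd m) \<in> multipliers A" using m by simp
  obtain K where K: "\<forall>x\<in>carrier A. nrm A (fst m x) \<le> K * nrm A x"
    using left_multiplier_bounded[OF mm] by blast
  have "nrm A (fst m x) \<le> op_norm A (nrm A) (fst m) * nrm A x"
    using m x K multiplier_facts(1)[OF m]
    by (intro op_norm_bound[of "nrm A" "fst m" K]) (auto simp: multiplier_linear nrm_smult)
  also have "\<dots> \<le> nrm \<M> m * nrm A x" using x by (intro mult_right_mono) auto
  finally show "nrm A (fst m x) \<le> nrm \<M> m * nrm A x" .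
  obtain K where K: "\<forall>x\<in>carrier A. nrm A (snd m x) \<le> K * nrm A x"
    using right_multiplier_bounded[OF mm] by blast
  have "nrm A (snd m x) \<le> op_norm A (nrm A) (snd m) * nrm A x"
    using m x K multiplier_facts(2)[OF m]
    by (intro op_norm_bound[of "nrm A" "snd m" K]) (auto simp: multiplier_linear nrm_smult)
  also have "\<dots> \<le> nrm \<M> m * nrm A x" using x by (intro mult_right_mono) auto
  finally show "nrm A (snd m x) \<le> nrm \<M> m * nrm A x" .
qed

lemma multiplier_nrm_nonneg:
  assumes m: "m \<in> multipliers A"
  shows "0 \<le> nrm \<M> m"
proof -
  have mm: "(fst m, snd m) \<in> multipliers A" using m by simp
  obtain K where K: "\<forall>x\<in>carrier A. nrm A (fst m x) \<le> K * nrm A x"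
    using left_multiplier_bounded[OF mm] by blast
  have "0 \<le> op_norm A (nrm A) (fst m)"
    using m K multiplier_facts(1)[OF m]
    by (intro op_norm_nonneg[of "nrm A" "fst m" K]) (auto simp: multiplier_linear nrm_smult)
  then show ?thesis by simp
qed

lemma multiplier_nrm_le:
  assumes "0 \<le> r"
    and "\<And>x. x \<in> carrier A \<Longrightarrow> nrm A (fst m x) \<le> r * nrm A x"
    and "\<And>x. x \<in> carrier A \<Longrightarrow> nrm A (snd m x) \<le> r * nrm A x"
  shows "nrm \<M> m \<le> r"
proof -
  have *: "r * nrm A x \<le> r" if "x \<in> nball A 1" for x
    using mult_left_mono[OF _ assms(1), of "nrm A x" 1] that by (simp add: nball_def)
  have "op_norm A (nrm A) (fst m) \<le> r"
    using assms(2) by (intro op_norm_le order_trans[OF _ *]) (auto simp: nball_def)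
  moreover have "op_norm A (nrm A) (snd m) \<le> r"
    using assms(3) by (intro op_norm_le order_trans[OF _ *]) (auto simp: nball_def)
  ultimately show ?thesis by simp
qed

lemma module_multiplier_algebra: "module complex_ring \<M>"
proof (intro moduleI cring_complex_ring abelian_groupI)
  note cl = mult_alg_closed
  note fc = multiplier_facts(1,2)
  show "\<zero>\<^bsub>\<M>\<^esub> \<in> carrier \<M>" using cl by simp
  fix m assume m: "m \<in> carrier \<M>"
  then have m': "m \<in> multipliers A" by simp
  show "\<zero>\<^bsub>\<M>\<^esub> \<oplus>\<^bsub>\<M>\<^esub> m = m"
    using m' by (intro multiplier_eqI cl) (simp_all add: fc)
  show "\<exists>n\<in>carrier \<M>. n \<oplus>\<^bsub>\<M>\<^esub> m = \<zero>\<^bsub>\<M>\<^esub>"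
  proof (rule bexI)
    show "(- 1) \<odot>\<^bsub>\<M>\<^esub> m \<in> carrier \<M>" using cl(3)[OF m', of "-1"] by simp
    have "((- 1) \<odot> fst m a) \<oplus> fst m a = \<zero>" "((- 1) \<odot> snd m a) \<oplus> snd m a = \<zero>" if "a \<in> carrier A" for a
      using fc[OF m' that] by (simp_all add: uminus_eq_smult[symmetric] l_neg)
    then show "((- 1) \<odot>\<^bsub>\<M>\<^esub> m) \<oplus>\<^bsub>\<M>\<^esub> m = \<zero>\<^bsub>\<M>\<^esub>"
      by (intro multiplier_eqI[OF cl(2)[OF cl(3)[OF m'] m'] cl(1)]) simp_all
  qed
  show "\<one>\<^bsub>complex_ring\<^esub> \<odot>\<^bsub>\<M>\<^esub> m = m"
    using m' by (intro multiplier_eqI cl) (simp_all add: fc)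
  fix c
  show "c \<odot>\<^bsub>\<M>\<^esub> m \<in> carrier \<M>" using cl(3)[OF m'] by simp
  fix d
  show "(c \<oplus>\<^bsub>complex_ring\<^esub> d) \<odot>\<^bsub>\<M>\<^esub> m = c \<odot>\<^bsub>\<M>\<^esub> m \<oplus>\<^bsub>\<M>\<^esub> d \<odot>\<^bsub>\<M>\<^esub> m"
    using m' by (intro multiplier_eqI cl) (simp_all add: fc smult_add_left)
  show "(c \<otimes>\<^bsub>complex_ring\<^esub> d) \<odot>\<^bsub>\<M>\<^esub> m = c \<odot>\<^bsub>\<M>\<^esub> (d \<odot>\<^bsub>\<M>\<^esub> m)"
    using m' by (intro multiplier_eqI cl) (simp_all add: fc smult_smult)
next
  note cl = mult_alg_closed
  note fc = multiplier_facts(1,2)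
  fix m n assume "m \<in> carrier \<M>" "n \<in> carrier \<M>"
  then have mn: "m \<in> multipliers A" "n \<in> multipliers A" by simp_all
  show "m \<oplus>\<^bsub>\<M>\<^esub> n \<in> carrier \<M>" using cl(2)[OF mn] by simp
  show "m \<oplus>\<^bsub>\<M>\<^esub> n = n \<oplus>\<^bsub>\<M>\<^esub> m"
    using mn by (intro multiplier_eqI cl) (simp_all add: fc[OF mn(1)] fc[OF mn(2)] a_comm)
  fix c show "c \<odot>\<^bsub>\<M>\<^esub> (m \<oplus>\<^bsub>\<M>\<^esub> n) = c \<odot>\<^bsub>\<M>\<^esub> m \<oplus>\<^bsub>\<M>\<^esub> c \<odot>\<^bsub>\<M>\<^esub> n"
    using mn by (intro multiplier_eqI cl) (simp_all add: fc[OF mn(1)] fc[OF mn(2)] smult_add_right)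
next
  note cl = mult_alg_closed
  note fc = multiplier_facts(1,2)
  fix m n k assume "m \<in> carrier \<M>" "n \<in> carrier \<M>" "k \<in> carrier \<M>"
  then have mn: "m \<in> multipliers A" "n \<in> multipliers A" "k \<in> multipliers A" by simp_all
  show "m \<oplus>\<^bsub>\<M>\<^esub> n \<oplus>\<^bsub>\<M>\<^esub> k = m \<oplus>\<^bsub>\<M>\<^esub> (n \<oplus>\<^bsub>\<M>\<^esub> k)"
    using mn by (intro multiplier_eqI cl)
      (simp_all add: fc[OF mn(1)] fc[OF mn(2)] fc[OF mn(3)] a_assoc)
qed

lemma normed_multiplier_algebra: "normed_cspace \<M>"
proof -
  interpret M: module complex_ring \<M> by (rule module_multiplier_algebra)
  note cl = mult_alg_closed
  have le: "nrm \<M> (c \<odot>\<^bsub>\<M>\<^esub> m) \<le> cmod c * nrm \<M> m" if m: "m \<in> multipliers A" for c m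
  proof (rule multiplier_nrm_le)
    show "0 \<le> cmod c * nrm \<M> m" using multiplier_nrm_nonneg[OF m] by (intro mult_nonneg_nonneg) auto
    fix x assume x: "x \<in> carrier A"
    show "nrm A (fst (c \<odot>\<^bsub>\<M>\<^esub> m) x) \<le> cmod c * nrm \<M> m * nrm A x"
      "nrm A (snd (c \<odot>\<^bsub>\<M>\<^esub> m) x) \<le> cmod c * nrm \<M> m * nrm A x"
      using x mult_left_mono[OF multiplier_nrm_bound(1)[OF m x], of "cmod c"]
        mult_left_mono[OF multiplier_nrm_bound(2)[OF m x], of "cmod c"]
      by (simp_all add: nrm_smult multiplier_facts[OF m] mult.assoc del: mult_alg_simps(6))
  qed
  show ?thesis
  proof unfold_locales
    fix m assume m: "m \<in> carrier \<M>" and 0: "nrm \<M> m = 0"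
    then have m': "m \<in> multipliers A" by simp
    have "nrm A (fst m a) \<le> 0" "nrm A (snd m a) \<le> 0" if "a \<in> carrier A" for a
      using multiplier_nrm_bound[OF m' that] unfolding 0 by simp_all
    then have "fst m a = \<zero>" "snd m a = \<zero>" if "a \<in> carrier A" for a
      using that multiplier_facts(1,2)[OF m'] by (auto intro!: nrm_eq_zero antisym)
    then show "m = \<zero>\<^bsub>\<M>\<^esub>" by (intro multiplier_eqI m' cl(1)) auto
  next
    fix m c assume m: "m \<in> carrier \<M>"
    then have m': "m \<in> multipliers A" by simp
    show "nrm \<M> (c \<odot>\<^bsub>\<M>\<^esub> m) = cmod c * nrm \<M> m"
    proof (cases "c = 0")
      case True
      then show ?thesis
        using le[OF m', of c] multiplier_nrm_nonneg[OF cl(3)[OF m', of c]]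
        by (auto simp del: mult_alg_simps intro: antisym)
    next
      case False
      have "(1 / c) \<odot>\<^bsub>\<M>\<^esub> (c \<odot>\<^bsub>\<M>\<^esub> m) = m"
        using M.smult_assoc1[of "1 / c" c m] M.smult_one[of m] m False
        by (simp del: mult_alg_simps(4))
      then have "nrm \<M> m \<le> cmod (1 / c) * nrm \<M> (c \<odot>\<^bsub>\<M>\<^esub> m)"
        using le[OF cl(3)[OF m', of c], of "1 / c"] by simp
      then have "cmod c * nrm \<M> m \<le> nrm \<M> (c \<odot>\<^bsub>\<M>\<^esub> m)"
        using False by (simp add: norm_divide pos_le_divide_eq mult.commute del: mult_alg_simps)
      then show ?thesis by (rule antisym[OF le[OF m']])
    qed
  next
    fix m n assume "m \<in> carrier \<M>" "n \<in> carrier \<M>"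
    then have m: "m \<in> multipliers A" and n: "n \<in> multipliers A" by simp_all
    show "nrm \<M> (m \<oplus>\<^bsub>\<M>\<^esub> n) \<le> nrm \<M> m + nrm \<M> n"
    proof (rule multiplier_nrm_le)
      show "0 \<le> nrm \<M> m + nrm \<M> n" using multiplier_nrm_nonneg m n by (intro add_nonneg_nonneg)
      fix x assume x: "x \<in> carrier A"
      have "nrm A (fst m x \<oplus> fst n x) \<le> nrm \<M> m * nrm A x + nrm \<M> n * nrm A x"
        by (rule order_trans[OF nrm_triangle add_mono])
          (intro multiplier_facts multiplier_nrm_bound m n x)+
      then show "nrm A (fst (m \<oplus>\<^bsub>\<M>\<^esub> n) x) \<le> (nrm \<M> m + nrm \<M> n) * nrm A x"
        using x by (simp add: semiring_class.distrib_right del: mult_alg_simps(6))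
      have "nrm A (snd m x \<oplus> snd n x) \<le> nrm \<M> m * nrm A x + nrm \<M> n * nrm A x"
        by (rule order_trans[OF nrm_triangle add_mono])
          (intro multiplier_facts multiplier_nrm_bound m n x)+
      then show "nrm A (snd (m \<oplus>\<^bsub>\<M>\<^esub> n) x) \<le> (nrm \<M> m + nrm \<M> n) * nrm A x"
        using x by (simp add: semiring_class.distrib_right del: mult_alg_simps(6))
    qed
  qed
qed

text \<open>This turns a ball of M(A) into the multipliers inside a product of balls of A, the form
  to which Tychonoff applies.\<close>

lemma nball_multipliers:
  assumes "0 \<le> r"
  shows "m \<in> nball \<M> r \<longleftrightarrow> m \<in> multipliers A \<and>
    (\<forall>x\<in>carrier A. fst m x \<in> nball A (r * nrm A x) \<and> snd m x \<in> nball A (r * nrm A x))"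
proof (intro iffI conjI ballI; (elim conjE)?)
  assume "m \<in> nball \<M> r"
  then have m: "m \<in> multipliers A" and r: "nrm \<M> m \<le> r" by (auto simp: nball_def)
  then show "m \<in> multipliers A" by simp
  fix x assume x: "x \<in> carrier A"
  have *: "nrm \<M> m * nrm A x \<le> r * nrm A x" using r x by (intro mult_right_mono) auto
  show "fst m x \<in> nball A (r * nrm A x)" "snd m x \<in> nball A (r * nrm A x)"
    using order_trans[OF multiplier_nrm_bound(1)[OF m x] *] order_trans[OF multiplier_nrm_bound(2)[OF m x] *]
      multiplier_facts(1,2)[OF m x] by (simp_all add: nball_def)
next
  assume m: "m \<in> multipliers A"
    and le: "\<forall>x\<in>carrier A. fst m x \<in> nball A (r * nrm A x) \<and> snd m x \<in> nball A (r * nrm A x)"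
  have "nrm \<M> m \<le> r"
    using le by (intro multiplier_nrm_le[OF assms]) (auto simp: nball_def)
  then show "m \<in> nball \<M> r" using m by (simp add: nball_def del: mult_alg_simps(6))
qed

lemma banach_algebra_multiplier_algebra:
  assumes "banach_space \<M>" shows "banach_algebra \<M>"
proof -
  interpret M: banach_space \<M> by fact
  note cl = mult_alg_closed
  note fc = multiplier_facts(1,2)
  show ?thesis
  proof unfold_locales
    fix m n assume "m \<in> carrier \<M>" "n \<in> carrier \<M>"
    then have m: "m \<in> multipliers A" and n: "n \<in> multipliers A" by simp_all
    show "m \<otimes>\<^bsub>\<M>\<^esub> n \<in> carrier \<M>" using cl(4)[OF m n] by simp
    show "nrm \<M> (m \<otimes>\<^bsub>\<M>\<^esub> n) \<le> nrm \<M> m * nrm \<M> n"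
    proof (rule multiplier_nrm_le)
      show "0 \<le> nrm \<M> m * nrm \<M> n" using multiplier_nrm_nonneg m n by (intro mult_nonneg_nonneg)
      fix x assume x: "x \<in> carrier A"
      have "nrm A (fst m (fst n x)) \<le> nrm \<M> m * (nrm \<M> n * nrm A x)"
        using multiplier_nrm_bound(1)[OF n x] multiplier_nrm_nonneg[OF m]
        by (rule order_trans[OF multiplier_nrm_bound(1)[OF m fc(1)[OF n x]] mult_left_mono])
      then show "nrm A (fst (m \<otimes>\<^bsub>\<M>\<^esub> n) x) \<le> nrm \<M> m * nrm \<M> n * nrm A x"
        using x by (simp add: compose_def mult.assoc)
      have "nrm A (snd n (snd m x)) \<le> nrm \<M> n * (nrm \<M> m * nrm A x)"
        using multiplier_nrm_bound(2)[OF m x] multiplier_nrm_nonneg[OF n]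
        by (rule order_trans[OF multiplier_nrm_bound(2)[OF n fc(2)[OF m x]] mult_left_mono])
      also have "\<dots> = nrm \<M> m * nrm \<M> n * nrm A x" by (simp only: mult_ac)
      finally show "nrm A (snd (m \<otimes>\<^bsub>\<M>\<^esub> n) x) \<le> nrm \<M> m * nrm \<M> n * nrm A x"
        using x by (simp add: compose_def)
    qed
    fix c
    show "(c \<odot>\<^bsub>\<M>\<^esub> m) \<otimes>\<^bsub>\<M>\<^esub> n = c \<odot>\<^bsub>\<M>\<^esub> (m \<otimes>\<^bsub>\<M>\<^esub> n)"
      by (intro multiplier_eqI cl m n) (simp_all add: compose_def fc[OF m] fc[OF n] multiplier_linear[OF n])
    show "m \<otimes>\<^bsub>\<M>\<^esub> (c \<odot>\<^bsub>\<M>\<^esub> n) = c \<odot>\<^bsub>\<M>\<^esub> (m \<otimes>\<^bsub>\<M>\<^esub> n)"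
      by (intro multiplier_eqI cl m n) (simp_all add: compose_def fc[OF m] fc[OF n] multiplier_linear[OF m])
  next
    fix m n k assume "m \<in> carrier \<M>" "n \<in> carrier \<M>" "k \<in> carrier \<M>"
    then have m: "m \<in> multipliers A" and n: "n \<in> multipliers A" and k: "k \<in> multipliers A" by simp_all
    show "m \<otimes>\<^bsub>\<M>\<^esub> n \<otimes>\<^bsub>\<M>\<^esub> k = m \<otimes>\<^bsub>\<M>\<^esub> (n \<otimes>\<^bsub>\<M>\<^esub> k)"
      by (intro multiplier_eqI cl m n k) (simp_all add: compose_def fc[OF m] fc[OF n] fc[OF k])
    show "(m \<oplus>\<^bsub>\<M>\<^esub> n) \<otimes>\<^bsub>\<M>\<^esub> k = m \<otimes>\<^bsub>\<M>\<^esub> k \<oplus>\<^bsub>\<M>\<^esub> n \<otimes>\<^bsub>\<M>\<^esub> k"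
      by (intro multiplier_eqI cl m n k)
        (simp_all add: compose_def fc[OF m] fc[OF n] fc[OF k] multiplier_linear[OF k])
    show "k \<otimes>\<^bsub>\<M>\<^esub> (m \<oplus>\<^bsub>\<M>\<^esub> n) = k \<otimes>\<^bsub>\<M>\<^esub> m \<oplus>\<^bsub>\<M>\<^esub> k \<otimes>\<^bsub>\<M>\<^esub> n"
      by (intro multiplier_eqI cl m n k)
        (simp_all add: compose_def fc[OF m] fc[OF n] fc[OF k] multiplier_linear[OF k])
  qed
qed

section \<open>Compact balls and the predual of M(A)\<close>

lemma topspace_pairs: "topspace \<T> = (carrier A \<rightarrow>\<^sub>E carrier A) \<times> (carrier A \<rightarrow>\<^sub>E carrier A)"
  by simp

lemma multipliers_subset_topspace: "multipliers A \<subseteq> topspace \<T>"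
  unfolding topspace_pairs by (auto simp: multipliers_def)

lemma Hausdorff_pairs: "Hausdorff_space \<T>"
  by (simp add: Hausdorff_space_prod_topology Hausdorff_space_product_topology Hausdorff)

lemma continuous_map_pairs:
  "continuous_map X \<T> g \<longleftrightarrow> g \<in> topspace X \<rightarrow> topspace \<T> \<and>
     (\<forall>a\<in>carrier A. continuous_map X \<W> (\<lambda>x. fst (g x) a) \<and> continuous_map X \<W> (\<lambda>x. snd (g x) a))"
  (is "?l \<longleftrightarrow> ?r")
proof
  assume l: ?l
  then have "g \<in> topspace X \<rightarrow> topspace \<T>" by (rule continuous_map_funspace)
  then show ?r
    using l by (auto simp: continuous_map_pairwise continuous_map_componentwise o_def)
next
  assume ?r
  then show ?l
    by (fastforce simp: continuous_map_pairwise continuous_map_componentwise o_def topspace_pairs PiE_def Pi_iff)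
qed

lemma continuous_map_coordinate:
  assumes "a \<in> carrier A"
  shows "continuous_map \<T> \<W> (\<lambda>m. fst m a)" "continuous_map \<T> \<W> (\<lambda>m. snd m a)"
  using continuous_map_pairs[of \<T> "\<lambda>m. m"] assms by auto

text \<open>Both sides of a L(b) = R(a) b are continuous in (L, R) because the product of A is
  separately weak*-continuous, and \<open>\<W>\<close> is Hausdorff; so the equations are closed.
  They alone cut out the ball in the product, linearity being a consequence of faithfulness.\<close>

lemma compactin_nball_multipliers:
  assumes r: "0 \<le> r"
  shows "compactin \<T> (nball \<M> r)"
proof -
  define C where "C = (\<Inter>(a, b)\<in>carrier A \<times> carrier A. {m \<in> topspace \<T>. a \<otimes> fst m b = snd m a \<otimes> b})"
  have "closedin \<T> C"
    unfolding C_def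
  proof (intro closedin_INT)
    fix p assume "p \<in> carrier A \<times> carrier A"
    then obtain a b where p: "p = (a, b)" "a \<in> carrier A" "b \<in> carrier A" by blast
    have "closedin \<T> {m \<in> topspace \<T>. a \<otimes> fst m b = snd m a \<otimes> b}"
      using continuous_map_compose[OF continuous_map_coordinate(1)[OF p(3)] mult_left_continuous[OF p(2)]]
        continuous_map_compose[OF continuous_map_coordinate(2)[OF p(2)] mult_right_continuous[OF p(3)]]
      by (intro closedin_continuous_maps_eq[OF Hausdorff]) (simp_all only: o_def)
    then show "closedin \<T> (case p of (a, b) \<Rightarrow> {m \<in> topspace \<T>. a \<otimes> fst m b = snd m a \<otimes> b})"
      using p by simp
  qed (use zero_closed in blast)
  moreover define K where "K = PiE (carrier A) (\<lambda>a. nball A (r * nrm A a))"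
  have "compactin \<T> (K \<times> K)"
    by (simp add: K_def compactin_Times compactin_PiE banach_alaoglu)
  ultimately have "compactin \<T> (K \<times> K \<inter> C)" by (rule compact_Int_closedin[rotated])
  also have "K \<times> K \<inter> C = nball \<M> r"
  proof (intro equalityI subsetI)
    fix m assume m: "m \<in> K \<times> K \<inter> C"
    then have "fst m \<in> carrier A \<rightarrow>\<^sub>E carrier A" "snd m \<in> carrier A \<rightarrow>\<^sub>E carrier A"
      by (auto simp: K_def PiE_def nball_def)
    then have "m \<in> multipliers A"
      using m zero_closed by (cases m) (auto simp: C_def multipliers_def)
    then show "m \<in> nball \<M> r"
      using m by (auto simp: nball_multipliers[OF r] K_def PiE_iff)
  next
    fix m assume "m \<in> nball \<M> r"
    then have m: "m \<in> multipliers A"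
      "\<And>x. x \<in> carrier A \<Longrightarrow> fst m x \<in> nball A (r * nrm A x) \<and> snd m x \<in> nball A (r * nrm A x)"
      by (auto simp: nball_multipliers[OF r])
    have "m \<in> topspace \<T>" using m(1) multipliers_subset_topspace by blast
    then have "m \<in> C" using multiplier_facts(3)[OF m(1)] by (auto simp: C_def simp del: topspace_prod_topology)
    moreover have "m \<in> K \<times> K"
      using m(2) \<open>m \<in> topspace \<T>\<close> by (auto simp: K_def PiE_def)
    ultimately show "m \<in> K \<times> K \<inter> C" by blast
  qed
  finally show ?thesis .
qed

abbreviation "\<F> \<equiv> ball_continuous_functionals \<M> \<T>"
abbreviation "\<P> \<equiv> ball_predual \<M> \<T>"

text \<open>These functionals ensure that \<open>\<F>\<close> is large: they norm M(A), and they
  make the coordinates m a and a m weak*-continuous in m. The variable \<open>pr\<close> treats both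
  components at once.\<close>

lemma coordinate_functional:
  assumes pr: "pr = fst \<or> pr = snd" and a: "a \<in> carrier A" and e: "e \<in> carrier E"
  shows "(\<lambda>m\<in>multipliers A. \<phi> (pr m a) e) \<in> \<F>"
    and "m \<in> multipliers A \<Longrightarrow> cmod (\<phi> (pr m a) e) \<le> nrm \<M> m * nrm A a * nrm E e"
proof -
  let ?f = "\<lambda>m\<in>multipliers A. \<phi> (pr m a) e"
  have prA: "pr m a \<in> carrier A" if "m \<in> multipliers A" for m
    using multiplier_facts(1,2)[OF that a] pr by auto
  show bd: "cmod (\<phi> (pr m a) e) \<le> nrm \<M> m * nrm A a * nrm E e" if m: "m \<in> multipliers A" for m
  proof -
    have "cmod (\<phi> (pr m a) e) \<le> nrm A (pr m a) * nrm E e" by (rule bound[OF prA[OF m] e])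
    also have "nrm A (pr m a) \<le> nrm \<M> m * nrm A a" using multiplier_nrm_bound[OF m a] pr by auto
    then have "nrm A (pr m a) * nrm E e \<le> nrm \<M> m * nrm A a * nrm E e"
      using E.nrm_nonneg[OF e] by (intro mult_right_mono)
    finally show ?thesis .
  qed
  have "linear_functional \<M> ?f"
    unfolding linear_functional_def
  proof (intro conjI ballI allI)
    fix m n assume "m \<in> carrier \<M>" "n \<in> carrier \<M>"
    then have m: "m \<in> multipliers A" and n: "n \<in> multipliers A" by simp_all
    have "pr (m \<oplus>\<^bsub>\<M>\<^esub> n) a = pr m a \<oplus> pr n a" using pr a by auto
    then show "?f (m \<oplus>\<^bsub>\<M>\<^esub> n) = ?f m + ?f n"
      using mult_alg_closed(2)[OF m n] m n linear_functional_add[OF linear_left[OF e] prA[OF m] prA[OF n]]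
      by (simp del: mult_alg_simps)
  next
    fix c m assume "m \<in> carrier \<M>"
    then have m: "m \<in> multipliers A" by simp
    have "pr (c \<odot>\<^bsub>\<M>\<^esub> m) a = c \<odot> pr m a" using pr a by auto
    then show "?f (c \<odot>\<^bsub>\<M>\<^esub> m) = c * ?f m"
      using mult_alg_closed(3)[OF m, of c] m linear_functional_smult[OF linear_left[OF e] prA[OF m]]
      by (simp del: mult_alg_simps)
  qed
  moreover have "\<exists>K. \<forall>m\<in>carrier \<M>. cmod (?f m) \<le> K * nrm \<M> m"
    using bd by (intro exI[of _ "nrm A a * nrm E e"]) (simp add: mult_ac del: mult_alg_simps(6))
  moreover have "continuous_map (subtopology \<T> (nball \<M> r)) euclidean ?f" for r
  proof (rule continuous_map_eq)
    have "continuous_map \<T> \<W> (\<lambda>m. pr m a)" using continuous_map_coordinate[OF a] pr by auto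
    from continuous_map_compose[OF this continuous_map_pairing[OF e]]
    show "continuous_map (subtopology \<T> (nball \<M> r)) euclidean (\<lambda>m. \<phi> (pr m a) e)"
      by (intro continuous_map_from_subtopology) (simp add: o_def)
    show "\<phi> (pr m a) e = ?f m" if "m \<in> topspace (subtopology \<T> (nball \<M> r))" for m
      using that by (simp add: nball_def)
  qed
  ultimately show "?f \<in> \<F>"
    by (simp add: ball_continuous_functionals_def bounded_functionals_iff del: mult_alg_simps(6))
qed

text \<open>For a and e in the unit balls the coordinate functionals are contractive, and a common
  bound for their values at m bounds the operator norms of both components.\<close>

lemma predual_multiplier_algebra: "predual \<M> \<P> (evaluation \<F>)"
proof -
  interpret M: normed_cspace \<M> by (rule normed_multiplier_algebra)
  show ?thesis
  proof (rule M.dixmier_ng[OF compactin_nball_multipliers])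
    fix m K
    assume "m \<in> carrier \<M>"
      and K: "\<And>f. f \<in> \<F> \<Longrightarrow> (\<And>n. n \<in> carrier \<M> \<Longrightarrow> cmod (f n) \<le> nrm \<M> n) \<Longrightarrow> cmod (f m) \<le> K"
    then have m: "m \<in> multipliers A" by simp
    have "nrm A (pr m a) \<le> K" if pr: "pr = fst \<or> pr = snd" and a: "a \<in> nball A 1" for pr a
    proof (rule nrm_le)
      show "pr m a \<in> carrier A" using multiplier_facts(1,2)[OF m] pr a by (auto simp: nball_def)
      fix e assume e: "e \<in> nball E 1"
      have ae: "a \<in> carrier A" "e \<in> carrier E" "nrm A a \<le> 1" "nrm E e \<le> 1"
        using a e by (auto simp: nball_def)
      let ?f = "\<lambda>m\<in>multipliers A. \<phi> (pr m a) e"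
      have "cmod (?f m) \<le> K"
      proof (rule K)
        show "?f \<in> \<F>" by (rule coordinate_functional(1)[OF pr ae(1,2)])
        fix n assume "n \<in> carrier \<M>"
        then have n: "n \<in> multipliers A" by simp
        have "cmod (\<phi> (pr n a) e) \<le> nrm \<M> n * nrm A a * nrm E e"
          by (rule coordinate_functional(2)[OF pr ae(1,2) n])
        also have "\<dots> \<le> nrm \<M> n * 1 * 1"
          using ae multiplier_nrm_nonneg[OF n] E.nrm_nonneg
          by (intro mult_mono mult_nonneg_nonneg) auto
        finally show "cmod (?f n) \<le> nrm \<M> n" using n by simp
      qed
      then show "cmod (\<phi> (pr m a) e) \<le> K" using m by simp
    qed
    then show "nrm \<M> m \<le> K" by (simp add: op_norm_le)
  qed
qed

sublocale M: predual_pair \<M> \<P> "evaluation \<F>"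
proof -
  interpret N: normed_cspace \<M> by (rule normed_multiplier_algebra)
  interpret P: banach_space \<P> using predual_multiplier_algebra by (simp add: predual_def)
  show "predual_pair \<M> \<P> (evaluation \<F>)"
    by unfold_locales (use predual_multiplier_algebra in \<open>simp add: predual_def\<close>)
qed

end

section \<open>Continuity of the product and agreement on bounded nets\<close>

context faithful_dual_algebra
begin

text \<open>In each product one component is again a coordinate of m, while the other applies a
  fixed multiplier to a coordinate of m. The latter is continuous on balls, and this confines the
  claim to balls.\<close>

lemma continuous_into_pairs_mult:
  assumes n: "n \<in> multipliers A" and r: "0 \<le> r"
  shows "continuous_map (subtopology \<T> (nball \<M> r)) \<T> (\<lambda>m. m \<otimes>\<^bsub>\<M>\<^esub> n)"
    and "continuous_map (subtopology \<T> (nball \<M> r)) \<T> (\<lambda>m. n \<otimes>\<^bsub>\<M>\<^esub> m)"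
proof -
  let ?X = "subtopology \<T> (nball \<M> r)"
  have nn: "(fst n, snd n) \<in> multipliers A" using n by simp
  have ball: "m \<in> multipliers A" "fst m a \<in> nball A (r * nrm A a)" "snd m a \<in> nball A (r * nrm A a)"
    if "m \<in> topspace ?X" "a \<in> carrier A" for m a
    using that nball_multipliers[OF r, of m] by auto
  have mult: "m \<in> multipliers A" if "m \<in> topspace ?X" for m
    using that nball_multipliers[OF r, of m] by auto
  have coord: "continuous_map ?X \<W> (\<lambda>m. fst m a)" "continuous_map ?X \<W> (\<lambda>m. snd m a)"
    if "a \<in> carrier A" for a
    using continuous_map_coordinate[OF that] by (auto intro: continuous_map_from_subtopology)
  have coord': "continuous_map ?X (subtopology \<W> (nball A (r * nrm A a))) (\<lambda>m. fst m a)"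
    "continuous_map ?X (subtopology \<W> (nball A (r * nrm A a))) (\<lambda>m. snd m a)" if a: "a \<in> carrier A" for a
    using coord[OF a] ball[OF _ a] by (auto simp only: continuous_map_in_subtopology Pi_iff)
  have top: "(\<lambda>m. m \<otimes>\<^bsub>\<M>\<^esub> n) \<in> topspace ?X \<rightarrow> topspace \<T>" "(\<lambda>m. n \<otimes>\<^bsub>\<M>\<^esub> m) \<in> topspace ?X \<rightarrow> topspace \<T>"
    using mult_alg_closed(4) mult n multipliers_subset_topspace by blast+
  show "continuous_map ?X \<T> (\<lambda>m. m \<otimes>\<^bsub>\<M>\<^esub> n)"
    unfolding continuous_map_pairs
  proof (intro conjI ballI top)
    fix a assume a: "a \<in> carrier A"
    show "continuous_map ?X \<W> (\<lambda>m. fst (m \<otimes>\<^bsub>\<M>\<^esub> n) a)"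
      using coord(1)[OF multiplier_facts(1)[OF n a]] a by (simp add: compose_def)
    have "continuous_map ?X \<W> (snd n \<circ> (\<lambda>m. snd m a))"
      by (rule continuous_map_compose[OF coord'(2)[OF a] right_multiplier_continuous[OF nn]])
    then show "continuous_map ?X \<W> (\<lambda>m. snd (m \<otimes>\<^bsub>\<M>\<^esub> n) a)"
      using a by (simp add: compose_def o_def)
  qed
  show "continuous_map ?X \<T> (\<lambda>m. n \<otimes>\<^bsub>\<M>\<^esub> m)"
    unfolding continuous_map_pairs
  proof (intro conjI ballI top)
    fix a assume a: "a \<in> carrier A"
    show "continuous_map ?X \<W> (\<lambda>m. snd (n \<otimes>\<^bsub>\<M>\<^esub> m) a)"
      using coord(2)[OF multiplier_facts(2)[OF n a]] a by (simp add: compose_def)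
    have "continuous_map ?X \<W> (fst n \<circ> (\<lambda>m. fst m a))"
      by (rule continuous_map_compose[OF coord'(1)[OF a] left_multiplier_continuous[OF nn]])
    then show "continuous_map ?X \<W> (\<lambda>m. fst (n \<otimes>\<^bsub>\<M>\<^esub> m) a)"
      using a by (simp add: compose_def o_def)
  qed
qed

text \<open>Such a map has a pre-adjoint: composition with it preserves \<open>\<F>\<close>.\<close>

lemma continuous_map_weak_star_multiplier:
  assumes g: "\<And>m. m \<in> multipliers A \<Longrightarrow> g m \<in> multipliers A"
    and add: "\<And>m n. m \<in> multipliers A \<Longrightarrow> n \<in> multipliers A \<Longrightarrow> g (m \<oplus>\<^bsub>\<M>\<^esub> n) = g m \<oplus>\<^bsub>\<M>\<^esub> g n"
    and smult: "\<And>c m. m \<in> multipliers A \<Longrightarrow> g (c \<odot>\<^bsub>\<M>\<^esub> m) = c \<odot>\<^bsub>\<M>\<^esub> g m"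
    and K: "0 \<le> K" "\<And>m. m \<in> multipliers A \<Longrightarrow> nrm \<M> (g m) \<le> K * nrm \<M> m"
    and cont: "\<And>r. 0 \<le> r \<Longrightarrow> continuous_map (subtopology \<T> (nball \<M> r)) \<T> g"
  shows "continuous_map M.\<W> M.\<W> g"
  unfolding M.continuous_map_weak_star
proof (intro conjI ballI)
  show "g \<in> topspace M.\<W> \<rightarrow> carrier \<M>" using g by simp
  fix f assume "f \<in> carrier \<P>"
  then have f: "f \<in> \<F>" by simp
  then have fB: "f \<in> bounded_functionals \<M>" "linear_functional \<M> f"
    by (auto simp: ball_continuous_functionals_def bounded_functionals_iff)
  let ?h = "\<lambda>m\<in>multipliers A. f (g m)"
  have "linear_functional \<M> ?h"
    unfolding linear_functional_def
  proof (intro conjI ballI allI)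
    fix m n assume "m \<in> carrier \<M>" "n \<in> carrier \<M>"
    then have mn: "m \<in> multipliers A" "n \<in> multipliers A" by simp_all
    then show "?h (m \<oplus>\<^bsub>\<M>\<^esub> n) = ?h m + ?h n"
      using mult_alg_closed(2)[OF mn] linear_functional_add[OF fB(2), of "g m" "g n"] g
      by (simp add: add del: mult_alg_simps(3))
  next
    fix c m assume "m \<in> carrier \<M>"
    then have m: "m \<in> multipliers A" by simp
    then show "?h (c \<odot>\<^bsub>\<M>\<^esub> m) = c * ?h m"
      using mult_alg_closed(3)[OF m, of c] linear_functional_smult[OF fB(2), of "g m" c] g
      by (simp add: smult del: mult_alg_simps(4))
  qed
  moreover have "cmod (?h m) \<le> (op_norm \<M> cmod f * K) * nrm \<M> m" if "m \<in> carrier \<M>" for m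
  proof -
    have m: "m \<in> multipliers A" using that by simp
    have "cmod (f (g m)) \<le> op_norm \<M> cmod f * nrm \<M> (g m)"
      using M.V.functional_bound[OF fB(1), of "g m"] g[OF m] by simp
    also have "\<dots> \<le> op_norm \<M> cmod f * (K * nrm \<M> m)"
      by (intro mult_left_mono K(2)[OF m] M.V.functional_op_norm_nonneg[OF fB(1)])
    finally show ?thesis using m by (simp add: mult.assoc del: mult_alg_simps(6))
  qed
  then have "\<exists>K. \<forall>m\<in>carrier \<M>. cmod (?h m) \<le> K * nrm \<M> m" by blast
  moreover have "continuous_map (subtopology \<T> (nball \<M> r)) euclidean ?h" for r
  proof (rule continuous_map_from_subtopology_mono)
    show "nball \<M> r \<subseteq> nball \<M> \<bar>r\<bar>" by (auto simp: nball_def)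
    let ?X = "subtopology \<T> (nball \<M> \<bar>r\<bar>)"
    \<comment> \<open>The map leaves the given ball but lands in a larger one, where f is continuous
      as well.\<close>
    have "g m \<in> nball \<M> (K * \<bar>r\<bar>)" if "m \<in> nball \<M> \<bar>r\<bar>" for m
    proof -
      have m: "m \<in> multipliers A" "nrm \<M> m \<le> \<bar>r\<bar>" using that by (auto simp: nball_def)
      have "nrm \<M> (g m) \<le> K * \<bar>r\<bar>"
        by (rule order_trans[OF K(2)[OF m(1)] mult_left_mono[OF m(2) K(1)]])
      then show ?thesis using g[OF m(1)] by (simp add: nball_def del: mult_alg_simps(6))
    qed
    then have "continuous_map ?X (subtopology \<T> (nball \<M> (K * \<bar>r\<bar>))) g"
      using cont[of "\<bar>r\<bar>"] by (auto simp: continuous_map_in_subtopology simp del: topspace_prod_topology)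
    moreover have "continuous_map (subtopology \<T> (nball \<M> (K * \<bar>r\<bar>))) euclidean f"
      using f by (simp add: ball_continuous_functionals_def)
    ultimately have "continuous_map ?X euclidean (f \<circ> g)" by (rule continuous_map_compose)
    then show "continuous_map ?X euclidean ?h"
      by (rule continuous_map_eq) (auto simp: nball_def)
  qed
  ultimately have h: "?h \<in> \<F>"
    by (simp add: ball_continuous_functionals_def bounded_functionals_iff del: mult_alg_simps(6))
  then have "continuous_map M.\<W> euclidean (\<lambda>m. evaluation \<F> m ?h)"
    using M.continuous_map_pairing[of ?h] by simp
  then show "continuous_map M.\<W> euclidean (\<lambda>m. evaluation \<F> (g m) f)"
    by (rule continuous_map_eq) (use h f in \<open>simp add: evaluation_def\<close>)
qed

lemma dual_banach_algebra_multiplier_algebra: "dual_banach_algebra \<M> \<P> (evaluation \<F>)"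
proof -
  interpret MA: banach_algebra \<M>
    by (rule banach_algebra_multiplier_algebra[OF M.banach_space_of_dual])
  have "continuous_map M.\<W> M.\<W> (\<lambda>m. m \<otimes>\<^bsub>\<M>\<^esub> n)" if "n \<in> carrier \<M>" for n
  proof (rule continuous_map_weak_star_multiplier[where K = "nrm \<M> n"])
    have n: "n \<in> multipliers A" using that by simp
    show "0 \<le> nrm \<M> n" by (rule multiplier_nrm_nonneg[OF n])
    show "continuous_map (subtopology \<T> (nball \<M> r)) \<T> (\<lambda>m. m \<otimes>\<^bsub>\<M>\<^esub> n)" if "0 \<le> r" for r
      by (rule continuous_into_pairs_mult(1)[OF n that])
    fix m assume m: "m \<in> multipliers A"
    show "m \<otimes>\<^bsub>\<M>\<^esub> n \<in> multipliers A" by (rule mult_alg_closed(4)[OF m n])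
    show "nrm \<M> (m \<otimes>\<^bsub>\<M>\<^esub> n) \<le> nrm \<M> n * nrm \<M> m"
      using MA.nrm_mult[of m n] m n by (simp only: mult.commute mult_alg_simps(1))
    show "(c \<odot>\<^bsub>\<M>\<^esub> m) \<otimes>\<^bsub>\<M>\<^esub> n = c \<odot>\<^bsub>\<M>\<^esub> (m \<otimes>\<^bsub>\<M>\<^esub> n)" for c
      using MA.smult_mult_left[of m n c] m n by (simp only: mult_alg_simps(1))
    fix k assume k: "k \<in> multipliers A"
    show "(m \<oplus>\<^bsub>\<M>\<^esub> k) \<otimes>\<^bsub>\<M>\<^esub> n = m \<otimes>\<^bsub>\<M>\<^esub> n \<oplus>\<^bsub>\<M>\<^esub> k \<otimes>\<^bsub>\<M>\<^esub> n"
      using MA.distrib_right[of m k n] m n k by (simp only: mult_alg_simps(1))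
  qed
  moreover have "continuous_map M.\<W> M.\<W> (\<lambda>m. n \<otimes>\<^bsub>\<M>\<^esub> m)" if "n \<in> carrier \<M>" for n
  proof (rule continuous_map_weak_star_multiplier[where K = "nrm \<M> n"])
    have n: "n \<in> multipliers A" using that by simp
    show "0 \<le> nrm \<M> n" by (rule multiplier_nrm_nonneg[OF n])
    show "continuous_map (subtopology \<T> (nball \<M> r)) \<T> (\<lambda>m. n \<otimes>\<^bsub>\<M>\<^esub> m)" if "0 \<le> r" for r
      by (rule continuous_into_pairs_mult(2)[OF n that])
    fix m assume m: "m \<in> multipliers A"
    show "n \<otimes>\<^bsub>\<M>\<^esub> m \<in> multipliers A" by (rule mult_alg_closed(4)[OF n m])
    show "nrm \<M> (n \<otimes>\<^bsub>\<M>\<^esub> m) \<le> nrm \<M> n * nrm \<M> m"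
      using MA.nrm_mult[of n m] m n by (simp only: mult_alg_simps(1))
    show "n \<otimes>\<^bsub>\<M>\<^esub> (c \<odot>\<^bsub>\<M>\<^esub> m) = c \<odot>\<^bsub>\<M>\<^esub> (n \<otimes>\<^bsub>\<M>\<^esub> m)" for c
      using MA.smult_mult_right[of n m c] m n by (simp only: mult_alg_simps(1))
    fix k assume k: "k \<in> multipliers A"
    show "n \<otimes>\<^bsub>\<M>\<^esub> (m \<oplus>\<^bsub>\<M>\<^esub> k) = n \<otimes>\<^bsub>\<M>\<^esub> m \<oplus>\<^bsub>\<M>\<^esub> n \<otimes>\<^bsub>\<M>\<^esub> k"
      using MA.distrib_left[of m k n] m n k by (simp only: mult_alg_simps(1))
  qed
  ultimately show ?thesis
    using MA.banach_algebra_axioms predual_multiplier_algebra by (simp add: dual_banach_algebra_def)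
qed

section \<open>The embedding of A into M(A)\<close>

abbreviation "\<iota> \<equiv> multiplier_embedding A"

lemma embedding_multiplier: "a \<in> carrier A \<Longrightarrow> \<iota> a \<in> multipliers A"
  unfolding multiplier_embedding_def by (intro multipliersI) (auto simp: mult_closed mult_assoc)

lemma fst_embedding: "b \<in> carrier A \<Longrightarrow> fst (\<iota> a) b = a \<otimes> b"
  by (simp add: multiplier_embedding_def)

lemma snd_embedding: "b \<in> carrier A \<Longrightarrow> snd (\<iota> a) b = b \<otimes> a"
  by (simp add: multiplier_embedding_def)

lemma embedding_in_nball:
  assumes a: "a \<in> nball A r"
  shows "\<iota> a \<in> nball \<M> r"
proof -
  have aA: "a \<in> carrier A" "nrm A a \<le> r" using a by (auto simp: nball_def)
  have r: "0 \<le> r" using order_trans[OF nrm_nonneg[OF aA(1)] aA(2)] .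
  have "nrm A (a \<otimes> x) \<le> r * nrm A x" "nrm A (x \<otimes> a) \<le> r * nrm A x" if x: "x \<in> carrier A" for x
    using order_trans[OF nrm_mult[OF aA(1) x] mult_right_mono[OF aA(2) nrm_nonneg[OF x]]]
      order_trans[OF nrm_mult[OF x aA(1)] mult_left_mono[OF aA(2) nrm_nonneg[OF x]]]
    by (simp_all add: mult.commute[of r])
  then show ?thesis
    unfolding nball_multipliers[OF r]
    using embedding_multiplier[OF aA(1)] aA(1)
    by (auto simp: fst_embedding snd_embedding nball_def mult_closed)
qed

text \<open>The elements of \<open>\<F>\<close> are \<open>\<T>\<close>-continuous on balls, so the
  claim is made ball by ball; bounded nets ask for no more.\<close>

lemma embedding_continuous: "continuous_map (subtopology \<W> (nball A r)) M.\<W> \<iota>"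
  unfolding M.continuous_map_weak_star
proof (intro conjI ballI)
  let ?X = "subtopology \<W> (nball A r)"
  show "\<iota> \<in> topspace ?X \<rightarrow> carrier \<M>" using embedding_multiplier by auto
  fix f assume "f \<in> carrier \<P>"
  then have f: "f \<in> \<F>" by simp
  have "continuous_map ?X \<T> \<iota>"
    unfolding continuous_map_pairs
  proof (intro conjI ballI)
    show "\<iota> \<in> topspace ?X \<rightarrow> topspace \<T>"
      using embedding_multiplier multipliers_subset_topspace by fastforce
    fix a assume a: "a \<in> carrier A"
    show "continuous_map ?X \<W> (\<lambda>x. fst (\<iota> x) a)" "continuous_map ?X \<W> (\<lambda>x. snd (\<iota> x) a)"
      using mult_right_continuous[OF a] mult_left_continuous[OF a] a
      by (auto simp: fst_embedding snd_embedding intro: continuous_map_from_subtopology)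
  qed
  then have "continuous_map ?X (subtopology \<T> (nball \<M> r)) \<iota>"
    using embedding_in_nball by (auto simp: continuous_map_in_subtopology)
  moreover have "continuous_map (subtopology \<T> (nball \<M> r)) euclidean f"
    using f by (simp add: ball_continuous_functionals_def)
  ultimately have "continuous_map ?X euclidean (f \<circ> \<iota>)" by (rule continuous_map_compose)
  then show "continuous_map ?X euclidean (\<lambda>x. evaluation \<F> (\<iota> x) f)"
    using f by (simp add: evaluation_def o_def)
qed

lemma agree_multiplier_algebra: "agree_on_bounded_nets A \<W> M.\<W>"
  unfolding agree_on_bounded_nets_def
proof (intro allI ballI impI)
  fix F :: "'a filter" and K a
  assume a: "a \<in> carrier A" and ev: "\<forall>\<^sub>F x in F. x \<in> carrier A \<and> nrm A x \<le> K"
  \<comment> \<open>The radius includes the norm of a, so that the limit lies in the compact ball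
    together with the net.\<close>
  define r where "r = max K (nrm A a)"
  let ?X = "subtopology \<W> (nball A r)"
  have aB: "a \<in> nball A r" using a by (simp add: nball_def r_def)
  have evB: "\<forall>\<^sub>F x in F. x \<in> nball A r"
    using ev by eventually_elim (simp add: nball_def r_def le_max_iff_disj)
  have top: "topspace ?X = nball A r" by (auto simp: nball_def)
  have X_iff: "limitin ?X (\<lambda>x. x) a F \<longleftrightarrow> limitin \<W> (\<lambda>x. x) a F"
    using aB evB by (simp add: limitin_subtopology)
  show "limitin \<W> (\<lambda>x. x) a F \<longleftrightarrow> limitin M.\<W> \<iota> (\<iota> a) F"
  proof
    assume "limitin \<W> (\<lambda>x. x) a F"
    then have "limitin M.\<W> (\<iota> \<circ> (\<lambda>x. x)) (\<iota> a) F"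
      using X_iff by (intro continuous_map_limit[OF embedding_continuous[of r]]) simp
    then show "limitin M.\<W> \<iota> (\<iota> a) F" by (simp add: o_def)
  next
    assume lim: "limitin M.\<W> \<iota> (\<iota> a) F"
    let ?Y = "product_topology (\<lambda>_. \<W>) (carrier A)"
    have "continuous_map M.\<W> \<W> (\<lambda>m. fst m b)" if b: "b \<in> carrier A" for b
      unfolding continuous_map_weak_star
    proof (intro conjI ballI)
      show "(\<lambda>m. fst m b) \<in> topspace M.\<W> \<rightarrow> carrier A" using multiplier_facts(1)[OF _ b] by simp
      fix e assume e: "e \<in> carrier E"
      let ?f = "\<lambda>m\<in>multipliers A. \<phi> (fst m b) e"
      have f: "?f \<in> \<F>" by (rule coordinate_functional(1)[OF _ b e]) simp
      then have "continuous_map M.\<W> euclidean (\<lambda>m. evaluation \<F> m ?f)"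
        using M.continuous_map_pairing[of ?f] by simp
      then show "continuous_map M.\<W> euclidean (\<lambda>m. \<phi> (fst m b) e)"
        by (rule continuous_map_eq) (use f in \<open>simp add: evaluation_def\<close>)
    qed
    then have fst_cont: "continuous_map M.\<W> ?Y fst"
      using multiplierD(4) by (auto simp: continuous_map_componentwise)
    show "limitin \<W> (\<lambda>x. x) a F"
      unfolding X_iff[symmetric]
    proof (rule limitin_compact_injective)
      show "compact_space ?X" using banach_alaoglu[of r] by (simp add: compactin_subspace)
      show "Hausdorff_space ?Y" by (simp add: Hausdorff_space_product_topology Hausdorff)
      show "continuous_map ?X ?Y (fst \<circ> \<iota>)"
        by (rule continuous_map_compose[OF embedding_continuous fst_cont])
      show "limitin ?Y (fst \<circ> \<iota>) ((fst \<circ> \<iota>) a) F"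
        using continuous_map_limit[OF fst_cont lim] by simp
      show "inj_on (fst \<circ> \<iota>) (topspace ?X)"
      proof (rule inj_onI)
        fix x y assume "x \<in> topspace ?X" "y \<in> topspace ?X" and eq: "(fst \<circ> \<iota>) x = (fst \<circ> \<iota>) y"
        then have "x \<in> carrier A" "y \<in> carrier A" by auto
        moreover have "x \<otimes> b = y \<otimes> b" if "b \<in> carrier A" for b
          using fun_cong[OF eq, of b] that by (simp add: fst_embedding)
        ultimately show "x = y" by (rule right_cancel)
      qed
      show "a \<in> topspace ?X" "\<forall>\<^sub>F x in F. x \<in> topspace ?X" using aB evB unfolding top by simp_all
    qed
  qed
qed

text \<open>A is a left ideal of M(A): the first components agree by L(a b) = L(a) b, the second by
  the multiplier identity.\<close>

lemma embedding_mult_left: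
  "m \<in> multipliers A \<Longrightarrow> a \<in> carrier A \<Longrightarrow> m \<otimes>\<^bsub>\<M>\<^esub> \<iota> a = \<iota> (fst m a)"
  using left_multiplier_mult[of "fst m" "snd m"] multiplier_facts[of m]
  by (intro multiplier_eqI mult_alg_closed(4) embedding_multiplier)
    (auto simp: compose_def fst_embedding snd_embedding)

lemma embedding_mult_right:
  "m \<in> multipliers A \<Longrightarrow> a \<in> carrier A \<Longrightarrow> \<iota> a \<otimes>\<^bsub>\<M>\<^esub> m = \<iota> (snd m a)"
  using right_multiplier_mult[of "fst m" "snd m"] multiplier_facts[of m]
  by (intro multiplier_eqI mult_alg_closed(4) embedding_multiplier)
    (auto simp: compose_def fst_embedding snd_embedding)

text \<open>Multiplying a bounded convergent net of multipliers by an element of \<open>A\<close> produces a net in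
  \<open>A\<close>, to which the agreement hypothesis applies. Hence such a weak*-topology is finer than \<open>\<T>\<close> on
  the unit ball, and by compactness equal to it.\<close>

lemma unit_ball_topology:
  fixes P :: "('p, 'n2) normed_module_scheme"
  assumes dba: "dual_banach_algebra \<M> P \<psi>"
    and agree: "agree_on_bounded_nets A \<W> (weak_star \<M> P \<psi>)"
  shows "predual_pair \<M> P \<psi>"
    and "subtopology (weak_star \<M> P \<psi>) (nball \<M> 1) = subtopology \<T> (nball \<M> 1)"
proof -
  interpret P: banach_space P using dba by (simp add: dual_banach_algebra_def predual_def)
  show pair: "predual_pair \<M> P \<psi>"
    by unfold_locales (use dba in \<open>simp add: dual_banach_algebra_def predual_def\<close>)
  then interpret N: predual_pair \<M> P \<psi> .
  let ?X = "subtopology N.\<W> (nball \<M> 1)"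
  have top: "topspace ?X = nball \<M> 1" by (auto simp: nball_def simp del: mult_alg_simps(6))
  have X: "m \<in> multipliers A" "a \<in> carrier A \<Longrightarrow> fst m a \<in> nball A (nrm A a)"
    "a \<in> carrier A \<Longrightarrow> snd m a \<in> nball A (nrm A a)" if "m \<in> topspace ?X" for m a
    using that nball_multipliers[of 1 m] unfolding top by simp_all
  \<comment> \<open>Here \<open>pr\<close> will be m a or a m, and g multiplication by the image of
    a in M(A). Weak*-continuity of g concerns M(A); the agreement hypothesis brings it down to
    A.\<close>
  have key: "continuous_map ?X \<W> pr"
    if pr: "\<And>m. m \<in> topspace ?X \<Longrightarrow> pr m \<in> nball A r"
      and cont: "continuous_map N.\<W> N.\<W> g" and g: "\<And>m. m \<in> topspace ?X \<Longrightarrow> g m = \<iota> (pr m)" for pr g r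
    unfolding continuous_map_atin
  proof
    fix m0 assume m0: "m0 \<in> topspace ?X"
    \<comment> \<open>The net is the punctured neighbourhood filter of m0, whose image under
      \<open>pr\<close> is a bounded filter on A.\<close>
    let ?F = "atin ?X m0"
    have ev: "\<forall>\<^sub>F m in ?F. m \<in> topspace ?X"
      using openin_topspace[of ?X] m0 unfolding eventually_atin by blast
    have "continuous_map ?X N.\<W> (\<lambda>m. \<iota> (pr m))"
      by (rule continuous_map_eq[OF continuous_map_from_subtopology[OF cont] g])
    then have "limitin N.\<W> (\<lambda>m. \<iota> (pr m)) (\<iota> (pr m0)) ?F"
      using m0 by (intro limitin_continuous_map) auto
    then have "limitin N.\<W> \<iota> (\<iota> (pr m0)) (filtermap pr ?F)"
      by (simp add: limitin_def eventually_filtermap)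
    moreover have "\<forall>\<^sub>F x in filtermap pr ?F. x \<in> carrier A \<and> nrm A x \<le> r"
      unfolding eventually_filtermap using ev by eventually_elim (use pr in \<open>auto simp: nball_def\<close>)
    moreover have "pr m0 \<in> carrier A" using pr[OF m0] by (simp add: nball_def)
    ultimately have "limitin \<W> (\<lambda>x. x) (pr m0) (filtermap pr ?F)"
      using agree unfolding agree_on_bounded_nets_def by blast
    then show "limitin \<W> pr (pr m0) ?F"
      by (simp add: limitin_def eventually_filtermap)
  qed
  have cont: "continuous_map N.\<W> N.\<W> (\<lambda>m. m \<otimes>\<^bsub>\<M>\<^esub> n)" "continuous_map N.\<W> N.\<W> (\<lambda>m. n \<otimes>\<^bsub>\<M>\<^esub> m)"
    if "n \<in> multipliers A" for n
    using dba that by (simp_all add: dual_banach_algebra_def del: mult_alg_simps(5))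
  show "?X = subtopology \<T> (nball \<M> 1)"
  proof (rule subtopology_eq_compact[OF N.banach_alaoglu _ Hausdorff_pairs])
    show "continuous_map ?X \<T> (\<lambda>m. m)"
      unfolding continuous_map_pairs
    proof (intro conjI ballI)
      show "(\<lambda>m. m) \<in> topspace ?X \<rightarrow> topspace \<T>" using X(1) multipliers_subset_topspace by blast
      fix a assume a: "a \<in> carrier A"
      show "continuous_map ?X \<W> (\<lambda>m. fst m a)"
        by (rule key[OF X(2)[OF _ a] cont(1)[OF embedding_multiplier[OF a]] embedding_mult_left[OF X(1) a]])
      show "continuous_map ?X \<W> (\<lambda>m. snd m a)"
        by (rule key[OF X(3)[OF _ a] cont(2)[OF embedding_multiplier[OF a]] embedding_mult_right[OF X(1) a]])
    qed
  qed
qed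

end

section \<open>Uniqueness\<close>

lemma weak_star_mono_of_unit_ball:
  assumes "predual_pair V P \<psi>" and "predual_pair V Q \<theta>"
    and eq: "subtopology (weak_star V P \<psi>) (nball V 1) = subtopology (weak_star V Q \<theta>) (nball V 1)"
  shows "continuous_map (weak_star V Q \<theta>) (weak_star V P \<psi>) (\<lambda>v. v)"
proof -
  interpret P: predual_pair V P \<psi> by fact
  interpret Q: predual_pair V Q \<theta> by fact
  show ?thesis
    unfolding P.continuous_map_weak_star
  proof (intro conjI ballI)
    fix p assume p: "p \<in> carrier P"
    \<comment> \<open>Equality on the unit ball transfers continuity from one predual to the other;
      the representation theorem then yields an element of Q, whose pairing is continuous
      everywhere.\<close>
    have "continuous_map (subtopology Q.\<W> (nball V 1)) euclidean (\<lambda>v. \<psi> v p)"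
      unfolding eq[symmetric] by (intro continuous_map_from_subtopology P.continuous_map_pairing p)
    then obtain q where q: "q \<in> carrier Q" "\<And>v. v \<in> carrier V \<Longrightarrow> \<psi> v p = \<theta> v q"
      using Q.weak_star_continuous_functional[OF P.linear_left[OF p]] by blast
    show "continuous_map Q.\<W> euclidean (\<lambda>v. \<psi> v p)"
      by (rule continuous_map_eq[OF Q.continuous_map_pairing[OF q(1)]]) (simp add: q(2))
  qed simp
qed

lemma weak_star_eq_of_unit_ball:
  assumes P: "predual_pair V P \<psi>" and Q: "predual_pair V Q \<theta>"
    and eq: "subtopology (weak_star V P \<psi>) (nball V 1) = subtopology (weak_star V Q \<theta>) (nball V 1)"
  shows "weak_star V P \<psi> = weak_star V Q \<theta>"
proof -
  have "homeomorphic_maps (weak_star V P \<psi>) (weak_star V Q \<theta>) (\<lambda>v. v) (\<lambda>v. v)"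
    using weak_star_mono_of_unit_ball[OF P Q eq] weak_star_mono_of_unit_ball[OF Q P eq[symmetric]]
    by (simp add: homeomorphic_maps_def)
  then have "homeomorphic_map (weak_star V P \<psi>) (weak_star V Q \<theta>) id"
    unfolding id_def by (rule homeomorphic_maps_imp_map)
  then show ?thesis by simp
qed

text \<open>The constructed predual consists of functionals on M(A), which fixes its type.
  Uniqueness compares preduals over two arbitrary and possibly different types.\<close>

theorem theorem7p7:
  fixes A :: "'a normed_module" and E :: "'e normed_module" and \<phi> :: "'a \<Rightarrow> 'e \<Rightarrow> complex"
  assumes "dual_banach_algebra A E \<phi>" and "faithful A"
  shows "(\<exists>(P :: ('a multiplier \<Rightarrow> complex) normed_module) \<psi>.
        dual_banach_algebra (multiplier_algebra A) P \<psi> \<and>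
        agree_on_bounded_nets A (weak_star A E \<phi>) (weak_star (multiplier_algebra A) P \<psi>))
    \<and> (\<forall>(P :: 'p normed_module) \<psi> (Q :: 'q normed_module) \<theta>.
        dual_banach_algebra (multiplier_algebra A) P \<psi> \<and>
        agree_on_bounded_nets A (weak_star A E \<phi>) (weak_star (multiplier_algebra A) P \<psi>) \<and>
        dual_banach_algebra (multiplier_algebra A) Q \<theta> \<and>
        agree_on_bounded_nets A (weak_star A E \<phi>) (weak_star (multiplier_algebra A) Q \<theta>) \<longrightarrow>
        weak_star (multiplier_algebra A) P \<psi> = weak_star (multiplier_algebra A) Q \<theta>)"
proof -
  interpret A: banach_algebra A using assms(1) by (simp add: dual_banach_algebra_def)
  interpret E: banach_space E using assms(1) by (simp add: dual_banach_algebra_def predual_def)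
  interpret faithful_dual_algebra A E \<phi>
    by unfold_locales (use assms in \<open>auto simp: dual_banach_algebra_def predual_def\<close>)
  show ?thesis
  proof (intro conjI allI impI)
    show "\<exists>(P :: ('a multiplier \<Rightarrow> complex) normed_module) \<psi>.
        dual_banach_algebra (multiplier_algebra A) P \<psi> \<and>
        agree_on_bounded_nets A (weak_star A E \<phi>) (weak_star (multiplier_algebra A) P \<psi>)"
      using dual_banach_algebra_multiplier_algebra agree_multiplier_algebra by blast
    fix P :: "'p normed_module" and \<psi> and Q :: "'q normed_module" and \<theta>
    assume "dual_banach_algebra (multiplier_algebra A) P \<psi> \<and>
        agree_on_bounded_nets A (weak_star A E \<phi>) (weak_star (multiplier_algebra A) P \<psi>) \<and>
        dual_banach_algebra (multiplier_algebra A) Q \<theta> \<and>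
        agree_on_bounded_nets A (weak_star A E \<phi>) (weak_star (multiplier_algebra A) Q \<theta>)"
    then show "weak_star (multiplier_algebra A) P \<psi> = weak_star (multiplier_algebra A) Q \<theta>"
      by (intro weak_star_eq_of_unit_ball) (simp_all add: unit_ball_topology)
  qed
qed

end
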